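(* In the setting described in the context, let $B_n=(b_{n,ij})$ be random symmetric $n\times n$ matrices, independent of $X,Y$, such that for some finite $\beta$, $\|B_n\|\le\beta$ for all $n$, and $$n^{-1}\sum_{i=1}^nb_{n,ii}^2\to\omega,\qquad n^{-1}\mathrm{tr}\,B_n^2\to\theta,\qquad(n^{-1}\mathrm{tr}\,B_n)^2\to\phi$$ in probability, with $\omega,\theta,\phi$ all finite. Define $Z_n\in\mathbb R^M$ with components $$Z_{n,l}=n^{-1/2}\big[\bar x_{l\cdot}^TB_n\bar y_{l\cdot}-\rho_l\,\mathrm{tr}\,B_n\big].$$ Then $Z_n$ converges in distribution to $N_M(0,D)$ with $$D=(\theta-\omega)J+\omega K_1+\phi K_2=\theta J+\omega K+\phi K_2,$$ where $K=K_1-J$ and $J,K_1,K_2$ are the matrices defined by $$J=C^{xy}\circ C^{yx}+C^{xx}\circ C^{yy},\qquad K_1=C^{zz},\qquad K_2=C^{ww}-C^{wz}-C^{zw}.$$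
   Context: $\|\cdot\|$ is the spectral norm and $\circ$ is the Hadamard (entrywise) product. $(x,y)\in\mathbb R^M\times\mathbb R^M$ are zero-mean random vectors whose joint covariance matrix has $M\times M$ blocks $C^{xx},C^{xy},C^{yx},C^{yy}$, e.g. $C^{xy}_{ll'}=\mathbb E[x_ly_{l'}]$. It is assumed that $C^{xx}_{ll}=C^{yy}_{ll}=1$, i.e. all components of $x$ and $y$ have unit variance, and $\rho_l=C^{xy}_{ll}=\mathbb E[x_ly_l]$. The random vectors $z,w\in\mathbb R^M$ are $z_l=x_ly_l$ and $w_l=\rho_l(x_l^2+y_l^2)/2$, with covariance matrices $C^{zz}=\mathrm{Cov}(z)$, $C^{ww}=\mathrm{Cov}(w)$ and cross-covariances $C^{wz}=\mathrm{Cov}(w,z)$, $C^{zw}=\mathrm{Cov}(z,w)$, i.e. $C^{wz}_{ll'}=\mathrm{Cov}(w_l,z_{l'})$ and $C^{zw}_{ll'}=\mathrm{Cov}(z_l,w_{l'})$. $X=(x_{li})_{M\times n}$ and $Y=(y_{li})_{M\times n}$ are data matrices based on $n$ i.i.d. observations of $(x,y)$. The normalized data matrices are $\bar X=\hat\Sigma_x^{-1/2}X$ and $\bar Y=\hat\Sigma_y^{-1/2}Y$, where $\hat\Sigma_x=\mathrm{diag}(\hat\sigma_{x_1}^2,\dots,\hat\sigma_{x_M}^2)$, $\hat\Sigma_y=\mathrm{diag}(\hat\sigma_{y_1}^2,\dots,\hat\sigma_{y_M}^2)$, $\hat\sigma_{x_l}^2=n^{-1}\sum_{i=1}^nx_{li}^2$,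 $\hat\sigma_{y_l}^2=n^{-1}\sum_{i=1}^ny_{li}^2$. Their $l$th rows are denoted $\bar x_{l\cdot}^T$ and $\bar y_{l\cdot}^T$. *)

theory Defs
  imports "HOL-Probability.Probability"
begin

definition cov_mat :: "'a measure \<Rightarrow> ('a \<Rightarrow> real ^ 'm) \<Rightarrow> ('a \<Rightarrow> real ^ 'm) \<Rightarrow> real ^ 'm ^ 'm" where
  "cov_mat M u v = (\<chi> l l'. (\<integral>\<omega>. (u \<omega> $ l - (\<integral>\<omega>'. u \<omega>' $ l \<partial>M)) *
                                (v \<omega> $ l' - (\<integral>\<omega>'. v \<omega>' $ l' \<partial>M)) \<partial>M))"

definition rho :: "'a measure \<Rightarrow> ('a \<Rightarrow> real ^ 'm) \<Rightarrow> ('a \<Rightarrow> real ^ 'm) \<Rightarrow> 'm \<Rightarrow> real" where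
  "rho M x y l = cov_mat M x y $ l $ l"

definition zvec :: "('a \<Rightarrow> real ^ 'm) \<Rightarrow> ('a \<Rightarrow> real ^ 'm) \<Rightarrow> 'a \<Rightarrow> real ^ 'm" where
  "zvec x y \<omega> = (\<chi> l. x \<omega> $ l * y \<omega> $ l)"

definition wvec :: "'a measure \<Rightarrow> ('a \<Rightarrow> real ^ 'm) \<Rightarrow> ('a \<Rightarrow> real ^ 'm) \<Rightarrow> 'a \<Rightarrow> real ^ 'm" where
  "wvec M x y \<omega> = (\<chi> l. rho M x y l * ((x \<omega> $ l)\<^sup>2 + (y \<omega> $ l)\<^sup>2) / 2)"

(* Multiplication in the type class times acts componentwise on vectors, hence entrywise on
   matrices; the matrix product is a different operation of the library. *)
abbreviation hadamard :: "real ^ 'm ^ 'm \<Rightarrow> real ^ 'm ^ 'm \<Rightarrow> real ^ 'm ^ 'm" where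
  "hadamard A B \<equiv> A * B"

(* An n x n matrix is a function of two indices, of which only those below n matter. *)

definition tr :: "nat \<Rightarrow> (nat \<Rightarrow> nat \<Rightarrow> real) \<Rightarrow> real" where
  "tr n A = (\<Sum>i<n. A i i)"

definition mmult :: "nat \<Rightarrow> (nat \<Rightarrow> nat \<Rightarrow> real) \<Rightarrow> (nat \<Rightarrow> nat \<Rightarrow> real) \<Rightarrow> nat \<Rightarrow> nat \<Rightarrow> real" where
  "mmult n A B i j = (\<Sum>k<n. A i k * B k j)"

definition spectral_norm :: "nat \<Rightarrow> (nat \<Rightarrow> nat \<Rightarrow> real) \<Rightarrow> real" where
  "spectral_norm n A =
    (SUP v\<in>{v. L2_set v {..<n} \<le> 1}. L2_set (\<lambda>i. \<Sum>j<n. A i j * v j) {..<n})"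

(* The library's indep_var requires both random variables to have the same type. *)
definition indep_rv ::
  "'a measure \<Rightarrow> 'b measure \<Rightarrow> ('a \<Rightarrow> 'b) \<Rightarrow> 'c measure \<Rightarrow> ('a \<Rightarrow> 'c) \<Rightarrow> bool" where
  "indep_rv M S U T V \<longleftrightarrow>
     U \<in> measurable M S \<and> V \<in> measurable M T \<and>
     prob_space.indep_set M (sets (vimage_algebra (space M) U S))
                            (sets (vimage_algebra (space M) V T))"

definition converges_in_probability ::
  "'a measure \<Rightarrow> (nat \<Rightarrow> 'a \<Rightarrow> real) \<Rightarrow> real \<Rightarrow> bool" where
  "converges_in_probability M U c \<longleftrightarrow>
     (\<forall>n. U n \<in> borel_measurable M) \<and>
     (\<forall>\<epsilon>>0. (\<lambda>n. measure M {\<omega> \<in> space M. \<bar>U n \<omega> - c\<bar> > \<epsilon>}) \<longlonglongrightarrow> 0)"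

(* Weak convergence of the laws to N; the library's weak_conv_m is confined to the real line. *)
definition converges_in_distribution ::
  "'a measure \<Rightarrow> (nat \<Rightarrow> 'a \<Rightarrow> 'b::topological_space) \<Rightarrow> 'b measure \<Rightarrow> bool" where
  "converges_in_distribution M U N \<longleftrightarrow>
     (\<forall>n. U n \<in> borel_measurable M) \<and> prob_space N \<and> sets N = sets borel \<and>
     (\<forall>f :: 'b \<Rightarrow> real. continuous_on UNIV f \<longrightarrow> bounded (range f) \<longrightarrow>
        (\<lambda>n. \<integral>\<omega>. f (U n \<omega>) \<partial>M) \<longlonglongrightarrow> (\<integral>v. f v \<partial>N))"

(* Normal law on the line with mean m and variance v, for v >= 0; a point mass when v = 0. *)
definition normal_law :: "real \<Rightarrow> real \<Rightarrow> real measure" where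
  "normal_law m v =
     (if v = 0 then return borel m else density lborel (normal_density m (sqrt v)))"

(* N is the law N(\<mu>, D), where D may be singular: each linear functional t has the normal law
   with mean t . \<mu> and variance t . D t. *)
definition multivariate_normal ::
  "real ^ 'm \<Rightarrow> real ^ 'm ^ 'm \<Rightarrow> (real ^ 'm) measure \<Rightarrow> bool" where
  "multivariate_normal \<mu> D N \<longleftrightarrow>
     transpose D = D \<and> (\<forall>t. 0 \<le> t \<bullet> (D *v t)) \<and>
     prob_space N \<and> sets N = sets borel \<and>
     (\<forall>t. distr N borel (\<lambda>v. t \<bullet> v) = normal_law (t \<bullet> \<mu>) (t \<bullet> (D *v t)))"

(* X i and Y i, for i < n, are the columns of the data matrices. *)
definition iid_observations ::
  "'a measure \<Rightarrow> ('a \<Rightarrow> real ^ 'm) \<Rightarrow> ('a \<Rightarrow> real ^ 'm) \<Rightarrow> nat \<Rightarrow>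
   (nat \<Rightarrow> 'a \<Rightarrow> real ^ 'm) \<Rightarrow> (nat \<Rightarrow> 'a \<Rightarrow> real ^ 'm) \<Rightarrow> bool" where
  "iid_observations M x y n X Y \<longleftrightarrow>
     prob_space.indep_vars M (\<lambda>_. borel) (\<lambda>i \<omega>. (X i \<omega>, Y i \<omega>)) {..<n} \<and>
     (\<forall>i<n. distr M borel (\<lambda>\<omega>. (X i \<omega>, Y i \<omega>)) = distr M borel (\<lambda>\<omega>. (x \<omega>, y \<omega>)))"

definition indep_of_data ::
  "'a measure \<Rightarrow> nat \<Rightarrow> ('a \<Rightarrow> nat \<Rightarrow> nat \<Rightarrow> real) \<Rightarrow>
   (nat \<Rightarrow> 'a \<Rightarrow> real ^ 'm) \<Rightarrow> (nat \<Rightarrow> 'a \<Rightarrow> real ^ 'm) \<Rightarrow> bool" where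
  "indep_of_data M n B X Y \<longleftrightarrow>
     indep_rv M
       (PiM ({..<n} \<times> {..<n}) (\<lambda>_. borel)) (\<lambda>\<omega>. \<lambda>(i, j)\<in>{..<n} \<times> {..<n}. B \<omega> i j)
       (PiM {..<n} (\<lambda>_. borel)) (\<lambda>\<omega>. \<lambda>i\<in>{..<n}. (X i \<omega>, Y i \<omega>))"

definition sigma2_hat :: "nat \<Rightarrow> (nat \<Rightarrow> 'a \<Rightarrow> real ^ 'm) \<Rightarrow> 'm \<Rightarrow> 'a \<Rightarrow> real" where
  "sigma2_hat n X l \<omega> = (\<Sum>i<n. (X i \<omega> $ l)\<^sup>2) / real n"

(* Entry (l, i) of the normalized data matrix.  If the l-th row of the data vanishes, so that
   the normalization is undefined, the value is 0. *)
definition normalized :: "nat \<Rightarrow> (nat \<Rightarrow> 'a \<Rightarrow> real ^ 'm) \<Rightarrow> 'm \<Rightarrow> nat \<Rightarrow> 'a \<Rightarrow> real" where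
  "normalized n X l i \<omega> = X i \<omega> $ l / sqrt (sigma2_hat n X l \<omega>)"

definition bilinear_stat ::
  "'a measure \<Rightarrow> ('a \<Rightarrow> real ^ 'm) \<Rightarrow> ('a \<Rightarrow> real ^ 'm) \<Rightarrow> nat \<Rightarrow> ('a \<Rightarrow> nat \<Rightarrow> nat \<Rightarrow> real) \<Rightarrow>
   (nat \<Rightarrow> 'a \<Rightarrow> real ^ 'm) \<Rightarrow> (nat \<Rightarrow> 'a \<Rightarrow> real ^ 'm) \<Rightarrow> 'a \<Rightarrow> real ^ 'm" where
  "bilinear_stat M x y n B X Y \<omega> =
     (\<chi> l. ((\<Sum>i<n. \<Sum>j<n. normalized n X l i \<omega> * B \<omega> i j * normalized n Y l j \<omega>)
            - rho M x y l * tr n (B \<omega>)) / sqrt (real n))"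

end

theory Submission
  imports Defs
begin

text \<open>
  The normalized bilinear form \<open>x\<^sup>T B y\<close> is, up to negligible terms, a quadratic statistic of
  the i.i.d. columns of the data whose conditional variance given \<open>B\<close> depends on \<open>B\<close> only through
  the three averages that are assumed to converge. The proof follows characteristic functions.

  \<^emph>\<open>Deterministic weights suffice.\<close> As \<open>B\<close> is independent of the data, the characteristic function
  of \<open>t \<bullet> Z\<close> is the mean, over \<open>B\<close>, of that of the same statistic with a fixed matrix \<open>b\<close>
  (lemma \<open>char_conditional\<close>). So it is enough to know the latter up to an error that is uniform over
  all symmetric \<open>b\<close> of norm at most \<open>\<beta>\<close> (\<open>char_normalized_form\<close>). The remaining average of
  \<open>exp (- V / 2)\<close> over the random variance \<open>V\<close> converges because \<open>V\<close> is bounded and converges in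
  probability (\<open>random_variance_limit\<close>).

  \<^emph>\<open>Normalization.\<close> Write \<open>1 + A\<close> and \<open>1 + G\<close> for the two sample second moments of a component.
  The centred bilinear form is multiplied by \<open>1 / sqrt ((1 + A) (1 + G))\<close>, which tends to 1. However,
  its mean \<open>\<rho> tr b\<close> is of order \<open>n\<close>, so that after division by \<open>sqrt n\<close> the first order term
  \<open>- \<rho> tr b (A + G) / 2\<close> survives. Up to centring, observation \<open>i\<close> then contributes
  \<open>b i i * z - (tr b / n) * w\<close> with \<open>z = x y\<close> and \<open>w = \<rho> (x\<^sup>2 + y\<^sup>2) / 2\<close>; this is the origin of \<open>K\<^sub>2\<close>
  (\<open>normalization_error_pointwise\<close>, \<open>normalization_negligible\<close>).

  \<^emph>\<open>The central limit theorem for the linearized statistic.\<close> It is an off-diagonal quadratic form plus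
  a weighted linear statistic. Truncation reduces to bounded observations at a small cost in \<open>L\<^sup>1\<close>
  (\<open>char_quad_stat\<close>). For bounded ones, write the statistic as \<open>W = \<Sum>i. V i\<close>, and let \<open>D i\<close>
  be everything in \<open>W\<close> that involves observation \<open>i\<close>. Then \<open>R i = W - D i\<close> is free of that
  observation. Expanding \<open>exp (\<i> s W)\<close> around \<open>exp (\<i> s (R i))\<close> and integrating out observation \<open>i\<close>
  shows that the characteristic function \<open>\<phi>\<close> of \<open>W\<close> satisfies \<open>\<phi>'(s) = - s \<sigma>\<^sup>2 \<phi>(s)\<close> up to an
  error of order \<open>1 / sqrt n\<close>: the sum of the conditional expectations of \<open>V i * D i\<close> is itself
  concentrated around \<open>\<sigma>\<^sup>2\<close>, because the operator norm of \<open>b\<close>, and not only its Frobenius norm, is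
  bounded. The approximate Gaussian differential equation is then integrated (\<open>leave_one_out\<close>,
  \<open>conditional_variance_concentrates\<close>, \<open>char_bounded_kernel\<close>).

  \<^emph>\<open>From characteristic functions to the limit law.\<close> The quadratic form of \<open>D\<close> is the limit of the
  variances; it is nonnegative because the limit \<open>exp (- (t \<bullet> D t) / 2)\<close> of characteristic functions
  has modulus at most 1. A Gaussian law with a given positive semidefinite covariance matrix is
  obtained by splitting off rank one matrices (\<open>gaussian_exists_on\<close>), and convergence
  in distribution follows from the continuity theorem in Euclidean space
  (\<open>levy_continuity_euclidean\<close>).
\<close>

section \<open>Moments of linear and quadratic forms in independent observations\<close>

abbreviation samples :: "'e measure \<Rightarrow> nat \<Rightarrow> (nat \<Rightarrow> 'e) measure" where
  "samples P n \<equiv> PiM {..<n} (\<lambda>_. P)"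

lemma prob_space_samples: "prob_space P \<Longrightarrow> prob_space (samples P n)"
  by (rule prob_space_PiM)

lemma samples_component_integral:
  fixes F :: "'e \<Rightarrow> 'b::{banach, second_countable_topology}"
  assumes P: "prob_space P" and i: "i < n" and F: "F \<in> borel_measurable P"
  shows "integrable (samples P n) (\<lambda>u. F (u i)) \<longleftrightarrow> integrable P F"
    and "(\<integral>u. F (u i) \<partial>samples P n) = integral\<^sup>L P F"
proof -
  have d: "distr (samples P n) P (\<lambda>u. u i) = P"
    using distr_PiM_component[of "{..<n}" "\<lambda>_. P" i] P i by simp
  have m: "(\<lambda>u. u i) \<in> measurable (samples P n) P"
    using i by (intro measurable_component_singleton) simp
  show "integrable (samples P n) (\<lambda>u. F (u i)) \<longleftrightarrow> integrable P F"
    using integrable_distr_eq[OF m F] d by simp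
  show "(\<integral>u. F (u i) \<partial>samples P n) = integral\<^sup>L P F"
    using integral_distr[OF m F] d by simp
qed

lemma indep_vars_samples:
  assumes P: "prob_space P" and n: "0 < n"
  shows "prob_space.indep_vars (samples P n) (\<lambda>_. P) (\<lambda>i u. u i) {..<n}"
proof -
  interpret prob_space "samples P n" by (rule prob_space_samples[OF P])
  have "distr (samples P n) (samples P n) (\<lambda>x. \<lambda>i\<in>{..<n}. x i) = distr (samples P n) (samples P n) (\<lambda>x. x)"
    by (rule distr_cong) (auto simp: space_PiM PiE_iff extensional_restrict)
  also have "\<dots> = (\<Pi>\<^sub>M i\<in>{..<n}. distr (samples P n) P (\<lambda>u. u i))"
    unfolding distr_id
    by (rule PiM_cong) (simp_all add: distr_PiM_component[of "{..<n}" "\<lambda>_. P"] P)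
  finally show ?thesis
    using n by (intro iffD2[OF indep_vars_iff_distr_eq_PiM'] measurable_component_singleton) auto
qed

text \<open>The form of conditioning used throughout: integrating out observation \<open>i\<close> alone. Independence of
\<open>F (u i)\<close> and \<open>G u\<close> holds because \<open>G\<close>, being insensitive to coordinate \<open>i\<close>, is a measurable
function of the other coordinates: evaluate it with a fixed point inserted at \<open>i\<close>.\<close>

lemma samples_coordinate_factor:
  fixes F :: "'e \<Rightarrow> 'b::{real_normed_field, banach, second_countable_topology}"
  assumes P: "prob_space P" and i: "i < n"
    and F: "integrable P F" and G: "integrable (samples P n) G"
    and free: "\<And>u y. u \<in> space (samples P n) \<Longrightarrow> y \<in> space P \<Longrightarrow> G (u(i := y)) = G u"
  shows "integrable (samples P n) (\<lambda>u. F (u i) * G u)"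
    and "(\<integral>u. F (u i) * G u \<partial>samples P n) = integral\<^sup>L P F * integral\<^sup>L (samples P n) G"
proof -
  interpret P: prob_space P by (rule P)
  interpret S: prob_space "samples P n" by (rule prob_space_samples[OF P])
  obtain y0 where y0: "y0 \<in> space P" using P.not_empty by blast
  let ?J = "{..<n} - {i}"
  define G' where "G' v = G (v(i := y0))" for v
  have upd: "(\<lambda>v. v(i := y0)) \<in> measurable (PiM ?J (\<lambda>_. P)) (samples P n)"
  proof (rule measurable_PiM_single')
    show "(\<lambda>v. (v(i := y0)) j) \<in> measurable (PiM ?J (\<lambda>_. P)) P" if "j \<in> {..<n}" for j
      using that y0 by (cases "j = i") auto
    show "(\<lambda>v. v(i := y0)) \<in> space (PiM ?J (\<lambda>_. P)) \<rightarrow> {..<n} \<rightarrow>\<^sub>E space P"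
      using y0 i by (auto simp: space_PiM PiE_iff extensional_def Pi_iff)
  qed
  have G'm: "G' \<in> borel_measurable (PiM ?J (\<lambda>_. P))"
    unfolding G'_def by (rule measurable_compose[OF upd borel_measurable_integrable[OF G]])
  have G'eq: "G' (restrict u ?J) = G u" if u: "u \<in> space (samples P n)" for u
  proof -
    have "(restrict u ?J)(i := y0) = u(i := y0)"
      using u i by (auto simp: space_PiM PiE_iff extensional_def fun_eq_iff)
    then show ?thesis unfolding G'_def using free[OF u y0] by simp
  qed
  have ind: "S.indep_var (PiM {i} (\<lambda>_. P)) (\<lambda>u. restrict u {i}) (PiM ?J (\<lambda>_. P)) (\<lambda>u. restrict u ?J)"
    using S.indep_var_restrict[OF indep_vars_samples[OF P], where A = "{i}" and B = ?J] i by auto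
  have Fm: "(\<lambda>v. F (v i)) \<in> borel_measurable (PiM {i} (\<lambda>_. P))"
    using F by measurable
  have ind2: "S.indep_var borel (\<lambda>u. F (u i)) borel (\<lambda>u. G' (restrict u ?J))"
    using S.indep_var_compose[OF ind Fm G'm] by (simp add: comp_def)
  have iF: "integrable (samples P n) (\<lambda>u. F (u i))"
    using samples_component_integral(1)[OF P i borel_measurable_integrable[OF F]] F by simp
  have iG: "integrable (samples P n) (\<lambda>u. G' (restrict u ?J))"
    by (rule iffD2[OF Bochner_Integration.integrable_cong[OF refl G'eq] G])
  have "integrable (samples P n) (\<lambda>u. F (u i) * G' (restrict u ?J))"
    by (rule S.indep_var_integrable[OF ind2 iF iG])
  then show "integrable (samples P n) (\<lambda>u. F (u i) * G u)"
    by (rule iffD1[OF Bochner_Integration.integrable_cong[OF refl], rotated]) (simp add: G'eq)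
  have "(\<integral>u. F (u i) * G u \<partial>samples P n) = (\<integral>u. F (u i) * G' (restrict u ?J) \<partial>samples P n)"
    by (rule Bochner_Integration.integral_cong) (simp_all add: G'eq)
  also have "\<dots> = (\<integral>u. F (u i) \<partial>samples P n) * (\<integral>u. G' (restrict u ?J) \<partial>samples P n)"
    by (rule S.indep_var_lebesgue_integral[OF ind2 iF iG])
  also have "(\<integral>u. G' (restrict u ?J) \<partial>samples P n) = integral\<^sup>L (samples P n) G"
    by (rule Bochner_Integration.integral_cong) (simp_all add: G'eq)
  also have "(\<integral>u. F (u i) \<partial>samples P n) = integral\<^sup>L P F"
    by (rule samples_component_integral(2)[OF P i borel_measurable_integrable[OF F]])
  finally show "(\<integral>u. F (u i) * G u \<partial>samples P n) = integral\<^sup>L P F * integral\<^sup>L (samples P n) G" .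
qed

definition square_integrable :: "'a measure \<Rightarrow> ('a \<Rightarrow> real) \<Rightarrow> bool" where
  "square_integrable M f \<longleftrightarrow> f \<in> borel_measurable M \<and> integrable M (\<lambda>x. (f x)\<^sup>2)"

lemma square_integrable_measurable: "square_integrable M f \<Longrightarrow> f \<in> borel_measurable M"
  by (simp add: square_integrable_def)

lemma square_integrable_power2: "square_integrable M f \<Longrightarrow> integrable M (\<lambda>x. (f x)\<^sup>2)"
  by (simp add: square_integrable_def)

lemma square_integrable_mult:
  assumes "square_integrable M f" "square_integrable M g"
  shows "integrable M (\<lambda>x. f x * g x)"
proof (rule Bochner_Integration.integrable_bound)
  show "integrable M (\<lambda>x. (f x)\<^sup>2 + (g x)\<^sup>2)"
    using assms by (auto simp: square_integrable_def)
  show "(\<lambda>x. f x * g x) \<in> borel_measurable M"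
    using assms by (auto simp: square_integrable_def)
  have "\<bar>a * b\<bar> \<le> a\<^sup>2 + b\<^sup>2" for a b :: real
  proof -
    have "2 * (\<bar>a\<bar> * \<bar>b\<bar>) \<le> a\<^sup>2 + b\<^sup>2"
      using zero_le_power2[of "\<bar>a\<bar> - \<bar>b\<bar>"] by (simp add: power2_diff)
    moreover have "0 \<le> \<bar>a\<bar> * \<bar>b\<bar>" by simp
    ultimately show ?thesis unfolding abs_mult by linarith
  qed
  then show "AE x in M. norm (f x * g x) \<le> norm ((f x)\<^sup>2 + (g x)\<^sup>2)" by auto
qed

lemma square_integrable_add:
  assumes "square_integrable M f" "square_integrable M g"
  shows "square_integrable M (\<lambda>x. f x + g x)"
  unfolding square_integrable_def power2_sum mult.assoc
  using assms square_integrable_mult[OF assms]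
  by (intro conjI borel_measurable_add Bochner_Integration.integrable_add integrable_mult_right)
     (simp_all add: square_integrable_def)

lemma square_integrable_cmult:
  "square_integrable M f \<Longrightarrow> square_integrable M (\<lambda>x. c * f x)"
  by (auto simp: square_integrable_def power_mult_distrib)

lemma square_integrable_diff:
  assumes "square_integrable M f" "square_integrable M g"
  shows "square_integrable M (\<lambda>x. f x - g x)"
  using square_integrable_add[OF assms(1) square_integrable_cmult[OF assms(2), of "-1"]] by simp

lemma square_integrable_zero: "square_integrable M (\<lambda>x. 0)"
  by (simp add: square_integrable_def)

lemma square_integrable_sum:
  "(\<And>i. i \<in> I \<Longrightarrow> square_integrable M (f i)) \<Longrightarrow> square_integrable M (\<lambda>x. \<Sum>i\<in>I. f i x)"
  by (induction I rule: infinite_finite_induct)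
     (auto intro: square_integrable_add square_integrable_zero)

lemma square_integrable_bounded:
  assumes "finite_measure M" "f \<in> borel_measurable M" "\<And>x. x \<in> space M \<Longrightarrow> \<bar>f x\<bar> \<le> c"
  shows "square_integrable M f"
proof -
  interpret finite_measure M by fact
  have "norm ((f x)\<^sup>2) \<le> c\<^sup>2" if "x \<in> space M" for x
    using power_mono[OF assms(3)[OF that] abs_ge_zero, of 2] by simp
  then have "integrable M (\<lambda>x. (f x)\<^sup>2)"
    using assms(2) by (intro integrable_const_bound[where B = "c\<^sup>2"] AE_I2) auto
  then show ?thesis using assms by (simp add: square_integrable_def)
qed

lemma square_integrable_integrable:
  "finite_measure M \<Longrightarrow> square_integrable M f \<Longrightarrow> integrable M f"
  unfolding square_integrable_def using finite_measure.square_integrable_imp_integrable[of M f] by blast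

lemma (in prob_space) expectation_abs_le_L2:
  assumes "square_integrable M f" and "expectation (\<lambda>x. (f x)\<^sup>2) \<le> c\<^sup>2" and "0 \<le> c"
  shows "expectation (\<lambda>x. \<bar>f x\<bar>) \<le> c"
proof -
  have sq: "square_integrable M (\<lambda>x. \<bar>f x\<bar>)" using assms by (auto simp: square_integrable_def)
  have "0 \<le> variance (\<lambda>x. \<bar>f x\<bar>)" by (rule variance_positive)
  also have "\<dots> = expectation (\<lambda>x. (\<bar>f x\<bar>)\<^sup>2) - (expectation (\<lambda>x. \<bar>f x\<bar>))\<^sup>2"
    using sq square_integrable_integrable[OF _ sq] by (intro variance_eq) (auto simp: square_integrable_def finite_measure_axioms)
  finally have "(expectation (\<lambda>x. \<bar>f x\<bar>))\<^sup>2 \<le> c\<^sup>2" using assms(2) by simp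
  then show ?thesis using assms(3) by (rule power2_le_imp_le)
qed

lemma square_integrable_samples_component:
  assumes "prob_space P" "i < n" "square_integrable P f"
  shows "square_integrable (samples P n) (\<lambda>u. f (u i))"
proof -
  have m: "(\<lambda>u. u i) \<in> measurable (samples P n) P"
    using assms by (intro measurable_component_singleton) simp
  have f: "f \<in> borel_measurable P" "(\<lambda>x. (f x)\<^sup>2) \<in> borel_measurable P"
    using assms(3) by (auto simp: square_integrable_def)
  show ?thesis
    unfolding square_integrable_def
    using measurable_compose[OF m f(1)]
      samples_component_integral(1)[OF assms(1,2) f(2)] square_integrable_power2[OF assms(3)]
    by blast
qed

lemma square_integrable_coordinate_mult:
  assumes P: "prob_space P" and i: "i < n"
    and F: "square_integrable P F" and G: "square_integrable (samples P n) G"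
    and free: "\<And>u y. u \<in> space (samples P n) \<Longrightarrow> y \<in> space P \<Longrightarrow> G (u(i := y)) = G u"
  shows "square_integrable (samples P n) (\<lambda>u. F (u i) * G u)"
    and "(\<integral>u. (F (u i) * G u)\<^sup>2 \<partial>samples P n)
           = (\<integral>x. (F x)\<^sup>2 \<partial>P) * (\<integral>u. (G u)\<^sup>2 \<partial>samples P n)"
proof -
  have Fc: "square_integrable (samples P n) (\<lambda>u. F (u i))"
    by (rule square_integrable_samples_component[OF P i F])
  have *: "integrable (samples P n) (\<lambda>u. (F (u i))\<^sup>2 * (G u)\<^sup>2)"
    "(\<integral>u. (F (u i))\<^sup>2 * (G u)\<^sup>2 \<partial>samples P n)
       = (\<integral>x. (F x)\<^sup>2 \<partial>P) * (\<integral>u. (G u)\<^sup>2 \<partial>samples P n)"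
    using samples_coordinate_factor[OF P i square_integrable_power2[OF F] square_integrable_power2[OF G]] free
    by simp_all
  show "square_integrable (samples P n) (\<lambda>u. F (u i) * G u)"
    using * square_integrable_measurable[OF Fc] square_integrable_measurable[OF G]
    by (auto simp: square_integrable_def power_mult_distrib)
  show "(\<integral>u. (F (u i) * G u)\<^sup>2 \<partial>samples P n)
      = (\<integral>x. (F x)\<^sup>2 \<partial>P) * (\<integral>u. (G u)\<^sup>2 \<partial>samples P n)"
    using * by (simp add: power_mult_distrib)
qed

lemma samples_coordinate_orthogonal:
  assumes P: "prob_space P" and i: "i < n"
    and F: "square_integrable P F" "integral\<^sup>L P F = 0"
    and G: "square_integrable (samples P n) G" "square_integrable (samples P n) H"
    and free: "\<And>u y. u \<in> space (samples P n) \<Longrightarrow> y \<in> space P \<Longrightarrow> G (u(i := y)) = G u"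
      "\<And>u y. u \<in> space (samples P n) \<Longrightarrow> y \<in> space P \<Longrightarrow> H (u(i := y)) = H u"
  shows "(\<integral>u. G u * (F (u i) * H u) \<partial>samples P n) = 0"
proof -
  have fin: "finite_measure P" by (rule prob_space.axioms(1)[OF P])
  have "(\<integral>u. F (u i) * (G u * H u) \<partial>samples P n) = integral\<^sup>L P F * (\<integral>u. G u * H u \<partial>samples P n)"
    by (rule samples_coordinate_factor(2)[OF P i square_integrable_integrable[OF fin F(1)] square_integrable_mult[OF G]])
      (simp add: free)
  then show ?thesis using F(2) by (simp add: mult.left_commute)
qed

lemma linear_form_L2:
  assumes P: "prob_space P"
    and f: "\<And>i. i < n \<Longrightarrow> square_integrable P (f i)" "\<And>i. i < n \<Longrightarrow> integral\<^sup>L P (f i) = 0"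
    and J: "J \<subseteq> {..<n}"
  shows "square_integrable (samples P n) (\<lambda>u. \<Sum>i\<in>J. f i (u i))"
    and "(\<integral>u. (\<Sum>i\<in>J. f i (u i))\<^sup>2 \<partial>samples P n) = (\<Sum>i\<in>J. \<integral>x. (f i x)\<^sup>2 \<partial>P)"
proof -
  interpret S: prob_space "samples P n" by (rule prob_space_samples[OF P])
  have "finite J" using J finite_subset by blast
  show sq: "square_integrable (samples P n) (\<lambda>u. \<Sum>i\<in>J. f i (u i))"
    using J by (intro square_integrable_sum square_integrable_samples_component P f(1)) auto
  show "(\<integral>u. (\<Sum>i\<in>J. f i (u i))\<^sup>2 \<partial>samples P n) = (\<Sum>i\<in>J. \<integral>x. (f i x)\<^sup>2 \<partial>P)"
    using \<open>finite J\<close> J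
  proof (induction J)
    case (insert j J)
    let ?S = "\<lambda>u. \<Sum>i\<in>J. f i (u i)"
    have j: "j < n" using insert by auto
    have sqS: "square_integrable (samples P n) ?S"
      using insert by (intro square_integrable_sum square_integrable_samples_component P f(1)) auto
    have sqj: "square_integrable (samples P n) (\<lambda>u. f j (u j))"
      by (rule square_integrable_samples_component[OF P j f(1)[OF j]])
    have one: "square_integrable (samples P n) (\<lambda>_. 1)"
      by (rule square_integrable_bounded[where c = 1]) (auto simp: S.finite_measure_axioms)
    have free: "?S (u(j := y)) = ?S u" for u y
      using insert(2) by (intro sum.cong) auto
    have orth: "(\<integral>u. ?S u * f j (u j) \<partial>samples P n) = 0"
      using samples_coordinate_orthogonal[OF P j f(1)[OF j] f(2)[OF j] sqS one] free by simp
    have sqj2: "(\<integral>u. (f j (u j))\<^sup>2 \<partial>samples P n) = (\<integral>x. (f j x)\<^sup>2 \<partial>P)"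
      by (rule samples_component_integral(2)[OF P j]) (use f(1)[OF j] in \<open>auto simp: square_integrable_def\<close>)
    have "(\<integral>u. (\<Sum>i\<in>insert j J. f i (u i))\<^sup>2 \<partial>samples P n)
        = (\<integral>u. ((f j (u j))\<^sup>2 + (?S u)\<^sup>2) + 2 * (?S u * f j (u j)) \<partial>samples P n)"
      using insert by (intro Bochner_Integration.integral_cong) (auto simp: power2_sum)
    also have "\<dots> = (\<integral>u. (f j (u j))\<^sup>2 \<partial>samples P n) + (\<integral>u. (?S u)\<^sup>2 \<partial>samples P n)
        + 2 * (\<integral>u. ?S u * f j (u j) \<partial>samples P n)"
      using square_integrable_power2[OF sqj] square_integrable_power2[OF sqS] square_integrable_mult[OF sqS sqj]
      by simp
    finally show ?case using insert orth sqj2 by simp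
  qed simp
qed

lemma weighted_sum_L2:
  assumes P: "prob_space P" and f: "square_integrable P f" "integral\<^sup>L P f = 0"
    and J: "J \<subseteq> {..<n}"
  shows "square_integrable (samples P n) (\<lambda>u. \<Sum>i\<in>J. c i * f (u i))"
    and "(\<integral>u. (\<Sum>i\<in>J. c i * f (u i))\<^sup>2 \<partial>samples P n) = (\<integral>x. (f x)\<^sup>2 \<partial>P) * (\<Sum>i\<in>J. (c i)\<^sup>2)"
proof -
  have "integral\<^sup>L P (\<lambda>x. c i * f x) = 0" for i using f(2) by simp
  note * = linear_form_L2[OF P square_integrable_cmult[OF f(1)] this J]
  show "square_integrable (samples P n) (\<lambda>u. \<Sum>i\<in>J. c i * f (u i))" by (rule *(1))
  show "(\<integral>u. (\<Sum>i\<in>J. c i * f (u i))\<^sup>2 \<partial>samples P n) = (\<integral>x. (f x)\<^sup>2 \<partial>P) * (\<Sum>i\<in>J. (c i)\<^sup>2)"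
    unfolding *(2) by (simp add: power_mult_distrib sum_distrib_left mult.commute)
qed

text \<open>Adding the index \<open>m\<close> to a quadratic form with zero diagonal adds a centred function of
observation \<open>m\<close> times a function of the earlier observations, so the increments are orthogonal
and their squared norms add up. The factor 2 comes from treating row and column of \<open>m\<close> separately.\<close>

lemma quadratic_form_L2:
  assumes P: "prob_space P"
    and f: "square_integrable P f" "integral\<^sup>L P f = 0"
    and g: "square_integrable P g" "integral\<^sup>L P g = 0"
    and A: "\<And>i. A i i = 0" and m: "m \<le> n"
  shows "square_integrable (samples P n) (\<lambda>u. \<Sum>i<m. \<Sum>j<m. A i j * (f (u i) * g (u j)))"
    and "(\<integral>u. (\<Sum>i<m. \<Sum>j<m. A i j * (f (u i) * g (u j)))\<^sup>2 \<partial>samples P n)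
           \<le> 2 * (\<integral>x. (f x)\<^sup>2 \<partial>P) * (\<integral>x. (g x)\<^sup>2 \<partial>P) * (\<Sum>i<m. \<Sum>j<m. (A i j)\<^sup>2)"
proof -
  interpret S: prob_space "samples P n" by (rule prob_space_samples[OF P])
  let ?S = "samples P n"
  let ?Q = "\<lambda>m u. \<Sum>i<m. \<Sum>j<m. A i j * (f (u i) * g (u j))"
  let ?F = "\<integral>x. (f x)\<^sup>2 \<partial>P" and ?G = "\<integral>x. (g x)\<^sup>2 \<partial>P"
  have "square_integrable ?S (?Q m) \<and>
    (\<integral>u. (?Q m u)\<^sup>2 \<partial>?S) \<le> 2 * ?F * ?G * (\<Sum>i<m. \<Sum>j<m. (A i j)\<^sup>2)"
    using m
  proof (induction m)
    case 0
    then show ?case by (simp add: square_integrable_zero)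
  next
    case (Suc m)
    then have m: "m < n" by simp
    let ?L1 = "\<lambda>u. \<Sum>j<m. A m j * g (u j)" and ?L2 = "\<lambda>u. \<Sum>j<m. A j m * f (u j)"
    let ?X = "\<lambda>u. f (u m) * ?L1 u" and ?Y = "\<lambda>u. g (u m) * ?L2 u"
    have Q: "?Q (Suc m) u = ?Q m u + (?X u + ?Y u)" for u
      using A by (simp add: sum.distrib sum_distrib_left sum_distrib_right algebra_simps)
    have sqQ: "square_integrable ?S (?Q m)" using Suc by simp
    have L1: "square_integrable ?S ?L1" "(\<integral>u. (?L1 u)\<^sup>2 \<partial>?S) = ?G * (\<Sum>j<m. (A m j)\<^sup>2)"
      using weighted_sum_L2[OF P g, of "{..<m}"] m by auto
    have L2: "square_integrable ?S ?L2" "(\<integral>u. (?L2 u)\<^sup>2 \<partial>?S) = ?F * (\<Sum>j<m. (A j m)\<^sup>2)"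
      using weighted_sum_L2[OF P f, of "{..<m}"] m by auto
    have freeL: "?L1 (u(m := y)) = ?L1 u" "?L2 (u(m := y)) = ?L2 u" "?Q m (u(m := y)) = ?Q m u" for u y
      by (intro sum.cong refl; simp)+
    note X = square_integrable_coordinate_mult[OF P m f(1) L1(1) freeL(1)]
    note Y = square_integrable_coordinate_mult[OF P m g(1) L2(1) freeL(2)]
    have oX: "(\<integral>u. ?Q m u * ?X u \<partial>?S) = 0"
      by (rule samples_coordinate_orthogonal[OF P m f sqQ L1(1) freeL(3) freeL(1)])
    have oY: "(\<integral>u. ?Q m u * ?Y u \<partial>?S) = 0"
      by (rule samples_coordinate_orthogonal[OF P m g sqQ L2(1) freeL(3) freeL(2)])
    have XY: "square_integrable ?S (\<lambda>u. ?X u + ?Y u)"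
      by (rule square_integrable_add[OF X(1) Y(1)])
    have "(\<integral>u. (?X u + ?Y u)\<^sup>2 \<partial>?S) \<le> (\<integral>u. 2 * (?X u)\<^sup>2 + 2 * (?Y u)\<^sup>2 \<partial>?S)"
    proof (rule integral_mono)
      show "(?X u + ?Y u)\<^sup>2 \<le> 2 * (?X u)\<^sup>2 + 2 * (?Y u)\<^sup>2" for u
        using zero_le_power2[of "?X u - ?Y u"] by (simp add: power2_sum power2_diff)
    qed (use square_integrable_power2[OF XY] square_integrable_power2[OF X(1)] square_integrable_power2[OF Y(1)] in auto)
    also have "\<dots> = 2 * (\<integral>u. (?X u)\<^sup>2 \<partial>?S) + 2 * (\<integral>u. (?Y u)\<^sup>2 \<partial>?S)"
      using square_integrable_power2[OF X(1)] square_integrable_power2[OF Y(1)] by simp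
    also have "\<dots> = 2 * ?F * ?G * ((\<Sum>j<m. (A m j)\<^sup>2) + (\<Sum>j<m. (A j m)\<^sup>2))"
      unfolding X(2) Y(2) L1(2) L2(2) by (simp add: algebra_simps)
    finally have B: "(\<integral>u. (?X u + ?Y u)\<^sup>2 \<partial>?S) \<le> 2 * ?F * ?G * ((\<Sum>j<m. (A m j)\<^sup>2) + (\<Sum>j<m. (A j m)\<^sup>2))" .
    have "(\<integral>u. (?Q (Suc m) u)\<^sup>2 \<partial>?S)
      = (\<integral>u. (?Q m u)\<^sup>2 + (?X u + ?Y u)\<^sup>2 + 2 * (?Q m u * ?X u + ?Q m u * ?Y u) \<partial>?S)"
      unfolding Q by (intro Bochner_Integration.integral_cong) (simp_all add: power2_sum algebra_simps)
    also have "\<dots> = (\<integral>u. (?Q m u)\<^sup>2 \<partial>?S) + (\<integral>u. (?X u + ?Y u)\<^sup>2 \<partial>?S)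
       + 2 * ((\<integral>u. ?Q m u * ?X u \<partial>?S) + (\<integral>u. ?Q m u * ?Y u \<partial>?S))"
      using square_integrable_power2[OF sqQ] square_integrable_power2[OF XY]
        square_integrable_mult[OF sqQ X(1)] square_integrable_mult[OF sqQ Y(1)]
      by simp
    also have "\<dots> \<le> 2 * ?F * ?G * (\<Sum>i<m. \<Sum>j<m. (A i j)\<^sup>2)
         + 2 * ?F * ?G * ((\<Sum>j<m. (A m j)\<^sup>2) + (\<Sum>j<m. (A j m)\<^sup>2))"
      using Suc B oX oY by simp
    also have "\<dots> = 2 * ?F * ?G * (\<Sum>i<Suc m. \<Sum>j<Suc m. (A i j)\<^sup>2)"
      using A by (simp add: sum.distrib algebra_simps)
    finally show ?case
      using square_integrable_add[OF sqQ XY] unfolding Q by simp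
  qed
  then show "square_integrable ?S (?Q m)"
    "(\<integral>u. (?Q m u)\<^sup>2 \<partial>?S) \<le> 2 * ?F * ?G * (\<Sum>i<m. \<Sum>j<m. (A i j)\<^sup>2)" by auto
qed

text \<open>In the expansion of \<open>(a + b)\<^sup>4\<close>, with \<open>a\<close> the form so far and \<open>b\<close> the new summand, the terms with a
first power integrate to zero. Only \<open>6 a\<^sup>2 b\<^sup>2\<close> and the fourth powers remain, and \<open>3 S\<^sup>2\<close> grows by \<open>6 S c\<^sup>2 + 3 c\<^sup>4\<close> when
\<open>S\<close> grows by \<open>c\<^sup>2\<close>. The second moment has to be carried along.\<close>

lemma linear_form_fourth_moment:
  fixes q :: "'e \<Rightarrow> real"
  assumes P: "prob_space P"
    and q: "q \<in> borel_measurable P" "\<And>x. \<bar>q x\<bar> \<le> C" "integral\<^sup>L P q = 0"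
    and m: "m \<le> n"
  shows "(\<integral>u. (\<Sum>j<m. c j * q (u j))^4 \<partial>samples P n) \<le> 3 * C^4 * (\<Sum>j<m. (c j)\<^sup>2)\<^sup>2"
proof -
  interpret P: prob_space P by (rule P)
  interpret S: prob_space "samples P n" by (rule prob_space_samples[OF P])
  let ?S = "samples P n"
  let ?L = "\<lambda>m u. \<Sum>j<m. c j * q (u j)"
  have C: "0 \<le> C" using q(2)[of undefined] by linarith
  have qk: "integrable P (\<lambda>x. q x ^ k)" "(\<integral>x. q x ^ k \<partial>P) \<le> C ^ k" for k
  proof -
    have b: "\<bar>q x ^ k\<bar> \<le> C ^ k" for x using power_mono[OF q(2) abs_ge_zero, where n = k] by (simp add: power_abs)
    show i: "integrable P (\<lambda>x. q x ^ k)"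
      using q(1) b by (intro P.integrable_const_bound[where B = "C^k"]) auto
    show "(\<integral>x. q x ^ k \<partial>P) \<le> C ^ k"
      using P.integral_le_const[OF i, of "C^k"] b by (auto simp: abs_le_iff)
  qed
  have Lm: "?L m \<in> borel_measurable ?S" if "m \<le> n" for m
    using q(1) that by (intro borel_measurable_sum borel_measurable_times borel_measurable_const
      measurable_compose[OF measurable_component_singleton]) auto
  have Lk: "integrable ?S (\<lambda>u. ?L m u ^ k)" if "m \<le> n" for m k
  proof (rule S.integrable_const_bound)
    have "\<bar>?L m u\<bar> \<le> (\<Sum>j<m. \<bar>c j\<bar> * C)" for u
      by (rule order_trans[OF sum_abs]) (auto intro!: sum_mono mult_left_mono simp: abs_mult q(2))
    then show "AE u in ?S. norm (?L m u ^ k) \<le> (\<Sum>j<m. \<bar>c j\<bar> * C) ^ k"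
      by (auto simp: power_abs intro!: AE_I2 power_mono)
  qed (use Lm[OF that] in auto)
  have "(\<integral>u. ?L m u \<partial>?S) = 0 \<and> (\<integral>u. (?L m u)\<^sup>2 \<partial>?S) \<le> C\<^sup>2 * (\<Sum>j<m. (c j)\<^sup>2)
     \<and> (\<integral>u. (?L m u)^4 \<partial>?S) \<le> 3 * C^4 * (\<Sum>j<m. (c j)\<^sup>2)\<^sup>2" (is "?I m")
    using m
  proof (induction m)
    case (Suc m)
    then have m: "m < n" and mn: "m \<le> n" by auto
    have IH: "?I m" using Suc by simp
    let ?s = "\<Sum>j<m. (c j)\<^sup>2"
    have f: "integrable ?S (\<lambda>u. q (u m) ^ k * ?L m u ^ l)"
       "(\<integral>u. q (u m) ^ k * ?L m u ^ l \<partial>?S) = (\<integral>x. q x ^ k \<partial>P) * (\<integral>u. ?L m u ^ l \<partial>?S)" for k l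
      by (rule samples_coordinate_factor[OF P m qk(1) Lk[OF mn]], simp)+
    have e1: "(\<integral>u. ?L (Suc m) u \<partial>?S) = 0"
      using f[of 1 0] f[of 0 1] IH q(3) by (simp add: P.prob_space S.prob_space)
    have "(\<integral>u. (?L (Suc m) u)\<^sup>2 \<partial>?S)
       = (\<integral>u. (q (u m) ^ 0 * ?L m u ^ 2) + 2 * c m * (q (u m) ^ 1 * ?L m u ^ 1) + (c m)\<^sup>2 * (q (u m) ^ 2 * ?L m u ^ 0) \<partial>?S)"
      by (intro Bochner_Integration.integral_cong) (simp_all add: power2_sum power_mult_distrib algebra_simps)
    also have "\<dots> = (\<integral>u. (?L m u)\<^sup>2 \<partial>?S) + (c m)\<^sup>2 * (\<integral>x. (q x)\<^sup>2 \<partial>P)"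
      using f[of 0 2] f[of 1 1] f[of 2 0] q(3) by (simp add: P.prob_space S.prob_space)
    also have "\<dots> \<le> C\<^sup>2 * ?s + (c m)\<^sup>2 * C\<^sup>2"
      using IH qk(2)[of 2] by (intro add_mono mult_left_mono) auto
    finally have e2: "(\<integral>u. (?L (Suc m) u)\<^sup>2 \<partial>?S) \<le> C\<^sup>2 * (\<Sum>j<Suc m. (c j)\<^sup>2)"
      by (simp add: algebra_simps)
    have p4: "(a + b)^4 = a^4 + 4 * (b * a^3) + 6 * (b^2 * a^2) + 4 * (b^3 * a) + b^4" for a b :: real
      by (simp add: power4_eq_xxxx power3_eq_cube power2_eq_square algebra_simps)
    have "(\<integral>u. (?L (Suc m) u)^4 \<partial>?S)
       = (\<integral>u. (q (u m) ^ 0 * ?L m u ^ 4) + 4 * c m * (q (u m) ^ 1 * ?L m u ^ 3) + 6 * (c m)\<^sup>2 * (q (u m) ^ 2 * ?L m u ^ 2)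
            + 4 * (c m)^3 * (q (u m) ^ 3 * ?L m u ^ 1) + (c m)^4 * (q (u m) ^ 4 * ?L m u ^ 0) \<partial>?S)"
      by (intro Bochner_Integration.integral_cong) (simp_all add: p4 power_mult_distrib mult_ac)
    also have "\<dots> = (\<integral>u. (?L m u)^4 \<partial>?S) + 6 * (c m)\<^sup>2 * ((\<integral>x. (q x)\<^sup>2 \<partial>P) * (\<integral>u. (?L m u)\<^sup>2 \<partial>?S))
           + (c m)^4 * (\<integral>x. (q x)^4 \<partial>P)"
      using f[of 0 4] f[of 1 3] f[of 2 2] f[of 3 1] f[of 4 0] q(3) IH
      by (simp add: P.prob_space S.prob_space)
    also have "\<dots> \<le> 3 * C^4 * ?s\<^sup>2 + 6 * (c m)\<^sup>2 * (C\<^sup>2 * (C\<^sup>2 * ?s)) + (c m)^4 * C^4"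
      using IH qk(2)[of 2] qk(2)[of 4]
      by (intro add_mono mult_left_mono mult_mono Bochner_Integration.integral_nonneg) (auto simp: sum_nonneg)
    also have "\<dots> \<le> 3 * C^4 * ?s\<^sup>2 + 6 * (c m)\<^sup>2 * (C\<^sup>2 * (C\<^sup>2 * ?s)) + 3 * ((c m)^4 * C^4)"
      by simp
    also have "\<dots> = 3 * C^4 * (\<Sum>j<Suc m. (c j)\<^sup>2)\<^sup>2"
      by (simp add: power2_sum power4_eq_xxxx power2_eq_square algebra_simps)
    finally show ?case using e1 e2 by blast
  qed simp
  then show ?thesis by simp
qed

section \<open>Symmetric matrices of bounded operator norm\<close>

definition op_bounded :: "nat \<Rightarrow> real \<Rightarrow> (nat \<Rightarrow> nat \<Rightarrow> real) \<Rightarrow> bool" where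
  "op_bounded n \<beta> b \<longleftrightarrow> 0 \<le> \<beta> \<and> (\<forall>i<n. \<forall>j<n. b i j = b j i) \<and>
     (\<forall>v. (\<Sum>i<n. (\<Sum>j<n. b i j * v j)\<^sup>2) \<le> \<beta>\<^sup>2 * (\<Sum>j<n. (v j)\<^sup>2))"

lemma op_boundedD:
  assumes "op_bounded n \<beta> b"
  shows "0 \<le> \<beta>" "\<And>i j. i < n \<Longrightarrow> j < n \<Longrightarrow> b i j = b j i"
    "\<And>v. (\<Sum>i<n. (\<Sum>j<n. b i j * v j)\<^sup>2) \<le> \<beta>\<^sup>2 * (\<Sum>j<n. (v j)\<^sup>2)"
  using assms by (auto simp: op_bounded_def)

lemma op_bounded_column:
  assumes "op_bounded n \<beta> b" "j < n"
  shows "(\<Sum>i<n. (b i j)\<^sup>2) \<le> \<beta>\<^sup>2"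
proof -
  have "(\<Sum>k<n. b i k * (if k = j then 1 else 0)) = b i j" for i
    using assms(2) by (simp add: if_distrib[of "\<lambda>x. _ * x"] cong: if_cong)
  moreover have "(\<Sum>k<n. (if k = j then 1 else 0 :: real)\<^sup>2) = 1"
    using assms(2) by (simp add: if_distrib[of "\<lambda>x. x\<^sup>2"] cong: if_cong)
  ultimately show ?thesis
    using op_boundedD(3)[OF assms(1), of "\<lambda>k. if k = j then 1 else 0"] by simp
qed

lemma op_bounded_row:
  assumes "op_bounded n \<beta> b" "i < n"
  shows "(\<Sum>j<n. (b i j)\<^sup>2) \<le> \<beta>\<^sup>2"
  using op_bounded_column[OF assms] op_boundedD(2)[OF assms(1)] assms(2) by simp

lemma op_bounded_frobenius:
  assumes "op_bounded n \<beta> b"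
  shows "(\<Sum>i<n. \<Sum>j<n. (b i j)\<^sup>2) \<le> real n * \<beta>\<^sup>2"
  using sum_mono[of "{..<n}" "\<lambda>i. \<Sum>j<n. (b i j)\<^sup>2" "\<lambda>_. \<beta>\<^sup>2"] op_bounded_row[OF assms] by simp

lemma op_bounded_entry:
  assumes "op_bounded n \<beta> b" "i < n" "j < n"
  shows "\<bar>b i j\<bar> \<le> \<beta>"
proof -
  have "(b i j)\<^sup>2 \<le> (\<Sum>j<n. (b i j)\<^sup>2)"
    using assms by (intro member_le_sum) auto
  also have "\<dots> \<le> \<beta>\<^sup>2" by (rule op_bounded_row[OF assms(1,2)])
  finally show ?thesis using op_boundedD(1)[OF assms(1)] by (simp add: abs_le_square_iff[symmetric])
qed

definition off_diagonal :: "(nat \<Rightarrow> nat \<Rightarrow> real) \<Rightarrow> nat \<Rightarrow> nat \<Rightarrow> real" where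
  "off_diagonal b i j = (if i = j then 0 else b i j)"

text \<open>The diagonal entries are at most \<open>\<beta>\<close> in absolute value, so deleting the diagonal subtracts a
matrix of norm at most \<open>\<beta>\<close>.\<close>

lemma op_bounded_off_diagonal:
  assumes "op_bounded n \<beta> b"
  shows "op_bounded n (2 * \<beta>) (off_diagonal b)"
  unfolding op_bounded_def
proof (intro conjI allI impI)
  show "0 \<le> 2 * \<beta>" using op_boundedD(1)[OF assms] by simp
  show "off_diagonal b i j = off_diagonal b j i" if "i < n" "j < n" for i j
    using op_boundedD(2)[OF assms that] by (simp add: off_diagonal_def)
  fix v :: "nat \<Rightarrow> real"
  have "(\<Sum>j<n. off_diagonal b i j * v j) = (\<Sum>j<n. b i j * v j) - b i i * v i" if "i < n" for i
    using that by (subst (1 2) sum.remove[of _ i]) (auto simp: off_diagonal_def)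
  then have "(\<Sum>i<n. (\<Sum>j<n. off_diagonal b i j * v j)\<^sup>2) = (\<Sum>i<n. ((\<Sum>j<n. b i j * v j) - b i i * v i)\<^sup>2)"
    by (intro sum.cong) auto
  also have "\<dots> \<le> (\<Sum>i<n. 2 * (\<Sum>j<n. b i j * v j)\<^sup>2 + 2 * (\<beta>\<^sup>2 * (v i)\<^sup>2))"
  proof (rule sum_mono)
    fix i assume "i \<in> {..<n}"
    then have i: "i < n" by simp
    have "(b i i * v i)\<^sup>2 \<le> \<beta>\<^sup>2 * (v i)\<^sup>2"
      using power_mono[OF op_bounded_entry[OF assms i i] abs_ge_zero, of 2]
      by (simp add: power_mult_distrib mult_right_mono)
    moreover have "(x - y)\<^sup>2 \<le> 2 * x\<^sup>2 + 2 * y\<^sup>2" for x y :: real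
      using zero_le_power2[of "x + y"] by (simp add: power2_sum power2_diff)
    ultimately show "((\<Sum>j<n. b i j * v j) - b i i * v i)\<^sup>2 \<le> 2 * (\<Sum>j<n. b i j * v j)\<^sup>2 + 2 * (\<beta>\<^sup>2 * (v i)\<^sup>2)"
      by (meson add_left_mono mult_left_mono order_trans zero_le_numeral)
  qed
  also have "\<dots> = 2 * (\<Sum>i<n. (\<Sum>j<n. b i j * v j)\<^sup>2) + 2 * (\<beta>\<^sup>2 * (\<Sum>i<n. (v i)\<^sup>2))"
    by (simp add: sum.distrib sum_distrib_left)
  also have "\<dots> \<le> 2 * (\<beta>\<^sup>2 * (\<Sum>i<n. (v i)\<^sup>2)) + 2 * (\<beta>\<^sup>2 * (\<Sum>i<n. (v i)\<^sup>2))"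
    using op_boundedD(3)[OF assms, of v] by simp
  also have "\<dots> = (2 * \<beta>)\<^sup>2 * (\<Sum>j<n. (v j)\<^sup>2)" by (simp add: power2_eq_square)
  finally show "(\<Sum>i<n. (\<Sum>j<n. off_diagonal b i j * v j)\<^sup>2) \<le> (2 * \<beta>)\<^sup>2 * (\<Sum>j<n. (v j)\<^sup>2)" .
qed

definition gram :: "nat \<Rightarrow> (nat \<Rightarrow> nat \<Rightarrow> real) \<Rightarrow> nat \<Rightarrow> nat \<Rightarrow> real" where
  "gram n b j l = (\<Sum>i<n. b i j * b i l)"

text \<open>A column of \<open>b\<^sup>T b\<close> is \<open>b\<close> applied to a column of \<open>b\<close>. The bound makes the squared Frobenius norm of
\<open>b\<^sup>T b\<close> of order \<open>n\<close> only.\<close>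

lemma gram_row:
  assumes b: "op_bounded n \<beta> b" and j: "j < n"
  shows "(\<Sum>l<n. (gram n b j l)\<^sup>2) \<le> \<beta>^4"
proof -
  have "(\<Sum>l<n. (gram n b j l)\<^sup>2) = (\<Sum>l<n. (\<Sum>i<n. b l i * b i j)\<^sup>2)"
    unfolding gram_def using op_boundedD(2)[OF b]
    by (intro sum.cong refl arg_cong[where f = "\<lambda>x. x\<^sup>2"]) (auto simp: mult.commute)
  also have "\<dots> \<le> \<beta>\<^sup>2 * (\<Sum>i<n. (b i j)\<^sup>2)" by (rule op_boundedD(3)[OF b])
  also have "\<dots> \<le> \<beta>\<^sup>2 * \<beta>\<^sup>2" by (intro mult_left_mono op_bounded_column[OF b j]) simp
  finally show ?thesis by (simp add: power4_eq_xxxx power2_eq_square mult.assoc)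
qed

lemma gram_diagonal_le:
  assumes b: "op_bounded n \<beta> b" and j: "j < n"
  shows "0 \<le> gram n b j j" "gram n b j j \<le> \<beta>\<^sup>2"
  using op_bounded_column[OF assms] by (auto simp: gram_def power2_eq_square sum_nonneg)

lemma op_bounded_left_apply:
  assumes b: "op_bounded n \<beta> b" and e: "\<And>i. i < n \<Longrightarrow> \<bar>e i\<bar> \<le> c"
  shows "(\<Sum>j<n. (\<Sum>i<n. e i * b i j)\<^sup>2) \<le> \<beta>\<^sup>2 * (real n * c\<^sup>2)"
proof -
  have "(\<Sum>j<n. (\<Sum>i<n. e i * b i j)\<^sup>2) = (\<Sum>j<n. (\<Sum>i<n. b j i * e i)\<^sup>2)"
    using op_boundedD(2)[OF b]
    by (intro sum.cong refl arg_cong[where f = "\<lambda>x. x\<^sup>2"]) (auto simp: mult.commute)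
  also have "\<dots> \<le> \<beta>\<^sup>2 * (\<Sum>i<n. (e i)\<^sup>2)" by (rule op_boundedD(3)[OF b])
  also have "\<dots> \<le> \<beta>\<^sup>2 * (\<Sum>i<n. c\<^sup>2)"
    using e power_mono[OF _ abs_ge_zero, of "e _" c 2] by (intro mult_left_mono sum_mono) auto
  finally show ?thesis by simp
qed

section \<open>Bounded random variables and the complex exponential\<close>

text \<open>The bound holds at every point, not only almost everywhere, so that the closure properties
below are statements about functions; truncated variables satisfy it.\<close>

definition bounded_measurable :: "'a measure \<Rightarrow> ('a \<Rightarrow> 'b::{banach, second_countable_topology}) \<Rightarrow> bool" where
  "bounded_measurable M f \<longleftrightarrow> f \<in> borel_measurable M \<and> (\<exists>c. \<forall>x. norm (f x) \<le> c)"

lemma bounded_measurableI: "f \<in> borel_measurable M \<Longrightarrow> (\<And>x. norm (f x) \<le> c) \<Longrightarrow> bounded_measurable M f"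
  by (auto simp: bounded_measurable_def)

lemma bounded_measurable_integrable:
  "prob_space M \<Longrightarrow> bounded_measurable M f \<Longrightarrow> integrable M f"
  unfolding bounded_measurable_def
  by (auto intro!: finite_measure.integrable_const_bound[OF prob_space.axioms(1)])

lemma bounded_measurable_const: "bounded_measurable M (\<lambda>_. c)"
  by (rule bounded_measurableI[where c = "norm c"]) auto

lemma bounded_measurable_add:
  assumes "bounded_measurable M f" "bounded_measurable M g"
  shows "bounded_measurable M (\<lambda>x. f x + g x)"
proof -
  obtain c d where "\<And>x. norm (f x) \<le> c" "\<And>x. norm (g x) \<le> d"
    using assms by (auto simp: bounded_measurable_def)
  then show ?thesis using assms
    by (intro bounded_measurableI[where c = "c + d"]) (auto simp: bounded_measurable_def intro: norm_triangle_mono)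
qed

lemma bounded_measurable_mult:
  fixes f g :: "'a \<Rightarrow> 'b::{banach, real_normed_field, second_countable_topology}"
  assumes "bounded_measurable M f" "bounded_measurable M g"
  shows "bounded_measurable M (\<lambda>x. f x * g x)"
proof -
  obtain c d where cd: "\<And>x. norm (f x) \<le> c" "\<And>x. norm (g x) \<le> d"
    using assms by (auto simp: bounded_measurable_def)
  have "0 \<le> c" using cd(1) norm_ge_zero order_trans by metis
  then show ?thesis using assms cd
    by (intro bounded_measurableI[where c = "c * d"])
       (auto simp: bounded_measurable_def norm_mult intro!: mult_mono)
qed

lemma bounded_measurable_sum:
  "(\<And>i. i \<in> I \<Longrightarrow> bounded_measurable M (f i)) \<Longrightarrow> bounded_measurable M (\<lambda>x. \<Sum>i\<in>I. f i x)"
  by (induction I rule: infinite_finite_induct)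
     (auto intro: bounded_measurable_add bounded_measurable_const)

lemma bounded_measurable_abs:
  fixes f :: "'a \<Rightarrow> real"
  shows "bounded_measurable M f \<Longrightarrow> bounded_measurable M (\<lambda>x. \<bar>f x\<bar>)"
  by (auto simp: bounded_measurable_def)

lemma bounded_measurable_power:
  fixes f :: "'a \<Rightarrow> real"
  shows "bounded_measurable M f \<Longrightarrow> bounded_measurable M (\<lambda>x. f x ^ k)"
  by (induction k) (auto intro: bounded_measurable_mult bounded_measurable_const)

lemma bounded_measurable_divide:
  fixes f :: "'a \<Rightarrow> real"
  shows "bounded_measurable M f \<Longrightarrow> bounded_measurable M (\<lambda>x. f x / c)"
  using bounded_measurable_mult[OF _ bounded_measurable_const, of M f "1 / c"] by simp

lemma bounded_measurable_of_real:
  "bounded_measurable M f \<Longrightarrow> bounded_measurable M (\<lambda>x. complex_of_real (f x))"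
  by (auto simp: bounded_measurable_def)

lemma bounded_measurable_iexp:
  fixes f :: "'a \<Rightarrow> real"
  assumes "f \<in> borel_measurable M" shows "bounded_measurable M (\<lambda>x. iexp (f x))"
proof (rule bounded_measurableI[where c = 1])
  show "(\<lambda>x. iexp (f x)) \<in> borel_measurable M"
    using assms[measurable] by measurable
qed simp

lemma bounded_measurable_square_integrable:
  fixes f :: "'a \<Rightarrow> real"
  assumes "prob_space M" "bounded_measurable M f"
  shows "square_integrable M f"
  using bounded_measurable_integrable[OF assms(1) bounded_measurable_power[OF assms(2), of 2]] assms(2)
  by (auto simp: square_integrable_def bounded_measurable_def)

lemma bounded_measurable_component:
  assumes f: "bounded_measurable P f" and i: "i < n"
  shows "bounded_measurable (samples P n) (\<lambda>u. f (u i))"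
proof -
  have m: "(\<lambda>u. u i) \<in> measurable (samples P n) P"
    using i by (intro measurable_component_singleton) simp
  show ?thesis using f measurable_compose[OF m, of f] unfolding bounded_measurable_def by blast
qed

lemmas bounded_measurable_intros =
  bounded_measurable_const bounded_measurable_add bounded_measurable_mult bounded_measurable_sum
  bounded_measurable_abs bounded_measurable_power bounded_measurable_divide bounded_measurable_of_real

lemma norm_iexp_minus_one_le: "norm (iexp x - 1) \<le> \<bar>x\<bar>"
  using iexp_approx1[of x 0] by simp

lemma norm_iexp_second_order_le: "norm (iexp x - 1 - \<i> * complex_of_real x) \<le> x\<^sup>2 / 2"
  using iexp_approx1[of x 1] by (simp add: diff_diff_eq power2_eq_square numeral_2_eq_2)

lemma power4_sum_le:
  fixes a :: "'i \<Rightarrow> real"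
  shows "(\<Sum>i\<in>I. a i)^4 \<le> (real (card I))^3 * (\<Sum>i\<in>I. (a i)^4)"
proof -
  have "(\<Sum>i\<in>I. a i)^4 = ((\<Sum>i\<in>I. a i)\<^sup>2)\<^sup>2" by (simp add: power_mult[symmetric])
  also have "\<dots> \<le> ((\<Sum>i\<in>I. (a i)\<^sup>2) * real (card I))\<^sup>2"
    using sum_squared_le_sum_of_squares[of a I] by (intro power_mono) auto
  also have "\<dots> = (real (card I))\<^sup>2 * (\<Sum>i\<in>I. (a i)\<^sup>2)\<^sup>2" by (simp add: power_mult_distrib)
  also have "\<dots> \<le> (real (card I))\<^sup>2 * ((\<Sum>i\<in>I. ((a i)\<^sup>2)\<^sup>2) * real (card I))"
    using sum_squared_le_sum_of_squares[of "\<lambda>i. (a i)\<^sup>2" I] by (intro mult_left_mono) auto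
  also have "\<dots> = (real (card I))^3 * (\<Sum>i\<in>I. (a i)^4)"
    by (simp add: power4_eq_xxxx power3_eq_cube power2_eq_square mult_ac)
  finally show ?thesis .
qed

section \<open>Leaving one observation out of a quadratic form\<close>

text \<open>The statistic studied here is
\<open>(1/2 \<Sum>i j. b i j h(u i, u j) + \<Sum>i. g i (u i)) / sqrt n\<close> for the symmetric kernel
\<open>h(x, y) = \<Sum>k\<in>K. p k x * q k y\<close>. A kernel of finite rank keeps the sums over observations linear
in functions of a single observation. The diagonal of \<open>b\<close> vanishes; diagonal contributions belong to \<open>g\<close>.\<close>

locale bounded_kernel =
  fixes P :: "'e measure" and K :: "'k set" and p q :: "'k \<Rightarrow> 'e \<Rightarrow> real"
    and C \<beta> :: real and n :: nat and b :: "nat \<Rightarrow> nat \<Rightarrow> real" and g :: "nat \<Rightarrow> 'e \<Rightarrow> real"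
  assumes P: "prob_space P" and K: "finite K" and C: "1 \<le> C" and n: "0 < n"
    and p_meas: "\<And>k. k \<in> K \<Longrightarrow> p k \<in> borel_measurable P"
    and q_meas: "\<And>k. k \<in> K \<Longrightarrow> q k \<in> borel_measurable P"
    and g_meas: "\<And>i. i < n \<Longrightarrow> g i \<in> borel_measurable P"
    and p_bound: "\<And>k x. k \<in> K \<Longrightarrow> \<bar>p k x\<bar> \<le> C"
    and q_bound: "\<And>k x. k \<in> K \<Longrightarrow> \<bar>q k x\<bar> \<le> C"
    and g_bound: "\<And>i x. i < n \<Longrightarrow> \<bar>g i x\<bar> \<le> C"
    and p_mean: "\<And>k. k \<in> K \<Longrightarrow> integral\<^sup>L P (p k) = 0"
    and q_mean: "\<And>k. k \<in> K \<Longrightarrow> integral\<^sup>L P (q k) = 0"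
    and g_mean: "\<And>i. i < n \<Longrightarrow> integral\<^sup>L P (g i) = 0"
    and kernel_sym: "\<And>x y. (\<Sum>k\<in>K. p k x * q k y) = (\<Sum>k\<in>K. p k y * q k x)"
    and b: "op_bounded n \<beta> b" and b_diag: "\<And>i. b i i = 0"
begin

sublocale P: prob_space P by (rule P)
sublocale S: prob_space "samples P n" by (rule prob_space_samples[OF P])

abbreviation "\<Omega> \<equiv> samples P n"

text \<open>\<open>H i / sqrt n\<close> collects the terms of the quadratic form that involve observation \<open>i\<close>, and so \<open>D i\<close>
collects all such terms of the statistic \<open>W\<close>. Each pair of observations is shared by two \<open>H i\<close>,
which is why \<open>V i\<close> takes only half of \<open>H i\<close>: the \<open>V i\<close> add up to \<open>W\<close>.
The function \<open>v i\<close> is the conditional expectation of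
\<open>V i * D i = ((g i)\<^sup>2 + 3/2 * g i * H i + 1/2 * (H i)\<^sup>2) / n\<close> given the other observations,
\<open>\<sigma>2\<close> is the expectation of \<open>\<Sum>i. v i\<close>, and \<open>C * T i / sqrt n\<close> majorizes \<open>V i\<close> and \<open>D i\<close>.\<close>

definition S where "S k i u = (\<Sum>j<n. b i j * q k (u j))" for k i and u :: "nat \<Rightarrow> 'e"
definition H where "H i u = (\<Sum>k\<in>K. p k (u i) * S k i u)" for i u
definition D where "D i u = (g i (u i) + H i u) / sqrt n" for i u
definition V where "V i u = (g i (u i) + H i u / 2) / sqrt n" for i u
definition W where "W u = (\<Sum>i<n. V i u)" for u
definition R where "R i u = W u - D i u" for i u
definition v where "v i u = (P.expectation (\<lambda>x. (g i x)\<^sup>2) + 3/2 * (\<Sum>k\<in>K. P.expectation (\<lambda>x. g i x * p k x) * S k i u)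
   + 1/2 * (\<Sum>k\<in>K. \<Sum>l\<in>K. P.expectation (\<lambda>x. p k x * p l x) * (S k i u * S l i u))) / n" for i u
definition T where "T i u = 1 + (\<Sum>k\<in>K. \<bar>S k i u\<bar>)" for i u
definition \<sigma>2 where "\<sigma>2 = ((\<Sum>i<n. P.expectation (\<lambda>x. (g i x)\<^sup>2)) + 1/2 * ((\<Sum>i<n. \<Sum>j<n. (b i j)\<^sup>2) *
   (\<Sum>k\<in>K. \<Sum>l\<in>K. P.expectation (\<lambda>x. p k x * p l x) * P.expectation (\<lambda>x. q k x * q l x)))) / n"

lemma bm_features:
  "k \<in> K \<Longrightarrow> bounded_measurable P (p k)" "k \<in> K \<Longrightarrow> bounded_measurable P (q k)" "i < n \<Longrightarrow> bounded_measurable P (g i)"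
  using p_meas q_meas g_meas p_bound q_bound g_bound by (auto intro!: bounded_measurableI[where c = C])

lemmas bm_component = bm_features[THEN bounded_measurable_component]

lemma bm_S: "k \<in> K \<Longrightarrow> bounded_measurable \<Omega> (S k i)"
  unfolding S_def by (intro bounded_measurable_intros bm_component) auto

lemma bm_H: "i < n \<Longrightarrow> bounded_measurable \<Omega> (H i)"
  unfolding H_def by (intro bounded_measurable_intros bm_component bm_S) auto

lemma bm_D: "i < n \<Longrightarrow> bounded_measurable \<Omega> (D i)"
  unfolding D_def by (intro bounded_measurable_intros bm_component bm_H)

lemma bm_V: "i < n \<Longrightarrow> bounded_measurable \<Omega> (V i)"
  unfolding V_def by (intro bounded_measurable_intros bm_component bm_H)

lemma bm_W: "bounded_measurable \<Omega> W"
  unfolding W_def by (intro bounded_measurable_intros bm_V) auto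

lemma bm_R: "i < n \<Longrightarrow> bounded_measurable \<Omega> (R i)"
proof -
  assume "i < n"
  moreover have "R i = (\<lambda>u. W u + (-1) * D i u)" by (simp add: R_def fun_eq_iff)
  ultimately show ?thesis by (simp only:) (intro bounded_measurable_intros bm_W bm_D)
qed

lemma bm_v: "bounded_measurable \<Omega> (v i)"
  unfolding v_def by (intro bounded_measurable_intros bm_S)

lemma bm_T: "bounded_measurable \<Omega> (T i)"
  unfolding T_def by (intro bounded_measurable_intros bm_S)

lemma bm_iexp: "bounded_measurable \<Omega> f \<Longrightarrow> bounded_measurable \<Omega> (\<lambda>u. iexp (s * f u))"
  by (rule bounded_measurable_iexp) (auto simp: bounded_measurable_def)

lemma S_free: "i < n \<Longrightarrow> S k i (u(i := y)) = S k i u"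
  unfolding S_def by (intro sum.cong refl) (auto simp: b_diag)

text \<open>By symmetry of \<open>b\<close> and of the kernel, the terms with first index \<open>i\<close> and those with second
index \<open>i\<close> contribute equally to the double sum; halved, they make up exactly \<open>H i\<close>.\<close>

lemma R_free:
  assumes i: "i < n"
  shows "R i (u(i := y)) = R i u"
proof -
  define h where "h x y = (\<Sum>k\<in>K. p k x * q k y)" for x y
  have hs: "h x y = h y x" for x y unfolding h_def by (rule kernel_sym)
  have Hh: "H m w = (\<Sum>j<n. b m j * h (w m) (w j))" for m w
    unfolding H_def S_def h_def by (simp add: sum_distrib_left sum.swap[of _ K] mult_ac)
  let ?I = "{..<n} - {i}"
  let ?r = "\<lambda>w. ((\<Sum>m\<in>?I. g m (w m)) + (\<Sum>m\<in>?I. \<Sum>j\<in>?I. b m j * h (w m) (w j)) / 2) / sqrt n"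
  have "R i w = ?r w" for w
  proof -
    have "(\<Sum>m<n. H m w) = H i w + (\<Sum>m\<in>?I. b m i * h (w m) (w i) + (\<Sum>j\<in>?I. b m j * h (w m) (w j)))"
      unfolding Hh using i
      by (subst sum.remove[of _ i]) (auto intro!: sum.cong simp: sum.remove[of "{..<n}" i])
    also have "\<dots> = H i w + ((\<Sum>m\<in>?I. b i m * h (w i) (w m)) + (\<Sum>m\<in>?I. \<Sum>j\<in>?I. b m j * h (w m) (w j)))"
      unfolding sum.distrib using i op_boundedD(2)[OF b]
      by (intro arg_cong2[where f = "(+)"] refl sum.cong) (auto simp: hs)
    also have "(\<Sum>m\<in>?I. b i m * h (w i) (w m)) = H i w"
      unfolding Hh using i b_diag by (subst sum.remove[of "{..<n}" i]) auto
    finally have *: "(\<Sum>m<n. H m w) = 2 * H i w + (\<Sum>m\<in>?I. \<Sum>j\<in>?I. b m j * h (w m) (w j))" by simp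
    have "W w = ((\<Sum>m<n. g m (w m)) + (\<Sum>m<n. H m w) / 2) / sqrt n"
      unfolding W_def V_def by (simp add: sum.distrib sum_divide_distrib add_divide_distrib)
    also have "(\<Sum>m<n. g m (w m)) = g i (w i) + (\<Sum>m\<in>?I. g m (w m))"
      using i by (subst sum.remove[of _ i]) auto
    finally have "W w = (g i (w i) + (\<Sum>m\<in>?I. g m (w m)) + (\<Sum>m<n. H m w) / 2) / sqrt n" .
    then show ?thesis unfolding * R_def D_def by (simp add: add_divide_distrib)
  qed
  note r = this
  show ?thesis unfolding r
    by (intro arg_cong2[where f = "(/)"] arg_cong2[where f = "(+)"] refl sum.cong) auto
qed

lemma factor:
  fixes F :: "'e \<Rightarrow> real" and G :: "(nat \<Rightarrow> 'e) \<Rightarrow> complex"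
  assumes i: "i < n" and F: "bounded_measurable P F" and G: "bounded_measurable \<Omega> G"
    and free: "\<And>u y. G (u(i := y)) = G u"
  shows "S.expectation (\<lambda>u. complex_of_real (F (u i)) * G u) = complex_of_real (P.expectation F) * S.expectation G"
proof -
  have "integrable P (\<lambda>x. complex_of_real (F x))"
    by (intro bounded_measurable_integrable[OF P] bounded_measurable_intros F)
  from samples_coordinate_factor(2)[OF P i this bounded_measurable_integrable[OF S.prob_space_axioms G] free]
  show ?thesis by simp
qed

text \<open>Given the other observations, \<open>V i\<close> is a linear combination of \<open>g i\<close> and the \<open>p k\<close> at
observation \<open>i\<close>, all of which are centred.\<close>

lemma expectation_V_rest:
  assumes i: "i < n"
  shows "S.expectation (\<lambda>u. complex_of_real (V i u) * iexp (s * R i u)) = 0"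
proof -
  let ?e = "\<lambda>u. iexp (s * R i u)"
  have bme: "bounded_measurable \<Omega> ?e" by (intro bm_iexp bm_R i)
  have Rf: "R i (u(i := y)) = R i u" for u y by (rule R_free[OF i])
  have z1: "S.expectation (\<lambda>u. complex_of_real (g i (u i)) * ?e u) = 0"
    using factor[OF i bm_features(3)[OF i] bme] g_mean[OF i] Rf by simp
  have z2: "S.expectation (\<lambda>u. complex_of_real (p k (u i)) * (complex_of_real (S k i u) * ?e u)) = 0" if "k \<in> K" for k
    using factor[OF i bm_features(1)[OF that], of "\<lambda>u. complex_of_real (S k i u) * ?e u"] p_mean[OF that] Rf S_free[OF i]
      bounded_measurable_mult[OF bounded_measurable_of_real[OF bm_S[OF that]] bme] by simp
  have "S.expectation (\<lambda>u. complex_of_real (V i u) * ?e u)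
    = S.expectation (\<lambda>u. 1 / sqrt n * (complex_of_real (g i (u i)) * ?e u
        + 1/2 * (\<Sum>k\<in>K. complex_of_real (p k (u i)) * (complex_of_real (S k i u) * ?e u))))"
    unfolding V_def H_def
    by (intro Bochner_Integration.integral_cong) (simp_all add: sum_distrib_left sum_distrib_right sum_divide_distrib divide_simps algebra_simps)
  also have "\<dots> = 1 / sqrt n * (S.expectation (\<lambda>u. complex_of_real (g i (u i)) * ?e u)
     + 1/2 * (\<Sum>k\<in>K. S.expectation (\<lambda>u. complex_of_real (p k (u i)) * (complex_of_real (S k i u) * ?e u))))"
  proof -
    have i1: "integrable \<Omega> (\<lambda>u. complex_of_real (g i (u i)) * ?e u)"
      by (intro bounded_measurable_integrable[OF S.prob_space_axioms] bounded_measurable_intros bm_component bme i)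
    have i2: "integrable \<Omega> (\<lambda>u. complex_of_real (p k (u i)) * (complex_of_real (S k i u) * ?e u))" if "k \<in> K" for k
      by (intro bounded_measurable_integrable[OF S.prob_space_axioms] bounded_measurable_intros bm_component bm_S bme i that)
    show ?thesis using i1 i2 by (simp add: Bochner_Integration.integral_sum)
  qed
  finally show ?thesis using z1 z2 by simp
qed

lemma expectation_VD_rest:
  assumes i: "i < n"
  shows "S.expectation (\<lambda>u. complex_of_real (V i u * D i u) * iexp (s * R i u))
    = S.expectation (\<lambda>u. complex_of_real (v i u) * iexp (s * R i u))"
proof -
  let ?e = "\<lambda>u. iexp (s * R i u)"
  have bme: "bounded_measurable \<Omega> ?e" by (intro bm_iexp bm_R i)
  have Rf: "R i (u(i := y)) = R i u" for u y by (rule R_free[OF i])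
  let ?G1 = "\<lambda>k u. complex_of_real (S k i u) * ?e u"
  let ?G2 = "\<lambda>k l u. complex_of_real (S k i u * S l i u) * ?e u"
  have bG1: "k \<in> K \<Longrightarrow> bounded_measurable \<Omega> (?G1 k)" for k
    by (intro bounded_measurable_intros bm_S bme)
  have bG2: "k \<in> K \<Longrightarrow> l \<in> K \<Longrightarrow> bounded_measurable \<Omega> (?G2 k l)" for k l
    by (intro bounded_measurable_intros bm_S bme)
  have bgg: "bounded_measurable P (\<lambda>x. (g i x)\<^sup>2)" by (intro bounded_measurable_intros bm_features i)
  have bgp: "k \<in> K \<Longrightarrow> bounded_measurable P (\<lambda>x. g i x * p k x)" for k by (intro bounded_measurable_intros bm_features i)
  have bpp: "k \<in> K \<Longrightarrow> l \<in> K \<Longrightarrow> bounded_measurable P (\<lambda>x. p k x * p l x)" for k l by (intro bounded_measurable_intros bm_features i)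
  have f0: "S.expectation (\<lambda>u. complex_of_real ((g i (u i))\<^sup>2) * ?e u)
      = complex_of_real (P.expectation (\<lambda>x. (g i x)\<^sup>2)) * S.expectation ?e"
    by (rule factor[OF i bgg bme]) (simp add: Rf)
  have f1: "S.expectation (\<lambda>u. complex_of_real (g i (u i) * p k (u i)) * ?G1 k u)
      = complex_of_real (P.expectation (\<lambda>x. g i x * p k x)) * S.expectation (?G1 k)" if "k \<in> K" for k
    by (rule factor[OF i bgp[OF that] bG1[OF that]]) (simp add: Rf S_free[OF i])
  have f2: "S.expectation (\<lambda>u. complex_of_real (p k (u i) * p l (u i)) * ?G2 k l u)
      = complex_of_real (P.expectation (\<lambda>x. p k x * p l x)) * S.expectation (?G2 k l)" if "k \<in> K" "l \<in> K" for k l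
    by (rule factor[OF i bpp[OF that] bG2[OF that]]) (simp add: Rf S_free[OF i])
  note int = bounded_measurable_integrable[OF S.prob_space_axioms]
  have i0: "integrable \<Omega> (\<lambda>u. complex_of_real ((g i (u i))\<^sup>2) * ?e u)"
    by (intro int bounded_measurable_intros bm_component bme i)
  have i1: "k \<in> K \<Longrightarrow> integrable \<Omega> (\<lambda>u. complex_of_real (g i (u i) * p k (u i)) * ?G1 k u)" for k
    by (intro int bounded_measurable_intros bm_component bG1 i)
  have i2: "k \<in> K \<Longrightarrow> l \<in> K \<Longrightarrow> integrable \<Omega> (\<lambda>u. complex_of_real (p k (u i) * p l (u i)) * ?G2 k l u)" for k l
    by (intro int bounded_measurable_intros bm_component bG2 i)
  have j0: "integrable \<Omega> ?e" by (intro int bme)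
  have j1: "k \<in> K \<Longrightarrow> integrable \<Omega> (?G1 k)" for k by (intro int bG1)
  have j2: "k \<in> K \<Longrightarrow> l \<in> K \<Longrightarrow> integrable \<Omega> (?G2 k l)" for k l by (intro int bG2)
  have nn: "sqrt (real n) * sqrt (real n) = real n" by simp
  have HH: "H i u * H i u = (\<Sum>k\<in>K. \<Sum>l\<in>K. p k (u i) * p l (u i) * (S k i u * S l i u))" for u
    unfolding H_def sum_product by (intro sum.cong refl) (simp add: mult_ac)
  have gH: "g i (u i) * H i u = (\<Sum>k\<in>K. g i (u i) * p k (u i) * S k i u)" for u
    unfolding H_def by (simp add: sum_distrib_left mult.assoc)
  have VD: "V i u * D i u = ((g i (u i))\<^sup>2 + 3/2 * (g i (u i) * H i u) + 1/2 * (H i u * H i u)) / n" for u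
    unfolding V_def D_def times_divide_times_eq nn by (simp add: field_simps power2_eq_square)
  have eq1: "complex_of_real (V i u * D i u) * ?e u = 1 / n * (complex_of_real ((g i (u i))\<^sup>2) * ?e u
     + 3/2 * (\<Sum>k\<in>K. complex_of_real (g i (u i) * p k (u i)) * ?G1 k u)
     + 1/2 * (\<Sum>k\<in>K. \<Sum>l\<in>K. complex_of_real (p k (u i) * p l (u i)) * ?G2 k l u))" for u
    unfolding VD HH gH
    by (simp add: sum_distrib_left sum_distrib_right sum_divide_distrib add_divide_distrib distrib_left distrib_right mult_ac)
  have eq2: "complex_of_real (v i u) * ?e u = 1 / n * (complex_of_real (P.expectation (\<lambda>x. (g i x)\<^sup>2)) * ?e u
     + 3/2 * (\<Sum>k\<in>K. complex_of_real (P.expectation (\<lambda>x. g i x * p k x)) * ?G1 k u)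
     + 1/2 * (\<Sum>k\<in>K. \<Sum>l\<in>K. complex_of_real (P.expectation (\<lambda>x. p k x * p l x)) * ?G2 k l u))" for u
    unfolding v_def
    by (simp add: sum_distrib_left sum_distrib_right sum_divide_distrib add_divide_distrib distrib_left distrib_right mult_ac)
  have "S.expectation (\<lambda>u. complex_of_real (V i u * D i u) * ?e u)
     = 1 / n * (S.expectation (\<lambda>u. complex_of_real ((g i (u i))\<^sup>2) * ?e u)
     + 3/2 * (\<Sum>k\<in>K. S.expectation (\<lambda>u. complex_of_real (g i (u i) * p k (u i)) * ?G1 k u))
     + 1/2 * (\<Sum>k\<in>K. \<Sum>l\<in>K. S.expectation (\<lambda>u. complex_of_real (p k (u i) * p l (u i)) * ?G2 k l u)))"
    unfolding eq1 using i0 i1 i2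
    by (subst integral_mult_right_zero integral_add integral_sum | simp add: integrable_sum integrable_mult_right integrable_add
       del: of_real_mult of_real_power)+
  also have "\<dots> = 1 / n * (complex_of_real (P.expectation (\<lambda>x. (g i x)\<^sup>2)) * S.expectation ?e
     + 3/2 * (\<Sum>k\<in>K. complex_of_real (P.expectation (\<lambda>x. g i x * p k x)) * S.expectation (?G1 k))
     + 1/2 * (\<Sum>k\<in>K. \<Sum>l\<in>K. complex_of_real (P.expectation (\<lambda>x. p k x * p l x)) * S.expectation (?G2 k l)))"
    by (simp only: f0 f1 f2 cong: sum.cong)
  also have "\<dots> = S.expectation (\<lambda>u. complex_of_real (v i u) * ?e u)"
    unfolding eq2 using j0 j1 j2
    by (subst integral_mult_right_zero integral_add integral_sum | simp add: integrable_sum integrable_mult_right integrable_add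
       del: of_real_mult of_real_power)+
  finally show ?thesis .
qed

lemma T_ge_1: "1 \<le> T i u"
  unfolding T_def by (simp add: sum_nonneg)

lemma H_le: "\<bar>H i u\<bar> \<le> C * (\<Sum>k\<in>K. \<bar>S k i u\<bar>)"
proof -
  have "\<bar>H i u\<bar> \<le> (\<Sum>k\<in>K. \<bar>p k (u i) * S k i u\<bar>)" unfolding H_def by (rule sum_abs)
  also have "\<dots> \<le> (\<Sum>k\<in>K. C * \<bar>S k i u\<bar>)"
    by (intro sum_mono) (simp add: abs_mult mult_right_mono p_bound)
  finally show ?thesis by (simp add: sum_distrib_left)
qed

lemma D_le:
  assumes i: "i < n" shows "\<bar>D i u\<bar> \<le> C * T i u / sqrt n"
proof -
  have "\<bar>g i (u i) + H i u\<bar> \<le> C + C * (\<Sum>k\<in>K. \<bar>S k i u\<bar>)"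
    using g_bound[OF i, of "u i"] H_le[of i u] by linarith
  then show ?thesis unfolding D_def T_def by (simp add: divide_right_mono distrib_left)
qed

lemma V_le:
  assumes i: "i < n" shows "\<bar>V i u\<bar> \<le> C * T i u / sqrt n"
proof -
  have "\<bar>g i (u i) + H i u / 2\<bar> \<le> C + C * (\<Sum>k\<in>K. \<bar>S k i u\<bar>)"
    using g_bound[OF i, of "u i"] H_le[of i u] by linarith
  then show ?thesis unfolding V_def T_def by (simp add: divide_right_mono distrib_left)
qed

lemma expectation_product_le:
  assumes "bounded_measurable P f" "bounded_measurable P h" "\<And>x. \<bar>f x\<bar> \<le> C" "\<And>x. \<bar>h x\<bar> \<le> C"
  shows "\<bar>P.expectation (\<lambda>x. f x * h x)\<bar> \<le> C\<^sup>2"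
proof -
  have "\<bar>f x * h x\<bar> \<le> C\<^sup>2" for x
    unfolding abs_mult power2_eq_square using C assms(3,4) by (intro mult_mono) auto
  moreover have "integrable P (\<lambda>x. f x * h x)"
    by (intro bounded_measurable_integrable[OF P] bounded_measurable_intros assms)
  ultimately show ?thesis
    using P.integral_le_const[of "\<lambda>x. f x * h x" "C\<^sup>2"] P.integral_ge_const[of "\<lambda>x. f x * h x" "- (C\<^sup>2)"]
    by (auto simp: abs_le_iff minus_le_iff)
qed

lemma v_le:
  assumes i: "i < n" shows "\<bar>v i u\<bar> \<le> 3/2 * (C\<^sup>2 * (T i u)\<^sup>2) / n"
proof -
  let ?s = "\<Sum>k\<in>K. \<bar>S k i u\<bar>"
  have e: "\<bar>P.expectation (\<lambda>x. (g i x)\<^sup>2)\<bar> \<le> C\<^sup>2"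
    using expectation_product_le[OF bm_features(3)[OF i] bm_features(3)[OF i] g_bound[OF i] g_bound[OF i]]
    by (simp add: power2_eq_square)
  have "\<bar>\<Sum>k\<in>K. P.expectation (\<lambda>x. g i x * p k x) * S k i u\<bar> \<le> (\<Sum>k\<in>K. C\<^sup>2 * \<bar>S k i u\<bar>)"
    by (rule order_trans[OF sum_abs], intro sum_mono, unfold abs_mult, intro mult_right_mono expectation_product_le)
       (auto simp: i p_bound g_bound intro: bm_features)
  then have f: "\<bar>\<Sum>k\<in>K. P.expectation (\<lambda>x. g i x * p k x) * S k i u\<bar> \<le> C\<^sup>2 * ?s" by (simp add: sum_distrib_left)
  have "\<bar>\<Sum>k\<in>K. \<Sum>l\<in>K. P.expectation (\<lambda>x. p k x * p l x) * (S k i u * S l i u)\<bar>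
     \<le> (\<Sum>k\<in>K. \<Sum>l\<in>K. C\<^sup>2 * (\<bar>S k i u\<bar> * \<bar>S l i u\<bar>))"
    by (rule order_trans[OF sum_abs], intro sum_mono, rule order_trans[OF sum_abs], intro sum_mono,
        unfold abs_mult, intro mult_right_mono expectation_product_le)
       (auto simp: p_bound intro: bm_features)
  also have "\<dots> = C\<^sup>2 * ?s\<^sup>2" unfolding power2_eq_square[of ?s] sum_product by (simp only: sum_distrib_left)
  finally have h: "\<bar>\<Sum>k\<in>K. \<Sum>l\<in>K. P.expectation (\<lambda>x. p k x * p l x) * (S k i u * S l i u)\<bar> \<le> C\<^sup>2 * ?s\<^sup>2" .
  have s: "0 \<le> C\<^sup>2 * ?s" "0 \<le> C\<^sup>2 * ?s\<^sup>2" "0 \<le> C\<^sup>2" by (auto simp: sum_nonneg)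
  have "C\<^sup>2 * (T i u)\<^sup>2 = C\<^sup>2 + 2 * (C\<^sup>2 * ?s) + C\<^sup>2 * ?s\<^sup>2"
    unfolding T_def by (simp add: power2_sum algebra_simps)
  then have "\<bar>P.expectation (\<lambda>x. (g i x)\<^sup>2) + 3/2 * (\<Sum>k\<in>K. P.expectation (\<lambda>x. g i x * p k x) * S k i u)
   + 1/2 * (\<Sum>k\<in>K. \<Sum>l\<in>K. P.expectation (\<lambda>x. p k x * p l x) * (S k i u * S l i u))\<bar> \<le> 3/2 * (C\<^sup>2 * (T i u)\<^sup>2)"
    using e f h s by linarith
  from divide_right_mono[OF this, of "real n"] show ?thesis unfolding v_def by simp
qed

text \<open>Each \<open>S k i\<close> is a linear form whose coefficients are a row of \<open>b\<close>, of squared length at most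
\<open>\<beta>\<^sup>2\<close>; hence its moments are bounded independently of \<open>n\<close>.\<close>

lemma expectation_T4:
  assumes i: "i < n"
  shows "S.expectation (\<lambda>u. T i u ^ 4) \<le> (real (card K) + 1)^3 * (1 + card K * (3 * C^4 * \<beta>^4))"
proof -
  have S4: "S.expectation (\<lambda>u. S k i u ^ 4) \<le> 3 * C^4 * \<beta>^4" if k: "k \<in> K" for k
  proof -
    have "S.expectation (\<lambda>u. S k i u ^ 4) \<le> 3 * C^4 * (\<Sum>j<n. (b i j)\<^sup>2)\<^sup>2"
      unfolding S_def by (rule linear_form_fourth_moment[OF P q_meas[OF k] q_bound[OF k] q_mean[OF k]]) simp
    also have "\<dots> \<le> 3 * C^4 * (\<beta>\<^sup>2)\<^sup>2"
      using op_bounded_row[OF b i] by (intro mult_left_mono power_mono) (auto simp: sum_nonneg)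
    finally show ?thesis by simp
  qed
  have T: "T i u ^ 4 \<le> (real (card K) + 1)^3 * (1 + (\<Sum>k\<in>K. S k i u ^ 4))" for u
  proof -
    \<comment> \<open>None stands for the summand 1 of T, so that T is one sum to which the power mean bound applies\<close>
    let ?a = "\<lambda>k. case k of None \<Rightarrow> 1 | Some k \<Rightarrow> \<bar>S k i u\<bar>"
    let ?I = "insert None (Some ` K)"
    have "sum ?a ?I = T i u" using K by (simp add: T_def sum.reindex)
    moreover have "(\<Sum>k\<in>?I. ?a k ^ 4) = 1 + (\<Sum>k\<in>K. S k i u ^ 4)" using K by (simp add: sum.reindex)
    moreover have "card ?I = card K + 1" using K by (simp add: card_image)
    ultimately show ?thesis using power4_sum_le[of ?a ?I] by (simp add: add.commute)
  qed
  note int = bounded_measurable_integrable[OF S.prob_space_axioms]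
  have iS: "k \<in> K \<Longrightarrow> integrable \<Omega> (\<lambda>u. S k i u ^ 4)" for k by (intro int bounded_measurable_intros bm_S)
  have "S.expectation (\<lambda>u. T i u ^ 4) \<le> S.expectation (\<lambda>u. (real (card K) + 1)^3 * (1 + (\<Sum>k\<in>K. S k i u ^ 4)))"
    by (rule integral_mono[OF _ _ T]) (intro int bounded_measurable_intros bm_T bm_S; assumption?)+
  also have "\<dots> = (real (card K) + 1)^3 * (1 + (\<Sum>k\<in>K. S.expectation (\<lambda>u. S k i u ^ 4)))"
    using iS by (simp add: S.prob_space)
  also have "\<dots> \<le> (real (card K) + 1)^3 * (1 + (\<Sum>k\<in>K. 3 * C^4 * \<beta>^4))"
    using S4 by (intro mult_left_mono add_left_mono sum_mono) auto
  finally show ?thesis by simp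
qed

definition growth_bound where "growth_bound = (real (card K) + 1)^3 * (1 + card K * (3 * C^4 * \<beta>^4))"

text \<open>Integration by parts for \<open>exp (\<i> s W)\<close> in observation \<open>i\<close>. In the expansion
\<open>exp (\<i> s W) = exp (\<i> s (R i)) * (1 + \<i> s (D i) + \<dots>)\<close> the first term vanishes against \<open>V i\<close> by
\<open>expectation_V_rest\<close>, and the second turns \<open>V i * D i\<close> into \<open>v i\<close> by \<open>expectation_VD_rest\<close>.
Returning from \<open>R i\<close> to \<open>W\<close> in the second term costs one more factor of order \<open>1 / sqrt n\<close>,
like the remainder of the expansion.\<close>

lemma leave_one_out:
  assumes i: "i < n" and s: "\<bar>s\<bar> \<le> 1"
  shows "norm (S.expectation (\<lambda>u. complex_of_real (V i u) * iexp (s * W u))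
      - \<i> * s * S.expectation (\<lambda>u. complex_of_real (v i u) * iexp (s * W u))) \<le> 2 * C^3 * growth_bound / (n * sqrt n)"
proof -
  let ?eR = "\<lambda>u. iexp (s * R i u)" and ?eW = "\<lambda>u. iexp (s * W u)"
  let ?A = "\<lambda>u. complex_of_real (V i u) * ?eW u" and ?B = "\<lambda>u. complex_of_real (v i u) * ?eW u"
  let ?A' = "\<lambda>u. complex_of_real (V i u) * ?eR u" and ?B' = "\<lambda>u. complex_of_real (v i u) * ?eR u"
  let ?E' = "\<lambda>u. complex_of_real (V i u * D i u) * ?eR u"
  let ?\<Delta> = "\<lambda>u. ?A u - \<i> * s * ?B u - (?A' u + \<i> * s * (?E' u - ?B' u))"
  note int = bounded_measurable_integrable[OF S.prob_space_axioms]
  have ii: "integrable \<Omega> ?A" "integrable \<Omega> ?B" "integrable \<Omega> ?A'" "integrable \<Omega> ?B'" "integrable \<Omega> ?E'"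
    by (intro int bounded_measurable_intros bm_iexp bm_V bm_W bm_R bm_v bm_D i)+
  have "S.expectation ?\<Delta> = S.expectation ?A - \<i> * s * S.expectation ?B
      - (S.expectation ?A' + \<i> * s * (S.expectation ?E' - S.expectation ?B'))"
    using ii by simp
  also have "\<dots> = S.expectation ?A - \<i> * s * S.expectation ?B"
    using expectation_V_rest[OF i, of s] expectation_VD_rest[OF i, of s] by simp
  finally have eq: "S.expectation ?A - \<i> * s * S.expectation ?B = S.expectation ?\<Delta>" ..
  \<comment> \<open>third order in 1 / sqrt n; the cube of T is enlarged to the fourth power, whose expectation is known\<close>
  have pt: "norm (?\<Delta> u) \<le> 2 * C^3 / (n * sqrt n) * T i u ^ 4" for u
  proof -
    let ?D = "D i u" and ?t = "C * T i u / sqrt n"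
    have W: "?eW u = ?eR u * iexp (s * ?D)"
      unfolding R_def by (simp add: exp_add[symmetric] algebra_simps)
    have D: "\<bar>?D\<bar> \<le> ?t" and Vb: "\<bar>V i u\<bar> \<le> ?t" and t0: "0 \<le> ?t"
      using D_le[OF i, of u] V_le[OF i, of u] by auto
    have vb: "\<bar>v i u\<bar> \<le> 3/2 * ?t\<^sup>2"
      using v_le[OF i, of u] by (simp add: power_divide power_mult_distrib)
    define x y where "x = iexp (s * ?D) - 1 - \<i> * complex_of_real (s * ?D)" and "y = iexp (s * ?D) - 1"
    have "?\<Delta> u = ?eR u * (complex_of_real (V i u) * x - \<i> * s * complex_of_real (v i u) * y)"
      unfolding W x_def y_def by (simp add: algebra_simps)
    then have "norm (?\<Delta> u) = norm (complex_of_real (V i u) * x - \<i> * s * complex_of_real (v i u) * y)"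
      by (simp add: norm_mult)
    also have "\<dots> \<le> norm (complex_of_real (V i u) * x) + norm (\<i> * s * complex_of_real (v i u) * y)"
      by (rule norm_triangle_ineq4)
    also have "\<dots> = \<bar>V i u\<bar> * norm x + \<bar>s\<bar> * \<bar>v i u\<bar> * norm y"
      by (simp add: norm_mult)
    also have "\<dots> \<le> ?t * (?t\<^sup>2 / 2) + 1 * (3/2 * ?t\<^sup>2) * ?t"
    proof (intro add_mono mult_mono)
      have "\<bar>s * ?D\<bar> \<le> \<bar>?D\<bar>" using s by (simp add: abs_mult mult_left_le_one_le)
      then have sD: "\<bar>s * ?D\<bar> \<le> ?t" using D by linarith
      show "norm y \<le> ?t" unfolding y_def using norm_iexp_minus_one_le[of "s * ?D"] sD by linarith
      have "(s * ?D)\<^sup>2 \<le> ?t\<^sup>2" using power_mono[OF sD abs_ge_zero, of 2] by simp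
      then show "norm x \<le> ?t\<^sup>2 / 2"
        unfolding x_def using norm_iexp_second_order_le[of "s * ?D"] by linarith
    qed (use Vb s vb t0 in auto)
    also have "\<dots> = 2 * ?t^3" by (simp add: power3_eq_cube power2_eq_square)
    also have "\<dots> = 2 * C^3 / (n * sqrt n) * T i u ^ 3"
      using n by (simp add: power_divide power_mult_distrib power3_eq_cube)
    also have "\<dots> \<le> 2 * C^3 / (n * sqrt n) * T i u ^ 4"
      using C T_ge_1[of i u] by (intro mult_left_mono power_increasing) auto
    finally show ?thesis .
  qed
  have "norm (S.expectation ?\<Delta>) \<le> S.expectation (\<lambda>u. 2 * C^3 / (n * sqrt n) * T i u ^ 4)"
  proof (rule order_trans[OF integral_norm_bound], rule integral_mono)
    show "integrable \<Omega> (\<lambda>u. norm (?\<Delta> u))" using ii by (intro integrable_norm) auto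
    show "integrable \<Omega> (\<lambda>u. 2 * C^3 / (n * sqrt n) * T i u ^ 4)"
      by (intro int bounded_measurable_intros bm_T)
  qed (rule pt)
  also have "\<dots> = 2 * C^3 / (n * sqrt n) * S.expectation (\<lambda>u. T i u ^ 4)" by simp
  also have "\<dots> \<le> 2 * C^3 / (n * sqrt n) * growth_bound"
    using expectation_T4[OF i] C unfolding growth_bound_def by (intro mult_left_mono) auto
  finally show ?thesis unfolding eq by simp
qed

lemma sum_leave_one_out:
  assumes s: "\<bar>s\<bar> \<le> 1"
  shows "norm (S.expectation (\<lambda>u. complex_of_real (W u) * iexp (s * W u))
      - \<i> * s * S.expectation (\<lambda>u. complex_of_real (\<Sum>i<n. v i u) * iexp (s * W u))) \<le> 2 * C^3 * growth_bound / sqrt n"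
proof -
  let ?eW = "\<lambda>u. iexp (s * W u)"
  note int = bounded_measurable_integrable[OF S.prob_space_axioms]
  have iV: "i < n \<Longrightarrow> integrable \<Omega> (\<lambda>u. complex_of_real (V i u) * ?eW u)" for i
    by (intro int bounded_measurable_intros bm_iexp bm_V bm_W)
  have iv: "integrable \<Omega> (\<lambda>u. complex_of_real (v i u) * ?eW u)" for i
    by (intro int bounded_measurable_intros bm_iexp bm_v bm_W)
  have Wc: "complex_of_real (W u) * c = (\<Sum>i<n. complex_of_real (V i u) * c)" for u c
    by (simp add: W_def sum_distrib_right)
  have e1: "S.expectation (\<lambda>u. complex_of_real (W u) * ?eW u) = (\<Sum>i<n. S.expectation (\<lambda>u. complex_of_real (V i u) * ?eW u))"
    unfolding Wc using iV by (subst Bochner_Integration.integral_sum) auto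
  have vc: "complex_of_real (\<Sum>i<n. v i u) * c = (\<Sum>i<n. complex_of_real (v i u) * c)" for u c
    by (simp add: sum_distrib_right)
  have e2: "S.expectation (\<lambda>u. complex_of_real (\<Sum>i<n. v i u) * ?eW u) = (\<Sum>i<n. S.expectation (\<lambda>u. complex_of_real (v i u) * ?eW u))"
    unfolding vc using iv by (subst Bochner_Integration.integral_sum) auto
  have "norm (\<Sum>i<n. S.expectation (\<lambda>u. complex_of_real (V i u) * ?eW u) - \<i> * s * S.expectation (\<lambda>u. complex_of_real (v i u) * ?eW u))
      \<le> (\<Sum>i<n. 2 * C^3 * growth_bound / (n * sqrt n))"
    by (intro sum_norm_le leave_one_out s) simp
  also have "\<dots> = 2 * C^3 * growth_bound / sqrt n" using n by simp
  finally show ?thesis unfolding e1 e2 sum_subtractf sum_distrib_left .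
qed

definition fluctuation_bound where "fluctuation_bound = 3/2 * (card K * (C^3 * \<beta>)) + 3/2 * (card K * card K * (C^4 * \<beta>\<^sup>2))"

lemma expectation_q_product_L2:
  assumes "k \<in> K" "l \<in> K"
  shows "P.expectation (\<lambda>x. (q k x * q l x - P.expectation (\<lambda>x. q k x * q l x))\<^sup>2) \<le> C^4"
proof -
  have bm: "bounded_measurable P (\<lambda>x. q k x * q l x)"
    by (intro bounded_measurable_intros bm_features assms)
  have i2: "integrable P (\<lambda>x. (q k x * q l x)\<^sup>2)"
    by (intro bounded_measurable_integrable[OF P] bounded_measurable_power bm)
  have "P.variance (\<lambda>x. q k x * q l x) \<le> P.expectation (\<lambda>x. (q k x * q l x)\<^sup>2)"
    using P.variance_eq[OF bounded_measurable_integrable[OF P bm] i2] by simp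
  also have "\<dots> \<le> C^4"
  proof (rule P.integral_le_const[OF i2], rule AE_I2)
    fix x
    have "\<bar>q k x * q l x\<bar> \<le> C * C"
      unfolding abs_mult using C q_bound[OF assms(1)] q_bound[OF assms(2)] by (intro mult_mono) auto
    from power_mono[OF this abs_ge_zero, of 2] show "(q k x * q l x)\<^sup>2 \<le> C^4"
      by (simp add: power4_eq_xxxx power2_eq_square mult_ac)
  qed
  finally show ?thesis .
qed

lemma square_expectation_le_C2:
  assumes "k \<in> K" shows "P.expectation (\<lambda>x. (q k x)\<^sup>2) \<le> C\<^sup>2" "0 \<le> P.expectation (\<lambda>x. (q k x)\<^sup>2)"
  using expectation_product_le[of "q k" "q k"] bm_features(2)[OF assms] q_bound[OF assms]
  by (auto simp: power2_eq_square abs_le_iff)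

text \<open>The fluctuations of \<open>\<Sum>i. v i\<close> are of three kinds: a linear form \<open>L\<close> from the mixed
terms, and from \<open>\<Sum>i. S k i * S l i = \<Sum>j m. gram n b j m * q k (u j) * q l (u m)\<close> a linear form
\<open>X\<close> (the diagonal, centred) and a quadratic form \<open>Y\<close> (the rest). All have \<open>L\<^sup>2\<close> norm of order
\<open>sqrt n\<close> and are divided by \<open>n\<close>. For \<open>Y\<close> this requires the Frobenius norm of \<open>b\<^sup>T b\<close> to be of
order \<open>sqrt n\<close>, which is where the bound on the operator norm of \<open>b\<close> is essential.\<close>

lemma conditional_variance_concentrates:
  "S.expectation (\<lambda>u. \<bar>(\<Sum>i<n. v i u) - \<sigma>2\<bar>) \<le> fluctuation_bound / sqrt n"
proof -
  note int = bounded_measurable_integrable[OF S.prob_space_axioms]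
  note sqi = bounded_measurable_square_integrable[OF P]
  define e where "e k i = P.expectation (\<lambda>x. g i x * p k x)" for k i
  define c where "c k l = P.expectation (\<lambda>x. p k x * p l x)" for k l
  define d where "d k l = P.expectation (\<lambda>x. q k x * q l x)" for k l
  define L where "L k u = (\<Sum>j<n. (\<Sum>i<n. e k i * b i j) * q k (u j))" for k and u :: "nat \<Rightarrow> 'e"
  define X where "X k l u = (\<Sum>j<n. gram n b j j * (q k (u j) * q l (u j) - d k l))" for k l and u :: "nat \<Rightarrow> 'e"
  define Y where "Y k l u = (\<Sum>i<n. \<Sum>j<n. off_diagonal (gram n b) i j * (q k (u i) * q l (u j)))" for k l and u :: "nat \<Rightarrow> 'e"
  have \<beta>: "0 \<le> \<beta>" by (rule op_boundedD(1)[OF b])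
  have C0: "0 \<le> C" using C by simp
  define N where "N = (\<Sum>i<n. \<Sum>j<n. (b i j)\<^sup>2)"
  have SS: "(\<Sum>i<n. S k i u * S l i u) = X k l u + Y k l u + N * d k l" for k l u
  proof -
    have "(\<Sum>i<n. S k i u * S l i u) = (\<Sum>i<n. \<Sum>j<n. \<Sum>m<n. b i j * b i m * (q k (u j) * q l (u m)))"
      unfolding S_def sum_product by (simp add: mult_ac)
    also have "\<dots> = (\<Sum>j<n. \<Sum>i<n. \<Sum>m<n. b i j * b i m * (q k (u j) * q l (u m)))"
      by (rule sum.swap)
    also have "\<dots> = (\<Sum>j<n. \<Sum>m<n. gram n b j m * (q k (u j) * q l (u m)))"
      unfolding gram_def sum_distrib_right by (intro sum.cong refl sum.swap)
    also have "\<dots> = (\<Sum>j<n. gram n b j j * (q k (u j) * q l (u j)) + (\<Sum>m<n. off_diagonal (gram n b) j m * (q k (u j) * q l (u m))))"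
      by (intro sum.cong refl, subst (1 2) sum.remove[of "{..<n}"]) (auto simp: off_diagonal_def intro!: sum.cong)
    also have "\<dots> = X k l u + Y k l u + (\<Sum>j<n. gram n b j j) * d k l"
      unfolding X_def Y_def by (simp add: sum.distrib sum_distrib_right right_diff_distrib sum_subtractf)
    also have "(\<Sum>j<n. gram n b j j) = N"
      unfolding N_def gram_def power2_eq_square by (rule sum.swap)
    finally show ?thesis .
  qed
  have eS: "(\<Sum>i<n. e k i * S k i u) = L k u" for k u
    unfolding L_def S_def sum_distrib_left sum_distrib_right by (subst sum.swap) (simp add: mult.assoc)
  have "(\<Sum>i<n. v i u) - \<sigma>2 = (3/2 * (\<Sum>k\<in>K. L k u) + 1/2 * (\<Sum>k\<in>K. \<Sum>l\<in>K. c k l * (X k l u + Y k l u))) / n" for u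
  proof -
    have "(\<Sum>i<n. v i u) = ((\<Sum>i<n. P.expectation (\<lambda>x. (g i x)\<^sup>2)) + 3/2 * (\<Sum>i<n. \<Sum>k\<in>K. e k i * S k i u)
        + 1/2 * (\<Sum>i<n. \<Sum>k\<in>K. \<Sum>l\<in>K. c k l * (S k i u * S l i u))) / n"
      unfolding v_def sum_divide_distrib[symmetric] sum.distrib sum_distrib_left[symmetric] e_def c_def ..
    also have "(\<Sum>i<n. \<Sum>k\<in>K. e k i * S k i u) = (\<Sum>k\<in>K. L k u)"
      by (subst sum.swap) (simp add: eS)
    also have "(\<Sum>i<n. \<Sum>k\<in>K. \<Sum>l\<in>K. c k l * (S k i u * S l i u)) = (\<Sum>k\<in>K. \<Sum>l\<in>K. c k l * (\<Sum>i<n. S k i u * S l i u))"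
      unfolding sum_distrib_left by (subst sum.swap, intro sum.cong refl sum.swap)
    also have "\<dots> = (\<Sum>k\<in>K. \<Sum>l\<in>K. c k l * (X k l u + Y k l u)) + N * (\<Sum>k\<in>K. \<Sum>l\<in>K. c k l * d k l)"
      unfolding SS distrib_left sum.distrib by (simp add: sum_distrib_left mult_ac)
    finally show ?thesis unfolding \<sigma>2_def c_def[symmetric] d_def[symmetric] N_def[symmetric] by (simp add: diff_divide_distrib[symmetric])
  qed
  note dev = this
  have EL: "S.expectation (\<lambda>u. \<bar>L k u\<bar>) \<le> C^3 * \<beta> * sqrt n" if k: "k \<in> K" for k
  proof (rule S.expectation_abs_le_L2)
    note wl = weighted_sum_L2[OF P sqi[OF bm_features(2)[OF k]] q_mean[OF k], of "{..<n}" n "\<lambda>j. \<Sum>i<n. e k i * b i j"]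
    show "square_integrable \<Omega> (L k)" unfolding L_def using wl(1) by simp
    have "S.expectation (\<lambda>u. (L k u)\<^sup>2) = P.expectation (\<lambda>x. (q k x)\<^sup>2) * (\<Sum>j<n. (\<Sum>i<n. e k i * b i j)\<^sup>2)"
      unfolding L_def using wl(2) by simp
    also have "\<dots> \<le> C\<^sup>2 * (\<beta>\<^sup>2 * (real n * (C\<^sup>2)\<^sup>2))"
    proof (intro mult_mono square_expectation_le_C2 k op_bounded_left_apply[OF b])
      show "\<bar>e k i\<bar> \<le> C\<^sup>2" if "i < n" for i
        unfolding e_def using that k by (intro expectation_product_le bm_features p_bound g_bound)
    qed (auto simp: sum_nonneg)
    also have "\<dots> = (C^3 * \<beta> * sqrt n)\<^sup>2" by (simp add: power_mult_distrib power2_eq_square power3_eq_cube)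
    finally show "S.expectation (\<lambda>u. (L k u)\<^sup>2) \<le> (C^3 * \<beta> * sqrt n)\<^sup>2" .
  qed (use C0 \<beta> in auto)
  have EX: "S.expectation (\<lambda>u. \<bar>X k l u\<bar>) \<le> C\<^sup>2 * \<beta>\<^sup>2 * sqrt n" if kl: "k \<in> K" "l \<in> K" for k l
  proof (rule S.expectation_abs_le_L2)
    let ?f = "\<lambda>x. q k x * q l x - d k l"
    have bq: "bounded_measurable P (\<lambda>x. q k x * q l x)" by (intro bounded_measurable_intros bm_features kl)
    have bf: "bounded_measurable P ?f"
      using bounded_measurable_add[OF bq bounded_measurable_const[of _ "- d k l"]] by simp
    have mf: "integral\<^sup>L P ?f = 0" using bounded_measurable_integrable[OF P bq] by (simp add: d_def P.prob_space)
    note wl = weighted_sum_L2[OF P sqi[OF bf] mf, of "{..<n}" n "\<lambda>j. gram n b j j"]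
    show "square_integrable \<Omega> (X k l)" unfolding X_def using wl(1) by simp
    have "S.expectation (\<lambda>u. (X k l u)\<^sup>2) = P.expectation (\<lambda>x. (?f x)\<^sup>2) * (\<Sum>j<n. (gram n b j j)\<^sup>2)"
      unfolding X_def using wl(2) by simp
    also have "\<dots> \<le> C^4 * (\<Sum>j<n. (\<beta>\<^sup>2)\<^sup>2)"
      using expectation_q_product_L2[OF kl] gram_diagonal_le[OF b]
      unfolding d_def by (intro mult_mono sum_mono power_mono) (auto simp: sum_nonneg)
    also have "\<dots> = (C\<^sup>2 * \<beta>\<^sup>2 * sqrt n)\<^sup>2" by (simp add: power_mult_distrib)
    finally show "S.expectation (\<lambda>u. (X k l u)\<^sup>2) \<le> (C\<^sup>2 * \<beta>\<^sup>2 * sqrt n)\<^sup>2" .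
  qed auto
  have EY: "S.expectation (\<lambda>u. \<bar>Y k l u\<bar>) \<le> 2 * (C\<^sup>2 * \<beta>\<^sup>2 * sqrt n)" if kl: "k \<in> K" "l \<in> K" for k l
  proof (rule S.expectation_abs_le_L2)
    note qf = quadratic_form_L2[OF P sqi[OF bm_features(2)[OF kl(1)]] q_mean[OF kl(1)] sqi[OF bm_features(2)[OF kl(2)]] q_mean[OF kl(2)],
        of "off_diagonal (gram n b)" n n]
    show "square_integrable \<Omega> (Y k l)" unfolding Y_def using qf(1) by (simp add: off_diagonal_def)
    have "S.expectation (\<lambda>u. (Y k l u)\<^sup>2) \<le> 2 * P.expectation (\<lambda>x. (q k x)\<^sup>2) * P.expectation (\<lambda>x. (q l x)\<^sup>2)
        * (\<Sum>i<n. \<Sum>j<n. (off_diagonal (gram n b) i j)\<^sup>2)"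
      unfolding Y_def using qf(2) by (simp add: off_diagonal_def)
    also have "\<dots> \<le> 2 * C\<^sup>2 * C\<^sup>2 * (\<Sum>i<n. \<beta>^4)"
    proof (intro mult_mono sum_mono square_expectation_le_C2 kl order_refl)
      fix i assume "i \<in> {..<n}"
      then have "(\<Sum>j<n. (gram n b i j)\<^sup>2) \<le> \<beta>^4" by (intro gram_row[OF b]) simp
      moreover have "(\<Sum>j<n. (off_diagonal (gram n b) i j)\<^sup>2) \<le> (\<Sum>j<n. (gram n b i j)\<^sup>2)"
        by (intro sum_mono) (simp add: off_diagonal_def)
      ultimately show "(\<Sum>j<n. (off_diagonal (gram n b) i j)\<^sup>2) \<le> \<beta>^4" by linarith
    qed (auto simp: sum_nonneg)
    also have "\<dots> = 2 * (C\<^sup>2 * \<beta>\<^sup>2 * sqrt n)\<^sup>2" by (simp add: power_mult_distrib power4_eq_xxxx power2_eq_square)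
    also have "\<dots> \<le> (2 * (C\<^sup>2 * \<beta>\<^sup>2 * sqrt n))\<^sup>2" unfolding power_mult_distrib[of 2] by simp
    finally show "S.expectation (\<lambda>u. (Y k l u)\<^sup>2) \<le> (2 * (C\<^sup>2 * \<beta>\<^sup>2 * sqrt n))\<^sup>2" .
  qed auto
  have cb: "\<bar>c k l\<bar> \<le> C\<^sup>2" if "k \<in> K" "l \<in> K" for k l
    unfolding c_def using that by (intro expectation_product_le bm_features p_bound)
  have bL: "k \<in> K \<Longrightarrow> bounded_measurable \<Omega> (L k)" for k
    unfolding L_def by (intro bounded_measurable_intros bm_component) auto
  have bX: "k \<in> K \<Longrightarrow> l \<in> K \<Longrightarrow> bounded_measurable \<Omega> (X k l)" for k l
    unfolding X_def diff_conv_add_uminus by (intro bounded_measurable_intros bm_component) auto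
  have bY: "k \<in> K \<Longrightarrow> l \<in> K \<Longrightarrow> bounded_measurable \<Omega> (Y k l)" for k l
    unfolding Y_def by (intro bounded_measurable_intros bm_component) auto
  let ?M = "\<lambda>u. (3/2 * (\<Sum>k\<in>K. \<bar>L k u\<bar>) + 1/2 * (\<Sum>k\<in>K. \<Sum>l\<in>K. C\<^sup>2 * (\<bar>X k l u\<bar> + \<bar>Y k l u\<bar>))) / n"
  have "S.expectation (\<lambda>u. \<bar>(\<Sum>i<n. v i u) - \<sigma>2\<bar>) \<le> S.expectation ?M"
  proof (rule integral_mono)
    show "integrable \<Omega> (\<lambda>u. \<bar>(\<Sum>i<n. v i u) - \<sigma>2\<bar>)"
      unfolding diff_conv_add_uminus by (intro int bounded_measurable_intros bm_v)
    show "integrable \<Omega> ?M"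
      by (intro int bounded_measurable_intros bL bX bY)
    fix u
    have "\<bar>3/2 * (\<Sum>k\<in>K. L k u) + 1/2 * (\<Sum>k\<in>K. \<Sum>l\<in>K. c k l * (X k l u + Y k l u))\<bar>
        \<le> 3/2 * (\<Sum>k\<in>K. \<bar>L k u\<bar>) + 1/2 * (\<Sum>k\<in>K. \<Sum>l\<in>K. C\<^sup>2 * (\<bar>X k l u\<bar> + \<bar>Y k l u\<bar>))"
    proof -
      have "\<bar>\<Sum>k\<in>K. L k u\<bar> \<le> (\<Sum>k\<in>K. \<bar>L k u\<bar>)" by (rule sum_abs)
      moreover have "\<bar>\<Sum>k\<in>K. \<Sum>l\<in>K. c k l * (X k l u + Y k l u)\<bar> \<le> (\<Sum>k\<in>K. \<Sum>l\<in>K. C\<^sup>2 * (\<bar>X k l u\<bar> + \<bar>Y k l u\<bar>))"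
        by (rule order_trans[OF sum_abs], intro sum_mono, rule order_trans[OF sum_abs], intro sum_mono,
            unfold abs_mult, intro mult_mono cb abs_triangle_ineq) auto
      ultimately show ?thesis by linarith
    qed
    then show "\<bar>(\<Sum>i<n. v i u) - \<sigma>2\<bar> \<le> ?M u" unfolding dev by (simp add: divide_right_mono)
  qed
  also have "S.expectation ?M = (3/2 * (\<Sum>k\<in>K. S.expectation (\<lambda>u. \<bar>L k u\<bar>))
      + 1/2 * (\<Sum>k\<in>K. \<Sum>l\<in>K. C\<^sup>2 * (S.expectation (\<lambda>u. \<bar>X k l u\<bar>) + S.expectation (\<lambda>u. \<bar>Y k l u\<bar>)))) / n"
  proof -
    have i1: "k \<in> K \<Longrightarrow> integrable \<Omega> (\<lambda>u. \<bar>L k u\<bar>)" for k by (intro int bounded_measurable_intros bL)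
    have i2: "k \<in> K \<Longrightarrow> l \<in> K \<Longrightarrow> integrable \<Omega> (\<lambda>u. \<bar>X k l u\<bar>)" for k l by (intro int bounded_measurable_intros bX)
    have i3: "k \<in> K \<Longrightarrow> l \<in> K \<Longrightarrow> integrable \<Omega> (\<lambda>u. \<bar>Y k l u\<bar>)" for k l by (intro int bounded_measurable_intros bY)
    show ?thesis using i1 i2 i3
      by (subst integral_divide_zero integral_mult_right_zero integral_add integral_sum
          | simp add: integrable_sum integrable_mult_right integrable_add)+
  qed
  also have "\<dots> \<le> (3/2 * (\<Sum>k\<in>K. C^3 * \<beta> * sqrt n)
      + 1/2 * (\<Sum>k\<in>K. \<Sum>l\<in>K. C\<^sup>2 * (C\<^sup>2 * \<beta>\<^sup>2 * sqrt n + 2 * (C\<^sup>2 * \<beta>\<^sup>2 * sqrt n)))) / n"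
    using EL EX EY by (intro divide_right_mono add_mono mult_left_mono sum_mono) auto
  also have "\<dots> = fluctuation_bound * (sqrt n / n)"
    unfolding fluctuation_bound_def by (simp add: field_simps power4_eq_xxxx power2_eq_square)
  also have "sqrt n / n = 1 / sqrt n" using n by (simp add: real_div_sqrt field_simps)
  finally show ?thesis by simp
qed

end

section \<open>Integrating the approximate Gaussian differential equation\<close>

lemma has_vector_derivative_char_bounded:
  assumes M: "prob_space M" and f: "bounded_measurable M f"
  shows "((\<lambda>s. \<integral>x. iexp (s * f x) \<partial>M) has_vector_derivative
           \<i> * (\<integral>x. complex_of_real (f x) * iexp (s * f x) \<partial>M)) (at s)"
proof -
  interpret prob_space M by (rule M)
  obtain c where c: "\<And>x. \<bar>f x\<bar> \<le> c" and fm: "f \<in> borel_measurable M"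
    using f by (auto simp: bounded_measurable_def)
  note int = bounded_measurable_integrable[OF M]
  have bme: "bounded_measurable M (\<lambda>x. iexp (s * f x))" for s
    by (intro bounded_measurable_iexp) (use fm in auto)
  have ie: "integrable M (\<lambda>x. iexp (s * f x))" for s by (intro int bme)
  have ife: "integrable M (\<lambda>x. complex_of_real (f x) * iexp (s * f x))" for s
    by (intro int bounded_measurable_intros f bme)
  let ?F = "\<lambda>s. \<integral>x. iexp (s * f x) \<partial>M" and ?F' = "\<i> * (\<integral>x. complex_of_real (f x) * iexp (s * f x) \<partial>M)"
  have bound: "norm (?F y - ?F s - (y - s) *\<^sub>R ?F') \<le> (y - s)\<^sup>2 * c\<^sup>2" for y
  proof -
    let ?d = "\<lambda>x. iexp (s * f x) * (iexp ((y - s) * f x) - 1 - \<i> * complex_of_real ((y - s) * f x))"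
    have d: "?d x = iexp (y * f x) - iexp (s * f x) - (\<i> * (y - s)) * (complex_of_real (f x) * iexp (s * f x))" for x
    proof -
      have "iexp (y * f x) = iexp (s * f x) * iexp ((y - s) * f x)"
        by (simp add: exp_add[symmetric] algebra_simps)
      then show ?thesis by (simp add: algebra_simps)
    qed
    have "?F y - ?F s - (y - s) *\<^sub>R ?F' = (\<integral>x. ?d x \<partial>M)"
    proof -
      have "(\<integral>x. ?d x \<partial>M) = ?F y - ?F s - (\<i> * (y - s)) * (\<integral>x. complex_of_real (f x) * iexp (s * f x) \<partial>M)"
        unfolding d by (simp only: Bochner_Integration.integral_diff Bochner_Integration.integrable_diff
            integrable_mult_right integral_mult_right_zero ie ife)
      then show ?thesis by (simp add: scaleR_conv_of_real)
    qed
    also have "norm \<dots> \<le> (\<integral>x. (y - s)\<^sup>2 * c\<^sup>2 \<partial>M)"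
    proof (rule order_trans[OF integral_norm_bound], rule integral_mono)
      show "integrable M (\<lambda>x. norm (?d x))" unfolding d using ie ife by simp
      fix x
      have "(f x)\<^sup>2 \<le> c\<^sup>2" using power_mono[OF c abs_ge_zero, where n = 2] by simp
      then have "((y - s) * f x)\<^sup>2 \<le> (y - s)\<^sup>2 * c\<^sup>2"
        unfolding power_mult_distrib by (intro mult_left_mono) auto
      moreover have "0 \<le> ((y - s) * f x)\<^sup>2" by simp
      ultimately have "norm (iexp ((y - s) * f x) - 1 - \<i> * complex_of_real ((y - s) * f x)) \<le> (y - s)\<^sup>2 * c\<^sup>2"
        using norm_iexp_second_order_le[of "(y - s) * f x"] by linarith
      then show "norm (?d x) \<le> (y - s)\<^sup>2 * c\<^sup>2" by (simp add: norm_mult)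
    qed simp
    also have "\<dots> = (y - s)\<^sup>2 * c\<^sup>2" by (simp add: prob_space)
    finally show ?thesis .
  qed
  show ?thesis
    unfolding has_vector_derivative_def has_derivative_iff_norm
  proof (intro conjI bounded_linear_scaleR_left)
    show "((\<lambda>y. norm (?F y - ?F s - (y - s) *\<^sub>R ?F') / norm (y - s)) \<longlongrightarrow> 0) (at s)"
    proof (rule Lim_null_comparison)
      have "norm (norm (?F y - ?F s - (y - s) *\<^sub>R ?F') / norm (y - s)) \<le> \<bar>y - s\<bar> * c\<^sup>2" if "y \<noteq> s" for y
      proof -
        have "(y - s)\<^sup>2 = \<bar>y - s\<bar> * \<bar>y - s\<bar>" by (simp add: power2_eq_square)
        then have "norm (?F y - ?F s - (y - s) *\<^sub>R ?F') \<le> (\<bar>y - s\<bar> * c\<^sup>2) * \<bar>y - s\<bar>"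
          using bound[of y] by (simp only: mult_ac)
        then show ?thesis using that by (simp add: pos_divide_le_eq)
      qed
      then show "\<forall>\<^sub>F y in at s. norm (norm (?F y - ?F s - (y - s) *\<^sub>R ?F') / norm (y - s)) \<le> \<bar>y - s\<bar> * c\<^sup>2"
        unfolding eventually_at by (intro exI[of _ 1]) auto
      show "((\<lambda>y. \<bar>y - s\<bar> * c\<^sup>2) \<longlongrightarrow> 0) (at s)"
        by (auto intro!: tendsto_eq_intros)
    qed
  qed
qed

text \<open>An approximate solution of \<open>\<phi>' = - s v \<phi>\<close> is multiplied by the integrating factor
\<open>exp (s\<^sup>2 v / 2)\<close>; the product has small derivative, so it stays close to its value 1 at 0.\<close>

lemma gaussian_ode_estimate:
  fixes \<phi> \<phi>' :: "real \<Rightarrow> complex"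
  assumes der: "\<And>s. (\<phi> has_vector_derivative \<phi>' s) (at s)"
    and le: "\<And>s. 0 \<le> s \<Longrightarrow> s \<le> 1 \<Longrightarrow> norm (\<phi>' s + s * v * \<phi> s) \<le> \<epsilon>"
    and \<phi>0: "\<phi> 0 = 1"
  shows "norm (\<phi> 1 - complex_of_real (exp (- v / 2))) \<le> \<epsilon> * exp \<bar>v\<bar>"
proof -
  let ?\<psi> = "\<lambda>s. \<phi> s * complex_of_real (exp (s\<^sup>2 * v / 2))"
  let ?\<psi>' = "\<lambda>s. \<phi> s * complex_of_real (s * v * exp (s\<^sup>2 * v / 2)) + \<phi>' s * complex_of_real (exp (s\<^sup>2 * v / 2))"
  have \<epsilon>: "0 \<le> \<epsilon>" using order_trans[OF norm_ge_zero le[of 0]] by simp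
  have d: "(?\<psi> has_vector_derivative ?\<psi>' s) (at s within {0..1})" for s
  proof -
    have "((\<lambda>s. exp (s\<^sup>2 * v / 2)) has_real_derivative s * v * exp (s\<^sup>2 * v / 2)) (at s within {0..1})"
      by (auto intro!: derivative_eq_intros)
    then have "((\<lambda>s. complex_of_real (exp (s\<^sup>2 * v / 2))) has_vector_derivative complex_of_real (s * v * exp (s\<^sup>2 * v / 2))) (at s within {0..1})"
      by (rule has_vector_derivative_of_real)
    then show ?thesis by (intro has_vector_derivative_mult has_vector_derivative_at_within[OF der])
  qed
  have "norm (?\<psi> 1 - ?\<psi> 0) \<le> (\<epsilon> * exp (\<bar>v\<bar> / 2)) * norm (1 - 0 :: real)"
  proof (rule differentiable_bound[where S = "{0..1::real}"])
    fix s :: real assume s: "s \<in> {0..1}"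
    show "(?\<psi> has_derivative (\<lambda>h. h *\<^sub>R ?\<psi>' s)) (at s within {0..1})"
      using d[of s] by (simp add: has_vector_derivative_def)
    have "?\<psi>' s = (\<phi>' s + s * v * \<phi> s) * complex_of_real (exp (s\<^sup>2 * v / 2))"
      by (simp add: algebra_simps)
    then have "norm (?\<psi>' s) = norm (\<phi>' s + s * v * \<phi> s) * exp (s\<^sup>2 * v / 2)" by (simp add: norm_mult)
    also have "\<dots> \<le> \<epsilon> * exp (\<bar>v\<bar> / 2)"
    proof (intro mult_mono)
      show "norm (\<phi>' s + s * v * \<phi> s) \<le> \<epsilon>" using le[of s] s by simp
      have "s\<^sup>2 * v \<le> s\<^sup>2 * \<bar>v\<bar>" by (intro mult_left_mono) auto
      also have "\<dots> \<le> \<bar>v\<bar>" using s by (intro mult_left_le_one_le) (auto simp: power_le_one)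
      finally show "exp (s\<^sup>2 * v / 2) \<le> exp (\<bar>v\<bar> / 2)" by simp
    qed (use s \<epsilon> in auto)
    finally show "onorm (\<lambda>h. h *\<^sub>R ?\<psi>' s) \<le> \<epsilon> * exp (\<bar>v\<bar> / 2)"
      by (simp add: onorm_scaleR_left onorm_id)
  qed auto
  then have "norm (\<phi> 1 * complex_of_real (exp (v / 2)) - 1) \<le> \<epsilon> * exp (\<bar>v\<bar> / 2)" using \<phi>0 by simp
  moreover have "\<phi> 1 - exp (- v / 2) = (\<phi> 1 * complex_of_real (exp (v / 2)) - 1) * complex_of_real (exp (- v / 2))"
    by (simp add: left_diff_distrib mult.assoc of_real_mult[symmetric] exp_add[symmetric] del: of_real_mult)
  ultimately have "norm (\<phi> 1 - exp (- v / 2)) \<le> \<epsilon> * exp (\<bar>v\<bar> / 2) * exp (- v / 2)"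
    by (simp add: norm_mult mult_right_mono)
  also have "\<dots> \<le> \<epsilon> * exp (\<bar>v\<bar> / 2) * exp (\<bar>v\<bar> / 2)"
    using \<epsilon> by (intro mult_left_mono) auto
  also have "\<dots> = \<epsilon> * exp \<bar>v\<bar>" by (simp add: mult.assoc exp_add[symmetric])
  finally show ?thesis .
qed

context bounded_kernel
begin

definition variance_bound where "variance_bound = C\<^sup>2 + 1/2 * (\<beta>\<^sup>2 * (card K * card K * C^4))"

lemma \<sigma>2_bound: "\<bar>\<sigma>2\<bar> \<le> variance_bound"
proof -
  have "\<bar>P.expectation (\<lambda>x. (g i x)\<^sup>2)\<bar> \<le> C\<^sup>2" if "i < n" for i
    using expectation_product_le[OF bm_features(3)[OF that] bm_features(3)[OF that] g_bound[OF that] g_bound[OF that]]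
    by (simp add: power2_eq_square)
  then have 1: "\<bar>\<Sum>i<n. P.expectation (\<lambda>x. (g i x)\<^sup>2)\<bar> \<le> (\<Sum>i<n. C\<^sup>2)"
    by (intro order_trans[OF sum_abs] sum_mono) auto
  have "\<bar>\<Sum>k\<in>K. \<Sum>l\<in>K. P.expectation (\<lambda>x. p k x * p l x) * P.expectation (\<lambda>x. q k x * q l x)\<bar> \<le> (\<Sum>k\<in>K. \<Sum>l\<in>K. C\<^sup>2 * C\<^sup>2)"
    by (rule order_trans[OF sum_abs], intro sum_mono, rule order_trans[OF sum_abs], intro sum_mono,
        unfold abs_mult, intro mult_mono expectation_product_le bm_features p_bound q_bound) auto
  then have 2: "\<bar>\<Sum>k\<in>K. \<Sum>l\<in>K. P.expectation (\<lambda>x. p k x * p l x) * P.expectation (\<lambda>x. q k x * q l x)\<bar> \<le> card K * card K * C^4"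
    by (simp add: power4_eq_xxxx power2_eq_square mult_ac)
  have 3: "\<bar>\<Sum>i<n. \<Sum>j<n. (b i j)\<^sup>2\<bar> \<le> real n * \<beta>\<^sup>2"
    using op_bounded_frobenius[OF b] by (simp add: sum_nonneg)
  have "\<bar>(\<Sum>i<n. \<Sum>j<n. (b i j)\<^sup>2) * (\<Sum>k\<in>K. \<Sum>l\<in>K. P.expectation (\<lambda>x. p k x * p l x) * P.expectation (\<lambda>x. q k x * q l x))\<bar>
      \<le> (real n * \<beta>\<^sup>2) * (card K * card K * C^4)"
    unfolding abs_mult by (intro mult_mono 2 3) auto
  then have "\<bar>(\<Sum>i<n. P.expectation (\<lambda>x. (g i x)\<^sup>2)) + 1/2 * ((\<Sum>i<n. \<Sum>j<n. (b i j)\<^sup>2) *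
   (\<Sum>k\<in>K. \<Sum>l\<in>K. P.expectation (\<lambda>x. p k x * p l x) * P.expectation (\<lambda>x. q k x * q l x)))\<bar> \<le> n * variance_bound"
    using 1 unfolding variance_bound_def by (simp add: algebra_simps)
  from divide_right_mono[OF this, of "real n"] show ?thesis unfolding \<sigma>2_def using n by simp
qed

lemma W_eq: "W u = (1/2 * (\<Sum>i<n. \<Sum>j<n. b i j * (\<Sum>k\<in>K. p k (u i) * q k (u j))) + (\<Sum>i<n. g i (u i))) / sqrt n"
proof -
  have "H i u = (\<Sum>j<n. b i j * (\<Sum>k\<in>K. p k (u i) * q k (u j)))" for i
    unfolding H_def S_def by (simp add: sum_distrib_left sum.swap[of _ K] mult_ac)
  then show ?thesis unfolding W_def V_def
    by (simp add: sum.distrib sum_divide_distrib add_divide_distrib)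
qed

text \<open>The derivative of the characteristic function at \<open>s\<close> is \<open>\<i>\<close> times the expectation of
\<open>W * exp (\<i> s W)\<close>, hence up to small errors \<open>- s\<close> times the expectation of
\<open>(\<Sum>i. v i) * exp (\<i> s W)\<close>, in which the sum may be replaced by \<open>\<sigma>2\<close>. The error depends on the
matrix and the observations only through \<open>card K\<close>, \<open>C\<close> and \<open>\<beta>\<close>.\<close>

theorem char_bounded_kernel:
  "norm (S.expectation (\<lambda>u. iexp (W u)) - complex_of_real (exp (- \<sigma>2 / 2))) \<le> (2 * C^3 * growth_bound + fluctuation_bound) * exp variance_bound / sqrt n"
proof -
  let ?\<phi> = "\<lambda>s. S.expectation (\<lambda>u. iexp (s * W u))"
  let ?d = "\<lambda>s. \<i> * S.expectation (\<lambda>u. complex_of_real (W u) * iexp (s * W u))"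
  note int = bounded_measurable_integrable[OF S.prob_space_axioms]
  have "norm (?d s + complex_of_real s * complex_of_real \<sigma>2 * ?\<phi> s) \<le> (2 * C^3 * growth_bound + fluctuation_bound) / sqrt n" if s: "0 \<le> s" "s \<le> 1" for s
  proof -
    let ?v = "\<lambda>u. \<Sum>i<n. v i u"
    have bm_v': "bounded_measurable \<Omega> ?v" by (intro bounded_measurable_intros bm_v)
    have i1: "integrable \<Omega> (\<lambda>u. iexp (s * W u))" by (intro int bm_iexp bm_W)
    have i2: "integrable \<Omega> (\<lambda>u. complex_of_real (?v u) * iexp (s * W u))"
      by (intro int bounded_measurable_mult bounded_measurable_of_real bm_v' bm_iexp bm_W)
    let ?X = "S.expectation (\<lambda>u. complex_of_real (W u) * iexp (s * W u))"
    let ?Y = "S.expectation (\<lambda>u. complex_of_real (?v u) * iexp (s * W u))"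
    define Z where "Z u = complex_of_real (?v u - \<sigma>2) * iexp (s * W u)" for u
    have Z: "S.expectation Z = ?Y - complex_of_real \<sigma>2 * ?\<phi> s"
      unfolding Z_def of_real_diff left_diff_distrib
      by (simp only: Bochner_Integration.integral_diff integrable_mult_right integral_mult_right_zero i1 i2)
    have nZ: "norm (Z u) = \<bar>?v u - \<sigma>2\<bar>" for u
      unfolding Z_def norm_mult norm_of_real norm_exp_i_times by simp
    have Y: "norm (?Y - complex_of_real \<sigma>2 * ?\<phi> s) \<le> fluctuation_bound / sqrt n"
      using integral_norm_bound[of \<Omega> Z] conditional_variance_concentrates unfolding nZ Z by (rule order_trans)
    define A B where "A = ?X - \<i> * s * ?Y" and "B = ?Y - complex_of_real \<sigma>2 * ?\<phi> s"
    have "?d s + complex_of_real s * complex_of_real \<sigma>2 * ?\<phi> s = \<i> * (A + \<i> * s * B)"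
      unfolding A_def B_def by (simp add: algebra_simps)
    then have "norm (?d s + complex_of_real s * complex_of_real \<sigma>2 * ?\<phi> s) = norm (A + \<i> * s * B)" by (simp add: norm_mult)
    also have "\<dots> \<le> norm A + norm (\<i> * s * B)" by (rule norm_triangle_ineq)
    also have "norm (\<i> * s * B) = \<bar>s\<bar> * norm B" by (simp add: norm_mult)
    also have "\<dots> \<le> 1 * (fluctuation_bound / sqrt n)" using s Y unfolding B_def by (intro mult_mono) auto
    finally show ?thesis using sum_leave_one_out[of s] s unfolding A_def by (simp add: add_divide_distrib)
  qed
  note est = this
  have "?\<phi> 0 = 1" by (simp add: S.prob_space)
  from gaussian_ode_estimate[where \<phi> = ?\<phi> and \<phi>' = ?d,
      OF has_vector_derivative_char_bounded[OF S.prob_space_axioms bm_W] est this]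
  have 1: "norm (S.expectation (\<lambda>u. iexp (W u)) - complex_of_real (exp (- \<sigma>2 / 2)))
      \<le> (2 * C^3 * growth_bound + fluctuation_bound) / sqrt n * exp \<bar>\<sigma>2\<bar>"
    unfolding mult_1 .
  have "0 \<le> growth_bound" unfolding growth_bound_def using C by simp
  moreover have "0 \<le> fluctuation_bound" unfolding fluctuation_bound_def using C op_boundedD(1)[OF b] by simp
  ultimately have "0 \<le> (2 * C^3 * growth_bound + fluctuation_bound) / sqrt n" using C by simp
  moreover have "exp \<bar>\<sigma>2\<bar> \<le> exp variance_bound" using \<sigma>2_bound by simp
  ultimately have "(2 * C^3 * growth_bound + fluctuation_bound) / sqrt n * exp \<bar>\<sigma>2\<bar> \<le> (2 * C^3 * growth_bound + fluctuation_bound) / sqrt n * exp variance_bound"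
    by (intro mult_left_mono)
  with 1 show ?thesis by simp
qed

end

section \<open>Quadratic statistics with square integrable entries\<close>

definition moment :: "'e measure \<Rightarrow> ('e \<Rightarrow> real) \<Rightarrow> ('e \<Rightarrow> real) \<Rightarrow> real" where
  "moment P f g = (\<integral>x. f x * g x \<partial>P)"

definition kernel_variance :: "'e measure \<Rightarrow> 'l set \<Rightarrow> ('l \<Rightarrow> 'e \<Rightarrow> real) \<Rightarrow> ('l \<Rightarrow> 'e \<Rightarrow> real) \<Rightarrow> real" where
  "kernel_variance P L f h = (\<Sum>l\<in>L. \<Sum>m\<in>L. moment P (f l) (f m) * moment P (h l) (h m)
      + moment P (f l) (h m) * moment P (h l) (f m))"

text \<open>The linearized statistic: off-diagonal quadratic forms, the diagonal weighted by \<open>\<zeta>\<close> (in the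
application the centred products \<open>x y\<close>), and the first order effect \<open>\<eta>\<close> of the normalization,
which enters through the mean of the diagonal.\<close>

definition quad_stat :: "nat \<Rightarrow> (nat \<Rightarrow> nat \<Rightarrow> real) \<Rightarrow> 'l set \<Rightarrow> ('l \<Rightarrow> 'e \<Rightarrow> real) \<Rightarrow> ('l \<Rightarrow> 'e \<Rightarrow> real)
    \<Rightarrow> ('e \<Rightarrow> real) \<Rightarrow> ('e \<Rightarrow> real) \<Rightarrow> (nat \<Rightarrow> 'e) \<Rightarrow> real" where
  "quad_stat n b L f h \<zeta> \<eta> u =
     ((\<Sum>l\<in>L. \<Sum>i<n. \<Sum>j<n. off_diagonal b i j * (f l (u i) * h l (u j)))
       + ((\<Sum>i<n. b i i * \<zeta> (u i)) - (\<Sum>i<n. tr n b / n * \<eta> (u i)))) / sqrt n"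

text \<open>The variance of \<open>quad_stat\<close>. The coefficient \<open>r\<close> will be \<open>E \<eta>\<^sup>2 - 2 E \<zeta>\<eta>\<close>: with
\<open>m = tr n b / n\<close>, expanding \<open>\<Sum>i. E (b i i \<zeta> - m \<eta>)\<^sup>2\<close> gives the cross term \<open>- 2 m (tr n b) E \<zeta>\<eta>\<close>,
and \<open>tr n b = n m\<close>.\<close>

definition quad_var :: "nat \<Rightarrow> (nat \<Rightarrow> nat \<Rightarrow> real) \<Rightarrow> real \<Rightarrow> real \<Rightarrow> real \<Rightarrow> real" where
  "quad_var n b J s r = (\<Sum>i<n. \<Sum>j<n. (off_diagonal b i j)\<^sup>2) / n * J + (\<Sum>i<n. (b i i)\<^sup>2) / n * s + (tr n b / n)\<^sup>2 * r"

lemma mean_diagonal_le: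
  assumes b: "op_bounded n \<beta> b"
  shows "\<bar>tr n b / n\<bar> \<le> \<beta>"
proof (cases "n = 0")
  case False
  have "\<bar>tr n b\<bar> \<le> (\<Sum>i<n. \<beta>)"
    unfolding tr_def by (rule order_trans[OF sum_abs], rule sum_mono) (simp add: op_bounded_entry[OF b])
  with False show ?thesis by (simp add: divide_le_eq mult.commute)
qed (use op_boundedD(1)[OF b] in simp)

lemma diagonal_mean_square_le:
  assumes b: "op_bounded n \<beta> b"
  shows "(\<Sum>i<n. (b i i)\<^sup>2) \<le> n * \<beta>\<^sup>2"
proof -
  have "(b i i)\<^sup>2 \<le> \<beta>\<^sup>2" if "i < n" for i
    using power_mono[OF op_bounded_entry[OF b that that] abs_ge_zero, of 2] by simp
  then have "(\<Sum>i<n. (b i i)\<^sup>2) \<le> (\<Sum>i<n. \<beta>\<^sup>2)" by (intro sum_mono) auto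
  then show ?thesis by simp
qed

lemma off_diagonal_frobenius:
  assumes b: "op_bounded n \<beta> b"
  shows "(\<Sum>i<n. \<Sum>j<n. (off_diagonal b i j)\<^sup>2) \<le> n * \<beta>\<^sup>2"
proof -
  have "(\<Sum>i<n. \<Sum>j<n. (off_diagonal b i j)\<^sup>2) \<le> (\<Sum>i<n. \<Sum>j<n. (b i j)\<^sup>2)"
    by (intro sum_mono) (simp add: off_diagonal_def)
  with op_bounded_frobenius[OF b] show ?thesis by linarith
qed

lemma le_n_imp_div_le: "x \<le> real n * y \<Longrightarrow> 0 \<le> y \<Longrightarrow> x / n \<le> y"
  by (cases "n = 0") (simp_all add: divide_le_eq mult.commute)

lemma quad_var_linear_bound:
  assumes b: "op_bounded n \<beta> b"
  shows "\<bar>quad_var n b J s r\<bar> \<le> \<beta>\<^sup>2 * (\<bar>J\<bar> + \<bar>s\<bar> + \<bar>r\<bar>)"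
proof -
  have 1: "\<bar>(\<Sum>i<n. \<Sum>j<n. (off_diagonal b i j)\<^sup>2) / n * J\<bar> \<le> \<beta>\<^sup>2 * \<bar>J\<bar>"
    unfolding abs_mult using le_n_imp_div_le[OF off_diagonal_frobenius[OF b]] by (intro mult_right_mono) (auto simp: sum_nonneg)
  have 2: "\<bar>(\<Sum>i<n. (b i i)\<^sup>2) / n * s\<bar> \<le> \<beta>\<^sup>2 * \<bar>s\<bar>"
    unfolding abs_mult using le_n_imp_div_le[OF diagonal_mean_square_le[OF b]] by (intro mult_right_mono) (auto simp: sum_nonneg)
  have "(tr n b / n)\<^sup>2 \<le> \<beta>\<^sup>2"
    using power_mono[OF mean_diagonal_le[OF b] abs_ge_zero, of 2] unfolding power2_abs .
  then have 3: "\<bar>(tr n b / n)\<^sup>2 * r\<bar> \<le> \<beta>\<^sup>2 * \<bar>r\<bar>"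
    unfolding abs_mult abs_power2 by (intro mult_right_mono) auto
  show ?thesis unfolding quad_var_def distrib_left using 1 2 3 by linarith
qed

lemma quad_var_diff: "quad_var n b J s r - quad_var n b J' s' r' = quad_var n b (J - J') (s - s') (r - r')"
  unfolding quad_var_def by (simp add: right_diff_distrib)

lemma exp_lipschitz: "\<bar>exp x - exp y\<bar> \<le> exp M * \<bar>x - y\<bar>" if "x \<le> M" "y \<le> M" for x y M :: real
proof -
  have *: "exp x - exp y \<le> exp M * \<bar>x - y\<bar>" if "x \<le> M" for x y :: real
  proof -
    have "exp y = exp x * exp (y - x)" by (simp add: exp_add[symmetric])
    also have "\<dots> \<ge> exp x * (1 + (y - x))" by (intro mult_left_mono exp_ge_add_one_self) auto
    finally have "exp x - exp y \<le> exp x * (x - y)" by (simp add: algebra_simps)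
    also have "\<dots> \<le> exp x * \<bar>x - y\<bar>" by (intro mult_left_mono) auto
    also have "\<dots> \<le> exp M * \<bar>x - y\<bar>" using that by (intro mult_right_mono) auto
    finally show ?thesis .
  qed
  show ?thesis using *[OF that(1), of y] *[OF that(2), of x] by (simp add: abs_le_iff abs_minus_commute)
qed

text \<open>The kernel \<open>\<Sum>l. f l x * h l y\<close> need not be symmetric. It is symmetrized by adding its transpose,
which doubles the index set to \<open>L \<times> bool\<close> and leaves the form unchanged because it carries the
factor 1/2 and \<open>b\<close> is symmetric. The constant \<open>Const\<close> involves neither \<open>n\<close> nor \<open>b\<close>, whence
uniformity in \<open>b\<close>.\<close>

lemma char_quad_stat_bounded:
  assumes P: "prob_space P" and L: "finite L" and \<beta>: "0 \<le> \<beta>" and c: "0 \<le> c" and e: "0 < (\<epsilon>::real)"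
    and f: "\<And>l. l \<in> L \<Longrightarrow> f l \<in> borel_measurable P" "\<And>l x. l \<in> L \<Longrightarrow> \<bar>f l x\<bar> \<le> c" "\<And>l. l \<in> L \<Longrightarrow> integral\<^sup>L P (f l) = 0"
    and h: "\<And>l. l \<in> L \<Longrightarrow> h l \<in> borel_measurable P" "\<And>l x. l \<in> L \<Longrightarrow> \<bar>h l x\<bar> \<le> c" "\<And>l. l \<in> L \<Longrightarrow> integral\<^sup>L P (h l) = 0"
    and \<zeta>: "\<zeta> \<in> borel_measurable P" "\<And>x. \<bar>\<zeta> x\<bar> \<le> c" "integral\<^sup>L P \<zeta> = 0"
    and \<eta>: "\<eta> \<in> borel_measurable P" "\<And>x. \<bar>\<eta> x\<bar> \<le> c" "integral\<^sup>L P \<eta> = 0"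
  shows "\<forall>\<^sub>F n in sequentially. \<forall>b. op_bounded n \<beta> b \<longrightarrow>
     norm ((\<integral>u. iexp (quad_stat n b L f h \<zeta> \<eta> u) \<partial>samples P n)
       - complex_of_real (exp (- quad_var n b (kernel_variance P L f h) (moment P \<zeta> \<zeta>) (moment P \<eta> \<eta> - 2 * moment P \<zeta> \<eta>) / 2))) < \<epsilon>"
proof -
  interpret P: prob_space P by (rule P)
  let ?K = "L \<times> (UNIV :: bool set)"
  define p q where "p k = (if snd k then f (fst k) else h (fst k))" and "q k = (if snd k then h (fst k) else f (fst k))" for k :: "'b \<times> bool"
  \<comment> \<open>bounds f and h by c, and the diagonal weights b i i * \<zeta> - tr n b / n * \<eta> by 2 \<beta> c\<close>
  define C where "C = 1 + c + 2 * (\<beta> * c)"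
  define Const where "Const = (2 * C ^ 3 * bounded_kernel.growth_bound ?K C (2 * \<beta>) + bounded_kernel.fluctuation_bound ?K C (2 * \<beta>)) * exp (bounded_kernel.variance_bound ?K C (2 * \<beta>))"
  have K: "finite ?K" using L by simp
  have cC: "c \<le> C" "2 * (\<beta> * c) \<le> C" "1 \<le> C" using \<beta> c by (auto simp: C_def)
  have sumK: "(\<Sum>k\<in>?K. F k) = (\<Sum>l\<in>L. F (l, True) + F (l, False))" for F :: "'b \<times> bool \<Rightarrow> real"
  proof -
    have "(\<Sum>k\<in>?K. F k) = (\<Sum>l\<in>L. \<Sum>s\<in>UNIV. F (l, s))" by (simp add: sum.cartesian_product)
    then show ?thesis by (simp add: UNIV_bool add.commute)
  qed
  have key: "norm ((\<integral>u. iexp (quad_stat n b L f h \<zeta> \<eta> u) \<partial>samples P n)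
       - complex_of_real (exp (- quad_var n b (kernel_variance P L f h) (moment P \<zeta> \<zeta>) (moment P \<eta> \<eta> - 2 * moment P \<zeta> \<eta>) / 2))) \<le> Const / sqrt n"
    if n: "0 < n" and b: "op_bounded n \<beta> b" for n b
  proof -
    define g where "g i x = b i i * \<zeta> x - tr n b / n * \<eta> x" for i x
    have i\<zeta>: "integrable P \<zeta>" "integrable P \<eta>"
      using \<zeta> \<eta> by (auto intro!: P.integrable_const_bound[where B = c])
    have gb: "\<bar>g i x\<bar> \<le> C" if "i < n" for i x
    proof -
      have "\<bar>b i i * \<zeta> x\<bar> \<le> \<beta> * c" unfolding abs_mult
        using op_bounded_entry[OF b that that] \<zeta>(2) \<beta> by (intro mult_mono) auto
      moreover have "\<bar>tr n b / n * \<eta> x\<bar> \<le> \<beta> * c" unfolding abs_mult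
        using mean_diagonal_le[OF b] \<eta>(2) \<beta> by (intro mult_mono) auto
      ultimately show ?thesis unfolding g_def using cC(2) by linarith
    qed
    interpret bk: bounded_kernel P ?K p q C "2 * \<beta>" n "off_diagonal b" g
    proof
      show "finite ?K" "1 \<le> C" "0 < n" by (rule K cC n)+
      fix k :: "'b \<times> bool" assume "k \<in> ?K"
      then have k: "fst k \<in> L" by auto
      show "p k \<in> borel_measurable P" "q k \<in> borel_measurable P" "integral\<^sup>L P (p k) = 0" "integral\<^sup>L P (q k) = 0"
        using f(1,3)[OF k] h(1,3)[OF k] by (auto simp: p_def q_def)
      show "\<bar>p k x\<bar> \<le> C" "\<bar>q k x\<bar> \<le> C" for x
        using f(2)[OF k, of x] h(2)[OF k, of x] cC(1) by (auto simp: p_def q_def)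
    next
      fix i assume "i < n"
      then show "g i \<in> borel_measurable P" "\<bar>g i x\<bar> \<le> C" "integral\<^sup>L P (g i) = 0" for x
        using gb \<zeta> \<eta> i\<zeta> by (auto simp: g_def[abs_def])
    next
      show "(\<Sum>k\<in>?K. p k x * q k y) = (\<Sum>k\<in>?K. p k y * q k x)" for x y
        unfolding sumK by (simp add: p_def q_def algebra_simps)
      show "op_bounded n (2 * \<beta>) (off_diagonal b)" by (rule op_bounded_off_diagonal[OF b])
      show "off_diagonal b i i = 0" for i by (simp add: off_diagonal_def)
    qed
    have sym: "off_diagonal b i j = off_diagonal b j i" if "i < n" "j < n" for i j
      using op_boundedD(2)[OF op_bounded_off_diagonal[OF b] that] .
    have W: "bk.W u = quad_stat n b L f h \<zeta> \<eta> u" for u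
    proof -
      let ?s = "\<Sum>i<n. \<Sum>j<n. \<Sum>l\<in>L. off_diagonal b i j * (f l (u i) * h l (u j))"
      have "(\<Sum>i<n. \<Sum>j<n. off_diagonal b i j * (\<Sum>k\<in>?K. p k (u i) * q k (u j)))
          = ?s + (\<Sum>i<n. \<Sum>j<n. \<Sum>l\<in>L. off_diagonal b i j * (f l (u j) * h l (u i)))"
        unfolding sumK by (simp add: p_def q_def sum.distrib distrib_left sum_distrib_left mult_ac)
      also have "(\<Sum>i<n. \<Sum>j<n. \<Sum>l\<in>L. off_diagonal b i j * (f l (u j) * h l (u i))) = ?s"
        by (subst sum.swap) (intro sum.cong refl, simp add: sym)
      finally have "1/2 * (\<Sum>i<n. \<Sum>j<n. off_diagonal b i j * (\<Sum>k\<in>?K. p k (u i) * q k (u j))) = ?s" by simp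
      also have "?s = (\<Sum>i<n. \<Sum>l\<in>L. \<Sum>j<n. off_diagonal b i j * (f l (u i) * h l (u j)))"
        by (intro sum.cong refl sum.swap)
      also have "\<dots> = (\<Sum>l\<in>L. \<Sum>i<n. \<Sum>j<n. off_diagonal b i j * (f l (u i) * h l (u j)))"
        by (rule sum.swap)
      finally show ?thesis unfolding bk.W_eq quad_stat_def g_def sum_subtractf by simp
    qed
    have V: "bk.\<sigma>2 = quad_var n b (kernel_variance P L f h) (moment P \<zeta> \<zeta>) (moment P \<eta> \<eta> - 2 * moment P \<zeta> \<eta>)"
    proof -
      define m where "m = tr n b / n"
      have trm: "tr n b = n * m" using n by (simp add: m_def)
      have ii: "integrable P (\<lambda>x. \<zeta> x * \<zeta> x)" "integrable P (\<lambda>x. \<zeta> x * \<eta> x)" "integrable P (\<lambda>x. \<eta> x * \<eta> x)"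
        using \<zeta> \<eta> by (auto intro!: square_integrable_mult square_integrable_bounded[where c = c] P.finite_measure_axioms)
      have "P.expectation (\<lambda>x. (g i x)\<^sup>2) = (b i i)\<^sup>2 * moment P \<zeta> \<zeta> - 2 * m * moment P \<zeta> \<eta> * b i i + m\<^sup>2 * moment P \<eta> \<eta>" for i
      proof -
        have "(g i x)\<^sup>2 = (b i i)\<^sup>2 * (\<zeta> x * \<zeta> x) - 2 * m * b i i * (\<zeta> x * \<eta> x) + m\<^sup>2 * (\<eta> x * \<eta> x)" for x
          unfolding g_def m_def[symmetric] by (simp add: power2_eq_square algebra_simps)
        then show ?thesis using ii by (simp add: moment_def)
      qed
      then have "(\<Sum>i<n. P.expectation (\<lambda>x. (g i x)\<^sup>2)) = (\<Sum>i<n. (b i i)\<^sup>2) * moment P \<zeta> \<zeta> - 2 * m * moment P \<zeta> \<eta> * tr n b + n * (m\<^sup>2 * moment P \<eta> \<eta>)"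
        by (simp add: sum.distrib sum_subtractf sum_distrib_left sum_distrib_right tr_def)
      then have G: "(\<Sum>i<n. P.expectation (\<lambda>x. (g i x)\<^sup>2)) = (\<Sum>i<n. (b i i)\<^sup>2) * moment P \<zeta> \<zeta> + n * (m\<^sup>2 * (moment P \<eta> \<eta> - 2 * moment P \<zeta> \<eta>))"
        unfolding trm by (simp add: right_diff_distrib power2_eq_square mult_ac)
      have KV: "(\<Sum>k\<in>?K. \<Sum>l\<in>?K. P.expectation (\<lambda>x. p k x * p l x) * P.expectation (\<lambda>x. q k x * q l x)) = 2 * kernel_variance P L f h"
        unfolding sumK kernel_variance_def moment_def
        by (simp add: p_def q_def sum.distrib sum_distrib_left algebra_simps)
      show ?thesis unfolding bk.\<sigma>2_def G KV quad_var_def m_def[symmetric] using n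
        by (simp add: add_divide_distrib)
    qed
    show ?thesis using bk.char_bounded_kernel unfolding W V Const_def .
  qed
  have "(\<lambda>n. Const / sqrt (real n)) \<longlonglongrightarrow> 0" by real_asymp
  from order_tendstoD(2)[OF this e] eventually_gt_at_top[of 0] show ?thesis
  proof eventually_elim
    case (elim n)
    then show ?case using key[of n] by fastforce
  qed
qed

text \<open>Truncation at level \<open>k\<close>, recentred so that the mean remains zero.\<close>

definition truncated :: "'e measure \<Rightarrow> nat \<Rightarrow> ('e \<Rightarrow> real) \<Rightarrow> 'e \<Rightarrow> real" where
  "truncated P k f x = (if \<bar>f x\<bar> \<le> k then f x else 0) - (\<integral>x. (if \<bar>f x\<bar> \<le> k then f x else 0) \<partial>P)"

context
  fixes P :: "'e measure" and f :: "'e \<Rightarrow> real"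
  assumes P: "prob_space P" and f: "integrable P f" "integral\<^sup>L P f = 0"
begin

interpretation P: prob_space P by (rule P)

lemma cutoff_integrable: "integrable P (\<lambda>x. if \<bar>f x\<bar> \<le> real k then f x else 0)"
  by (rule Bochner_Integration.integrable_bound[OF f(1)]) (use f(1) in auto)

lemma cutoff_expectation_le:
  shows "\<bar>\<integral>x. (if \<bar>f x\<bar> \<le> real k then f x else 0) \<partial>P\<bar> \<le> k"
    and "\<bar>\<integral>x. (if \<bar>f x\<bar> \<le> real k then f x else 0) \<partial>P\<bar> \<le> (\<integral>x. \<bar>f x\<bar> \<partial>P)"
proof -
  let ?c = "\<lambda>x. if \<bar>f x\<bar> \<le> real k then f x else 0"
  have i: "integrable P ?c" by (rule cutoff_integrable)
  show "\<bar>integral\<^sup>L P ?c\<bar> \<le> k"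
    using P.integral_le_const[OF i, of k] P.integral_ge_const[OF i, of "- real k"] by (auto simp: abs_le_iff)
  have "\<bar>integral\<^sup>L P ?c\<bar> \<le> (\<integral>x. \<bar>?c x\<bar> \<partial>P)" by (rule integral_abs_bound)
  also have "\<dots> \<le> (\<integral>x. \<bar>f x\<bar> \<partial>P)" by (rule integral_mono) (use i f(1) in auto)
  finally show "\<bar>integral\<^sup>L P ?c\<bar> \<le> (\<integral>x. \<bar>f x\<bar> \<partial>P)" .
qed

lemma truncated_measurable: "truncated P k f \<in> borel_measurable P"
  unfolding truncated_def[abs_def] using cutoff_integrable[of k] by auto

lemma truncated_bounded: "\<bar>truncated P k f x\<bar> \<le> 2 * real k"
proof -
  have "\<bar>if \<bar>f x\<bar> \<le> real k then f x else 0\<bar> \<le> real k" by simp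
  then show ?thesis unfolding truncated_def using cutoff_expectation_le(1)[of k] by linarith
qed

lemma truncated_dominated: "\<bar>truncated P k f x\<bar> \<le> \<bar>f x\<bar> + (\<integral>x. \<bar>f x\<bar> \<partial>P)"
proof -
  have "\<bar>if \<bar>f x\<bar> \<le> real k then f x else 0\<bar> \<le> \<bar>f x\<bar>" by simp
  then show ?thesis unfolding truncated_def using cutoff_expectation_le(2)[of k] by linarith
qed

lemma truncated_mean: "integral\<^sup>L P (truncated P k f) = 0"
  unfolding truncated_def[abs_def] using cutoff_integrable[of k] by (simp add: P.prob_space)

lemma truncated_tendsto: "(\<lambda>k. truncated P k f x) \<longlonglongrightarrow> f x"
proof -
  have c: "(\<lambda>k. if \<bar>f x\<bar> \<le> real k then f x else 0) \<longlonglongrightarrow> f x" for x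
  proof (rule tendsto_eventually)
    show "\<forall>\<^sub>F k in sequentially. (if \<bar>f x\<bar> \<le> real k then f x else 0) = f x"
      using eventually_ge_at_top[of "nat \<lceil>\<bar>f x\<bar>\<rceil>"] by eventually_elim (simp add: nat_le_iff ceiling_le_iff)
  qed
  have "(\<lambda>k. \<integral>x. (if \<bar>f x\<bar> \<le> real k then f x else 0) \<partial>P) \<longlonglongrightarrow> integral\<^sup>L P f"
    by (rule integral_dominated_convergence[where w = "\<lambda>x. \<bar>f x\<bar>"]) (use f(1) c cutoff_integrable in auto)
  from tendsto_diff[OF c[of x] this] show ?thesis unfolding truncated_def f(2) by simp
qed

end

lemma square_integrable_abs: "square_integrable M f \<Longrightarrow> square_integrable M (\<lambda>x. \<bar>f x\<bar>)"
  by (auto simp: square_integrable_def)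

lemma square_integrable_const: "prob_space M \<Longrightarrow> square_integrable M (\<lambda>_. c)"
  by (rule square_integrable_bounded[where c = "\<bar>c\<bar>"]) (auto dest: prob_space.axioms(1))

lemma moment_truncated_tendsto:
  assumes P: "prob_space P"
    and f: "square_integrable P f" "integral\<^sup>L P f = 0" and g: "square_integrable P g" "integral\<^sup>L P g = 0"
  shows "(\<lambda>k. moment P (truncated P k f) (truncated P k g)) \<longlonglongrightarrow> moment P f g"
proof -
  interpret P: prob_space P by (rule P)
  note fi = square_integrable_integrable[OF P.finite_measure_axioms f(1)]
  note gi = square_integrable_integrable[OF P.finite_measure_axioms g(1)]
  let ?F = "\<lambda>x. \<bar>f x\<bar> + (\<integral>x. \<bar>f x\<bar> \<partial>P)" and ?G = "\<lambda>x. \<bar>g x\<bar> + (\<integral>x. \<bar>g x\<bar> \<partial>P)"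
  have sF: "square_integrable P ?F" "square_integrable P ?G"
    by (intro square_integrable_add square_integrable_abs square_integrable_const P f(1) g(1))+
  show ?thesis unfolding moment_def
  proof (rule integral_dominated_convergence[where w = "\<lambda>x. ?F x * ?G x"])
    show "integrable P (\<lambda>x. ?F x * ?G x)" by (rule square_integrable_mult[OF sF])
    show "(\<lambda>x. f x * g x) \<in> borel_measurable P" using fi gi by auto
    show "(\<lambda>x. truncated P k f x * truncated P k g x) \<in> borel_measurable P" for k
      using truncated_measurable[OF P fi f(2)] truncated_measurable[OF P gi g(2)] by (intro borel_measurable_times)
    show "AE x in P. (\<lambda>k. truncated P k f x * truncated P k g x) \<longlonglongrightarrow> f x * g x"
      by (intro AE_I2 tendsto_mult truncated_tendsto[OF P fi f(2)] truncated_tendsto[OF P gi g(2)])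
    show "AE x in P. norm (truncated P k f x * truncated P k g x) \<le> ?F x * ?G x" for k
      unfolding real_norm_def abs_mult
      by (intro AE_I2 mult_mono truncated_dominated[OF P fi f(2)] truncated_dominated[OF P gi g(2)]) auto
  qed
qed

lemma truncated_square_integrable:
  assumes P: "prob_space P" and f: "integrable P f" "integral\<^sup>L P f = 0"
  shows "square_integrable P (truncated P k f)"
  by (rule square_integrable_bounded[OF prob_space.axioms(1)[OF P] truncated_measurable[OF P f] truncated_bounded[OF P f]])

definition L2norm :: "'e measure \<Rightarrow> ('e \<Rightarrow> real) \<Rightarrow> real" where
  "L2norm P f = sqrt (\<integral>x. (f x)\<^sup>2 \<partial>P)"

lemma L2norm_power2: "(L2norm P f)\<^sup>2 = (\<integral>x. (f x)\<^sup>2 \<partial>P)"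
  unfolding L2norm_def by (simp add: integral_nonneg_AE)

lemma L2norm_nonneg: "0 \<le> L2norm P f"
  unfolding L2norm_def by (simp add: integral_nonneg_AE)

lemma L2norm_truncated_tendsto:
  assumes P: "prob_space P" and f: "square_integrable P f" "integral\<^sup>L P f = 0"
  shows "(\<lambda>k. L2norm P (truncated P k f)) \<longlonglongrightarrow> L2norm P f"
  using tendsto_real_sqrt[OF moment_truncated_tendsto[OF P f f]] by (simp add: L2norm_def moment_def power2_eq_square)

lemma L2norm_truncation_error_tendsto:
  assumes P: "prob_space P" and f: "square_integrable P f" "integral\<^sup>L P f = 0"
  shows "(\<lambda>k. L2norm P (\<lambda>x. f x - truncated P k f x)) \<longlonglongrightarrow> 0"
proof -
  interpret P: prob_space P by (rule P)
  note fi = square_integrable_integrable[OF P.finite_measure_axioms f(1)]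
  let ?F = "\<lambda>x. 2 * \<bar>f x\<bar> + (\<integral>x. \<bar>f x\<bar> \<partial>P)"
  have sF: "square_integrable P ?F"
    by (intro square_integrable_add square_integrable_cmult square_integrable_abs square_integrable_const P f(1))
  have "(\<lambda>k. \<integral>x. (f x - truncated P k f x)\<^sup>2 \<partial>P) \<longlonglongrightarrow> (\<integral>x. (f x - f x)\<^sup>2 \<partial>P)"
  proof (rule integral_dominated_convergence[where w = "\<lambda>x. (?F x)\<^sup>2"])
    show "integrable P (\<lambda>x. (?F x)\<^sup>2)" by (rule square_integrable_power2[OF sF])
    show "(\<lambda>x. (f x - truncated P k f x)\<^sup>2) \<in> borel_measurable P" for k
      using truncated_measurable[OF P fi f(2)] fi by (intro borel_measurable_power borel_measurable_diff) auto
    show "AE x in P. (\<lambda>k. (f x - truncated P k f x)\<^sup>2) \<longlonglongrightarrow> (f x - f x)\<^sup>2"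
      by (intro AE_I2 tendsto_intros truncated_tendsto[OF P fi f(2)])
    show "AE x in P. norm ((f x - truncated P k f x)\<^sup>2) \<le> (?F x)\<^sup>2" for k
    proof (rule AE_I2)
      fix x
      have "\<bar>f x - truncated P k f x\<bar> \<le> ?F x" using truncated_dominated[OF P fi f(2), of k x] by linarith
      from power_mono[OF this abs_ge_zero, of 2] show "norm ((f x - truncated P k f x)\<^sup>2) \<le> (?F x)\<^sup>2" by simp
    qed
  qed simp
  from tendsto_real_sqrt[OF this] show ?thesis by (simp add: L2norm_def)
qed

text \<open>Second moments alone control \<open>L\<^sup>1\<close> norms of off-diagonal forms; no product of the same observation
with itself occurs. This is what makes truncation possible without fourth moments.\<close>

lemma quadratic_form_L1:
  assumes P: "prob_space P" and b: "op_bounded n \<beta> b"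
    and f: "square_integrable P f" "integral\<^sup>L P f = 0" and g: "square_integrable P g" "integral\<^sup>L P g = 0"
  shows "integrable (samples P n) (\<lambda>u. \<Sum>i<n. \<Sum>j<n. off_diagonal b i j * (f (u i) * g (u j)))" (is "integrable _ ?Q")
    and "(\<integral>u. \<bar>\<Sum>i<n. \<Sum>j<n. off_diagonal b i j * (f (u i) * g (u j))\<bar> \<partial>samples P n) \<le> 2 * \<beta> * L2norm P f * L2norm P g * sqrt n"
proof -
  interpret S: prob_space "samples P n" by (rule prob_space_samples[OF P])
  have sq: "square_integrable (samples P n) ?Q"
    by (rule quadratic_form_L2(1)[OF P f g]) (simp_all add: off_diagonal_def)
  show "integrable (samples P n) ?Q" by (rule square_integrable_integrable[OF S.finite_measure_axioms sq])
  have "(\<integral>u. (?Q u)\<^sup>2 \<partial>samples P n) \<le> 2 * (L2norm P f)\<^sup>2 * (L2norm P g)\<^sup>2 * (\<Sum>i<n. \<Sum>j<n. (off_diagonal b i j)\<^sup>2)"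
    unfolding L2norm_power2 by (rule quadratic_form_L2(2)[OF P f g]) (simp_all add: off_diagonal_def)
  also have "\<dots> \<le> 2 * (L2norm P f)\<^sup>2 * (L2norm P g)\<^sup>2 * (n * \<beta>\<^sup>2)"
    by (intro mult_left_mono off_diagonal_frobenius[OF b]) auto
  also have "\<dots> \<le> 4 * (L2norm P f)\<^sup>2 * (L2norm P g)\<^sup>2 * (n * \<beta>\<^sup>2)"
    by (intro mult_right_mono) auto
  also have "\<dots> = (2 * \<beta> * L2norm P f * L2norm P g * sqrt n)\<^sup>2" by (simp add: power_mult_distrib)
  finally show "(\<integral>u. \<bar>?Q u\<bar> \<partial>samples P n) \<le> 2 * \<beta> * L2norm P f * L2norm P g * sqrt n"
    using op_boundedD(1)[OF b] by (intro S.expectation_abs_le_L2[OF sq]) (auto simp: L2norm_nonneg)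
qed

lemma weighted_sum_L1:
  assumes P: "prob_space P" and f: "square_integrable P f" "integral\<^sup>L P f = 0"
    and c: "\<And>i. i < n \<Longrightarrow> \<bar>c i\<bar> \<le> \<beta>" and \<beta>: "0 \<le> \<beta>"
  shows "integrable (samples P n) (\<lambda>u. \<Sum>i<n. c i * f (u i))" (is "integrable _ ?Q")
    and "(\<integral>u. \<bar>\<Sum>i<n. c i * f (u i)\<bar> \<partial>samples P n) \<le> \<beta> * L2norm P f * sqrt n"
proof -
  interpret S: prob_space "samples P n" by (rule prob_space_samples[OF P])
  have sq: "square_integrable (samples P n) ?Q"
    by (rule weighted_sum_L2(1)[OF P f]) simp
  show "integrable (samples P n) ?Q" by (rule square_integrable_integrable[OF S.finite_measure_axioms sq])
  have "(\<integral>u. (?Q u)\<^sup>2 \<partial>samples P n) = (L2norm P f)\<^sup>2 * (\<Sum>i<n. (c i)\<^sup>2)"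
    unfolding L2norm_power2 by (rule weighted_sum_L2(2)[OF P f]) simp
  also have "\<dots> \<le> (L2norm P f)\<^sup>2 * (\<Sum>i<n. \<beta>\<^sup>2)"
  proof (intro mult_left_mono sum_mono)
    fix i assume "i \<in> {..<n}"
    then show "(c i)\<^sup>2 \<le> \<beta>\<^sup>2" using power_mono[OF c abs_ge_zero, of i 2] by simp
  qed simp
  also have "\<dots> = (\<beta> * L2norm P f * sqrt n)\<^sup>2" by (simp add: power_mult_distrib)
  finally show "(\<integral>u. \<bar>?Q u\<bar> \<partial>samples P n) \<le> \<beta> * L2norm P f * sqrt n"
    using \<beta> by (intro S.expectation_abs_le_L2[OF sq]) (auto simp: L2norm_nonneg)
qed

text \<open>The statistic is bilinear in \<open>(f, h)\<close> and linear in \<open>\<zeta>\<close> and \<open>\<eta>\<close>, so its change is controlled by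
the \<open>L\<^sup>2\<close> changes of these functions, uniformly in \<open>n\<close> and in \<open>b\<close>.\<close>

lemma quad_stat_L1_diff:
  assumes P: "prob_space P" and b: "op_bounded n \<beta> b"
    and f: "\<And>l. l \<in> L \<Longrightarrow> square_integrable P (f l)" "\<And>l. l \<in> L \<Longrightarrow> integral\<^sup>L P (f l) = 0"
    and h: "\<And>l. l \<in> L \<Longrightarrow> square_integrable P (h l)" "\<And>l. l \<in> L \<Longrightarrow> integral\<^sup>L P (h l) = 0"
    and \<zeta>: "square_integrable P \<zeta>" "integral\<^sup>L P \<zeta> = 0"
    and \<eta>: "square_integrable P \<eta>" "integral\<^sup>L P \<eta> = 0"
    and f': "\<And>l. l \<in> L \<Longrightarrow> square_integrable P (f' l)" "\<And>l. l \<in> L \<Longrightarrow> integral\<^sup>L P (f' l) = 0"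
    and h': "\<And>l. l \<in> L \<Longrightarrow> square_integrable P (h' l)" "\<And>l. l \<in> L \<Longrightarrow> integral\<^sup>L P (h' l) = 0"
    and \<zeta>': "square_integrable P \<zeta>'" "integral\<^sup>L P \<zeta>' = 0"
    and \<eta>': "square_integrable P \<eta>'" "integral\<^sup>L P \<eta>' = 0"
  shows "integrable (samples P n) (\<lambda>u. quad_stat n b L f h \<zeta> \<eta> u - quad_stat n b L f' h' \<zeta>' \<eta>' u)"
    and "(\<integral>u. \<bar>quad_stat n b L f h \<zeta> \<eta> u - quad_stat n b L f' h' \<zeta>' \<eta>' u\<bar> \<partial>samples P n)
       \<le> (\<Sum>l\<in>L. 2 * \<beta> * L2norm P (\<lambda>x. f l x - f' l x) * L2norm P (h l)
            + 2 * \<beta> * L2norm P (f' l) * L2norm P (\<lambda>x. h l x - h' l x))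
         + \<beta> * L2norm P (\<lambda>x. \<zeta> x - \<zeta>' x) + \<beta> * L2norm P (\<lambda>x. \<eta> x - \<eta>' x)" (is "_ \<le> ?\<Delta>")
proof -
  interpret S: prob_space "samples P n" by (rule prob_space_samples[OF P])
  have \<beta>: "0 \<le> \<beta>" by (rule op_boundedD(1)[OF b])
  note fin = prob_space.axioms(1)[OF P]
  have mean_diff: "integral\<^sup>L P (\<lambda>x. g x - g' x) = 0" if "square_integrable P g" "square_integrable P g'" "integral\<^sup>L P g = 0" "integral\<^sup>L P g' = 0" for g g'
    using that square_integrable_integrable[OF fin] by simp
  define Q where "Q g k u = (\<Sum>i<n. \<Sum>j<n. off_diagonal b i j * (g (u i) * k (u j)))" for g k and u :: "nat \<Rightarrow> 'a"
  define Wt where "Wt c g u = (\<Sum>i<n. c i * g (u i))" for c :: "nat \<Rightarrow> real" and g and u :: "nat \<Rightarrow> 'a"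
  let ?F = "\<lambda>l x. f l x - f' l x" and ?H = "\<lambda>l x. h l x - h' l x" and ?Z = "\<lambda>x. \<zeta> x - \<zeta>' x" and ?E = "\<lambda>x. \<eta> x - \<eta>' x"
  define m where "m = tr n b / n"
  have m_le: "\<bar>m\<bar> \<le> \<beta>" unfolding m_def by (rule mean_diagonal_le[OF b])
  let ?d = "\<lambda>i. b i i" and ?m = "\<lambda>i::nat. m"
  have diff: "quad_stat n b L f h \<zeta> \<eta> u - quad_stat n b L f' h' \<zeta>' \<eta>' u
     = ((\<Sum>l\<in>L. Q (?F l) (h l) u + Q (f' l) (?H l) u) + (Wt ?d ?Z u - Wt ?m ?E u)) / sqrt n" for u
    unfolding quad_stat_def Q_def Wt_def m_def[symmetric]
    by (simp add: diff_divide_distrib[symmetric] sum_subtractf sum.distrib algebra_simps)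
  have Q1: "integrable (samples P n) (Q (?F l) (h l))" "(\<integral>u. \<bar>Q (?F l) (h l) u\<bar> \<partial>samples P n) \<le> 2 * \<beta> * L2norm P (?F l) * L2norm P (h l) * sqrt n" if "l \<in> L" for l
    unfolding Q_def using that
    by (intro quadratic_form_L1[OF P b] square_integrable_diff mean_diff f f' h; assumption)+
  have Q2: "integrable (samples P n) (Q (f' l) (?H l))" "(\<integral>u. \<bar>Q (f' l) (?H l) u\<bar> \<partial>samples P n) \<le> 2 * \<beta> * L2norm P (f' l) * L2norm P (?H l) * sqrt n" if "l \<in> L" for l
    unfolding Q_def using that
    by (intro quadratic_form_L1[OF P b] square_integrable_diff mean_diff f' h h'; assumption)+
  have W1: "integrable (samples P n) (Wt ?d ?Z)" "(\<integral>u. \<bar>Wt ?d ?Z u\<bar> \<partial>samples P n) \<le> \<beta> * L2norm P ?Z * sqrt n"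
    unfolding Wt_def
    using weighted_sum_L1[OF P, of ?Z n ?d \<beta>] square_integrable_diff[OF \<zeta>(1) \<zeta>'(1)]
      mean_diff[OF \<zeta>(1) \<zeta>'(1) \<zeta>(2) \<zeta>'(2)] \<beta> op_bounded_entry[OF b] by blast+
  have W2: "integrable (samples P n) (Wt ?m ?E)" "(\<integral>u. \<bar>Wt ?m ?E u\<bar> \<partial>samples P n) \<le> \<beta> * L2norm P ?E * sqrt n"
    unfolding Wt_def
    using weighted_sum_L1[OF P, of ?E n ?m \<beta>] square_integrable_diff[OF \<eta>(1) \<eta>'(1)]
      mean_diff[OF \<eta>(1) \<eta>'(1) \<eta>(2) \<eta>'(2)] \<beta> m_le by blast+
  let ?M = "\<lambda>u. ((\<Sum>l\<in>L. \<bar>Q (?F l) (h l) u\<bar> + \<bar>Q (f' l) (?H l) u\<bar>) + (\<bar>Wt ?d ?Z u\<bar> + \<bar>Wt ?m ?E u\<bar>)) / sqrt n"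
  show int: "integrable (samples P n) (\<lambda>u. quad_stat n b L f h \<zeta> \<eta> u - quad_stat n b L f' h' \<zeta>' \<eta>' u)"
    unfolding diff using Q1(1) Q2(1) W1(1) W2(1)
    by (intro integrable_divide_zero Bochner_Integration.integrable_add Bochner_Integration.integrable_diff Bochner_Integration.integrable_sum) auto
  have "(\<integral>u. \<bar>quad_stat n b L f h \<zeta> \<eta> u - quad_stat n b L f' h' \<zeta>' \<eta>' u\<bar> \<partial>samples P n) \<le> (\<integral>u. ?M u \<partial>samples P n)"
  proof (rule integral_mono)
    show "integrable (samples P n) (\<lambda>u. \<bar>quad_stat n b L f h \<zeta> \<eta> u - quad_stat n b L f' h' \<zeta>' \<eta>' u\<bar>)"
      using int by simp
    show "integrable (samples P n) ?M"
      using Q1(1) Q2(1) W1(1) W2(1)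
      by (intro integrable_divide_zero Bochner_Integration.integrable_add Bochner_Integration.integrable_sum integrable_abs) auto
    fix u
    have "\<bar>\<Sum>l\<in>L. Q (?F l) (h l) u + Q (f' l) (?H l) u\<bar> \<le> (\<Sum>l\<in>L. \<bar>Q (?F l) (h l) u\<bar> + \<bar>Q (f' l) (?H l) u\<bar>)"
      by (rule order_trans[OF sum_abs], rule sum_mono, rule abs_triangle_ineq)
    then have "\<bar>(\<Sum>l\<in>L. Q (?F l) (h l) u + Q (f' l) (?H l) u) + (Wt ?d ?Z u - Wt ?m ?E u)\<bar>
        \<le> (\<Sum>l\<in>L. \<bar>Q (?F l) (h l) u\<bar> + \<bar>Q (f' l) (?H l) u\<bar>) + (\<bar>Wt ?d ?Z u\<bar> + \<bar>Wt ?m ?E u\<bar>)"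
      by linarith
    then show "\<bar>quad_stat n b L f h \<zeta> \<eta> u - quad_stat n b L f' h' \<zeta>' \<eta>' u\<bar> \<le> ?M u"
      unfolding diff by (simp add: divide_right_mono)
  qed
  also have "(\<integral>u. ?M u \<partial>samples P n) = ((\<Sum>l\<in>L. (\<integral>u. \<bar>Q (?F l) (h l) u\<bar> \<partial>samples P n) + (\<integral>u. \<bar>Q (f' l) (?H l) u\<bar> \<partial>samples P n))
      + ((\<integral>u. \<bar>Wt ?d ?Z u\<bar> \<partial>samples P n) + (\<integral>u. \<bar>Wt ?m ?E u\<bar> \<partial>samples P n))) / sqrt n"
    using Q1(1) Q2(1) W1(1) W2(1) by simp
  also have "\<dots> \<le> ((\<Sum>l\<in>L. 2 * \<beta> * L2norm P (?F l) * L2norm P (h l) * sqrt n + 2 * \<beta> * L2norm P (f' l) * L2norm P (?H l) * sqrt n)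
      + (\<beta> * L2norm P ?Z * sqrt n + \<beta> * L2norm P ?E * sqrt n)) / sqrt n"
    by (intro divide_right_mono add_mono sum_mono Q1(2) Q2(2) W1(2) W2(2)) auto
  also have "\<dots> = ?\<Delta> * sqrt n / sqrt n"
    by (simp add: distrib_right sum_distrib_right)
  also have "\<dots> \<le> ?\<Delta>"
  proof (cases "n = 0")
    case True
    have "0 \<le> ?\<Delta>" by (intro add_nonneg_nonneg sum_nonneg mult_nonneg_nonneg \<beta> L2norm_nonneg zero_le_numeral)
    with True show ?thesis by simp
  qed simp
  finally show "(\<integral>u. \<bar>quad_stat n b L f h \<zeta> \<eta> u - quad_stat n b L f' h' \<zeta>' \<eta>' u\<bar> \<partial>samples P n) \<le> ?\<Delta>" .
qed

lemma quad_stat_measurable: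
  assumes "\<And>l. l \<in> L \<Longrightarrow> f l \<in> borel_measurable P" "\<And>l. l \<in> L \<Longrightarrow> h l \<in> borel_measurable P"
    "\<zeta> \<in> borel_measurable P" "\<eta> \<in> borel_measurable P"
  shows "quad_stat n b L f h \<zeta> \<eta> \<in> borel_measurable (samples P n)"
  unfolding quad_stat_def[abs_def] using assms
  by (intro borel_measurable_divide borel_measurable_add borel_measurable_diff borel_measurable_sum
      borel_measurable_times borel_measurable_const
      measurable_compose[OF measurable_component_singleton, of _ "{..<n}" "\<lambda>_. P"]) auto

lemma iexp_diff_le: "norm (iexp x - iexp y) \<le> \<bar>x - y\<bar>"
proof -
  have "iexp x - iexp y = iexp y * (iexp (x - y) - 1)"
    by (simp add: right_diff_distrib exp_add[symmetric] algebra_simps)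
  then show ?thesis using norm_iexp_minus_one_le[of "x - y"] by (simp add: norm_mult)
qed

lemma char_diff_le_L1:
  assumes "prob_space M" "f \<in> borel_measurable M" "g \<in> borel_measurable M" "integrable M (\<lambda>x. f x - g x)"
  shows "norm ((\<integral>x. iexp (f x) \<partial>M) - (\<integral>x. iexp (g x) \<partial>M)) \<le> (\<integral>x. \<bar>f x - g x\<bar> \<partial>M)"
proof -
  have i: "integrable M (\<lambda>x. iexp (f x))" "integrable M (\<lambda>x. iexp (g x))"
    by (intro bounded_measurable_integrable[OF assms(1)] bounded_measurable_iexp assms(2,3))+
  have "norm (\<integral>x. iexp (f x) - iexp (g x) \<partial>M) \<le> (\<integral>x. norm (iexp (f x) - iexp (g x)) \<partial>M)"
    by (rule integral_norm_bound)
  also have "\<dots> \<le> (\<integral>x. \<bar>f x - g x\<bar> \<partial>M)"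
    using i assms(4) by (intro integral_mono iexp_diff_le) auto
  finally show ?thesis using i by simp
qed

text \<open>The truncation level \<open>k\<close> is fixed first, so that truncation changes the statistic by little in
\<open>L\<^sup>1\<close> and its variance by little, both for all \<open>n\<close> and \<open>b\<close> at once; only then does \<open>n\<close> grow.\<close>

theorem char_quad_stat:
  fixes f h :: "'l \<Rightarrow> 'e \<Rightarrow> real"
  assumes P: "prob_space P" and L: "finite L" and \<beta>: "0 \<le> \<beta>" and e: "0 < (\<epsilon>::real)"
    and f: "\<And>l. l \<in> L \<Longrightarrow> square_integrable P (f l)" "\<And>l. l \<in> L \<Longrightarrow> integral\<^sup>L P (f l) = 0"
    and h: "\<And>l. l \<in> L \<Longrightarrow> square_integrable P (h l)" "\<And>l. l \<in> L \<Longrightarrow> integral\<^sup>L P (h l) = 0"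
    and \<zeta>: "square_integrable P \<zeta>" "integral\<^sup>L P \<zeta> = 0"
    and \<eta>: "square_integrable P \<eta>" "integral\<^sup>L P \<eta> = 0"
  shows "\<forall>\<^sub>F n in sequentially. \<forall>b. op_bounded n \<beta> b \<longrightarrow>
     norm ((\<integral>u. iexp (quad_stat n b L f h \<zeta> \<eta> u) \<partial>samples P n)
       - complex_of_real (exp (- quad_var n b (kernel_variance P L f h) (moment P \<zeta> \<zeta>) (moment P \<eta> \<eta> - 2 * moment P \<zeta> \<eta>) / 2))) < \<epsilon>"
proof -
  note fin = prob_space.axioms(1)[OF P]
  note int = square_integrable_integrable[OF fin]
  define fk hk where "fk k l = truncated P k (f l)" and "hk k l = truncated P k (h l)" for k l
  define zk ek where "zk k = truncated P k \<zeta>" and "ek k = truncated P k \<eta>" for k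
  let ?J = "kernel_variance P L f h" and ?s = "moment P \<zeta> \<zeta>" and ?r = "moment P \<eta> \<eta> - 2 * moment P \<zeta> \<eta>"
  define J s r where "J k = kernel_variance P L (fk k) (hk k)" and "s k = moment P (zk k) (zk k)"
    and "r k = moment P (ek k) (ek k) - 2 * moment P (zk k) (ek k)" for k
  \<comment> \<open>\<Delta> bounds the effect of truncation on the statistic, \<Gamma> that on its variance, M the variance itself\<close>
  define \<Delta> where "\<Delta> k = (\<Sum>l\<in>L. 2 * \<beta> * L2norm P (\<lambda>x. f l x - fk k l x) * L2norm P (h l)
            + 2 * \<beta> * L2norm P (fk k l) * L2norm P (\<lambda>x. h l x - hk k l x))
         + \<beta> * L2norm P (\<lambda>x. \<zeta> x - zk k x) + \<beta> * L2norm P (\<lambda>x. \<eta> x - ek k x)" for k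
  define \<Gamma> where "\<Gamma> k = \<beta>\<^sup>2 * (\<bar>J k - ?J\<bar> + \<bar>s k - ?s\<bar> + \<bar>r k - ?r\<bar>)" for k
  define M where "M = \<beta>\<^sup>2 * (\<bar>?J\<bar> + \<bar>?s\<bar> + \<bar>?r\<bar>)"
  have "\<Delta> \<longlonglongrightarrow> (\<Sum>l\<in>L. 2 * \<beta> * 0 * L2norm P (h l) + 2 * \<beta> * L2norm P (f l) * 0) + \<beta> * 0 + \<beta> * 0"
    unfolding \<Delta>_def fk_def hk_def zk_def ek_def using f h \<zeta> \<eta>
    by (intro tendsto_intros L2norm_truncated_tendsto[OF P] L2norm_truncation_error_tendsto[OF P]) auto
  then have \<Delta>: "\<Delta> \<longlonglongrightarrow> 0" by simp
  have J: "J \<longlonglongrightarrow> ?J"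
    unfolding J_def kernel_variance_def fk_def hk_def using f h
    by (intro tendsto_intros moment_truncated_tendsto[OF P]) auto
  have s: "s \<longlonglongrightarrow> ?s" unfolding s_def zk_def using \<zeta> by (intro moment_truncated_tendsto[OF P]) auto
  have r: "r \<longlonglongrightarrow> ?r" unfolding r_def zk_def ek_def using \<zeta> \<eta>
    by (intro tendsto_intros moment_truncated_tendsto[OF P]) auto
  have "\<Gamma> \<longlonglongrightarrow> \<beta>\<^sup>2 * (\<bar>?J - ?J\<bar> + \<bar>?s - ?s\<bar> + \<bar>?r - ?r\<bar>)"
    unfolding \<Gamma>_def by (intro tendsto_intros J s r)
  then have \<Gamma>: "\<Gamma> \<longlonglongrightarrow> 0" by simp
  have "(\<lambda>k. \<Delta> k + exp ((M + \<Gamma> k) / 2) * (\<Gamma> k / 2)) \<longlonglongrightarrow> 0 + exp ((M + 0) / 2) * (0 / 2)"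
    by (intro tendsto_intros \<Delta> \<Gamma>) auto
  then have "(\<lambda>k. \<Delta> k + exp ((M + \<Gamma> k) / 2) * (\<Gamma> k / 2)) \<longlonglongrightarrow> 0" by simp
  from order_tendstoD(2)[OF this, of "\<epsilon> / 2"] e
  obtain k where k: "\<Delta> k + exp ((M + \<Gamma> k) / 2) * (\<Gamma> k / 2) < \<epsilon> / 2"
    by (auto simp: eventually_sequentially)
  have bdd: "\<forall>\<^sub>F n in sequentially. \<forall>b. op_bounded n \<beta> b \<longrightarrow>
     norm ((\<integral>u. iexp (quad_stat n b L (fk k) (hk k) (zk k) (ek k) u) \<partial>samples P n)
       - complex_of_real (exp (- quad_var n b (J k) (s k) (r k) / 2))) < \<epsilon> / 2"
    unfolding J_def s_def r_def
    by (rule char_quad_stat_bounded[OF P L \<beta>, where c = "2 * real k"])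
       (use e f h \<zeta> \<eta> in \<open>auto simp: fk_def hk_def zk_def ek_def intro!: truncated_measurable[OF P int] truncated_bounded[OF P int] truncated_mean[OF P int]\<close>)
  show ?thesis
    using bdd
  proof eventually_elim
    case (elim n)
    show ?case
    proof (intro allI impI)
      fix b assume b: "op_bounded n \<beta> b"
      let ?S = "samples P n"
      let ?c = "\<integral>u. iexp (quad_stat n b L f h \<zeta> \<eta> u) \<partial>?S" and ?ck = "\<integral>u. iexp (quad_stat n b L (fk k) (hk k) (zk k) (ek k) u) \<partial>?S"
      let ?v = "quad_var n b ?J ?s ?r" and ?vk = "quad_var n b (J k) (s k) (r k)"
      have tr': "\<And>l. l \<in> L \<Longrightarrow> square_integrable P (fk k l)" "\<And>l. l \<in> L \<Longrightarrow> integral\<^sup>L P (fk k l) = 0"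
        "\<And>l. l \<in> L \<Longrightarrow> square_integrable P (hk k l)" "\<And>l. l \<in> L \<Longrightarrow> integral\<^sup>L P (hk k l) = 0"
        "square_integrable P (zk k)" "integral\<^sup>L P (zk k) = 0" "square_integrable P (ek k)" "integral\<^sup>L P (ek k) = 0"
        using f h \<zeta> \<eta> by (auto simp: fk_def hk_def zk_def ek_def intro!: truncated_square_integrable[OF P int] truncated_mean[OF P int])
      note L1 = quad_stat_L1_diff[OF P b f h \<zeta> \<eta> tr']
      have "norm (?c - ?ck) \<le> (\<integral>u. \<bar>quad_stat n b L f h \<zeta> \<eta> u - quad_stat n b L (fk k) (hk k) (zk k) (ek k) u\<bar> \<partial>?S)"
        by (intro char_diff_le_L1[OF prob_space_samples[OF P]] quad_stat_measurable L1(1)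
            square_integrable_measurable f(1) h(1) \<zeta>(1) \<eta>(1) tr'(1,3,5,7))
      also have "\<dots> \<le> \<Delta> k" unfolding \<Delta>_def by (rule L1(2))
      finally have 1: "norm (?c - ?ck) \<le> \<Delta> k" .
      have dv: "\<bar>?vk - ?v\<bar> \<le> \<Gamma> k" unfolding quad_var_diff \<Gamma>_def by (rule quad_var_linear_bound[OF b])
      have vM: "\<bar>?v\<bar> \<le> M" unfolding M_def by (rule quad_var_linear_bound[OF b])
      have \<Gamma>0: "0 \<le> \<Gamma> k" unfolding \<Gamma>_def by simp
      have "\<bar>exp (- ?vk / 2) - exp (- ?v / 2)\<bar> \<le> exp ((M + \<Gamma> k) / 2) * \<bar>- ?vk / 2 - - ?v / 2\<bar>"
      proof (rule exp_lipschitz)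
        have "- (?vk - ?v) \<le> \<Gamma> k" "- ?v \<le> M" using abs_le_D2[OF dv] abs_le_D2[OF vM] .
        then show "- ?vk / 2 \<le> (M + \<Gamma> k) / 2" "- ?v / 2 \<le> (M + \<Gamma> k) / 2"
          using \<Gamma>0 by simp_all
      qed
      also have "\<dots> \<le> exp ((M + \<Gamma> k) / 2) * (\<Gamma> k / 2)"
      proof (rule mult_left_mono)
        have "- ?vk / 2 - - ?v / 2 = - ((?vk - ?v) / 2)" by (simp add: diff_divide_distrib)
        then have "\<bar>- ?vk / 2 - - ?v / 2\<bar> = \<bar>?vk - ?v\<bar> / 2" by (simp only: abs_minus_cancel abs_divide abs_numeral)
        then show "\<bar>- ?vk / 2 - - ?v / 2\<bar> \<le> \<Gamma> k / 2" using dv by simp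
      qed simp
      finally have 2: "norm (complex_of_real (exp (- ?vk / 2)) - complex_of_real (exp (- ?v / 2))) \<le> exp ((M + \<Gamma> k) / 2) * (\<Gamma> k / 2)"
        by (simp only: of_real_diff[symmetric] norm_of_real)
      have 3: "norm (?ck - complex_of_real (exp (- ?vk / 2))) < \<epsilon> / 2" using elim b by blast
      have 4: "norm (?c - complex_of_real (exp (- ?v / 2))) \<le> norm (?c - ?ck) + norm (?ck - complex_of_real (exp (- ?v / 2)))"
        using norm_triangle_ineq[of "?c - ?ck" "?ck - complex_of_real (exp (- ?v / 2))"] by simp
      have 5: "norm (?ck - complex_of_real (exp (- ?v / 2))) \<le> norm (?ck - complex_of_real (exp (- ?vk / 2)))
          + norm (complex_of_real (exp (- ?vk / 2)) - complex_of_real (exp (- ?v / 2)))"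
        using norm_triangle_ineq[of "?ck - complex_of_real (exp (- ?vk / 2))"
           "complex_of_real (exp (- ?vk / 2)) - complex_of_real (exp (- ?v / 2))"] by simp
      from 1 2 3 4 5 k show "norm (?c - complex_of_real (exp (- ?v / 2))) < \<epsilon>" by linarith
    qed
  qed
qed

section \<open>Normalization by the sample second moments\<close>

text \<open>For a truncated summand the \<open>L\<^sup>2\<close> norm of the mean is of order \<open>1 / sqrt n\<close>; the rest contributes at
most its own \<open>L\<^sup>1\<close> norm.\<close>

lemma weak_law_L1:
  assumes P: "prob_space P" and g: "integrable P g" "integral\<^sup>L P g = 0"
  shows "(\<lambda>n. \<integral>u. \<bar>(\<Sum>i<n. g (u i)) / n\<bar> \<partial>samples P n) \<longlonglongrightarrow> 0"
proof (rule LIMSEQ_I)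
  fix r :: real assume r: "0 < r"
  interpret P: prob_space P by (rule P)
  let ?E = "\<lambda>k x. g x - truncated P k g x"
  have tm: "truncated P k g \<in> borel_measurable P" for k by (rule truncated_measurable[OF P g])
  have ti: "integrable P (truncated P k g)" for k
    by (rule square_integrable_integrable[OF P.finite_measure_axioms truncated_square_integrable[OF P g]])
  have "(\<lambda>k. \<integral>x. \<bar>?E k x\<bar> \<partial>P) \<longlonglongrightarrow> (\<integral>x. \<bar>g x - g x\<bar> \<partial>P)"
  proof (rule integral_dominated_convergence[where w = "\<lambda>x. 2 * \<bar>g x\<bar> + (\<integral>x. \<bar>g x\<bar> \<partial>P)"])
    show "AE x in P. (\<lambda>k. \<bar>?E k x\<bar>) \<longlonglongrightarrow> \<bar>g x - g x\<bar>"
      by (intro AE_I2 tendsto_intros truncated_tendsto[OF P g])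
    show "AE x in P. norm \<bar>?E k x\<bar> \<le> 2 * \<bar>g x\<bar> + (\<integral>x. \<bar>g x\<bar> \<partial>P)" for k
    proof (rule AE_I2)
      fix x show "norm \<bar>?E k x\<bar> \<le> 2 * \<bar>g x\<bar> + (\<integral>x. \<bar>g x\<bar> \<partial>P)"
        using truncated_dominated[OF P g, of k x] unfolding real_norm_def by linarith
    qed
  qed (use g tm in auto)
  then have "(\<lambda>k. \<integral>x. \<bar>?E k x\<bar> \<partial>P) \<longlonglongrightarrow> 0" by simp
  from order_tendstoD(2)[OF this, of "r / 2"] r obtain k where k: "(\<integral>x. \<bar>?E k x\<bar> \<partial>P) < r / 2"
    by (auto simp: eventually_sequentially)
  define N where "N = L2norm P (truncated P k g)"
  have main: "(\<integral>u. \<bar>(\<Sum>i<n. g (u i)) / n\<bar> \<partial>samples P n) \<le> (\<integral>x. \<bar>?E k x\<bar> \<partial>P) + N / sqrt n" if n: "0 < n" for n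
  proof -
    interpret S: prob_space "samples P n" by (rule prob_space_samples[OF P])
    let ?T = "\<lambda>u. \<Sum>i<n. 1 * truncated P k g (u i)"
    have iE: "integrable P (\<lambda>x. \<bar>?E k x\<bar>)" using g ti by simp
    have c: "integrable (samples P n) (\<lambda>u. \<bar>?E k (u i)\<bar>)" "(\<integral>u. \<bar>?E k (u i)\<bar> \<partial>samples P n) = (\<integral>x. \<bar>?E k x\<bar> \<partial>P)" if "i < n" for i
      using samples_component_integral[OF P that borel_measurable_integrable[OF iE]] iE by simp_all
    have ig: "integrable (samples P n) (\<lambda>u. g (u i))" if "i < n" for i
      using samples_component_integral(1)[OF P that borel_measurable_integrable[OF g(1)]] g(1) by simp
    have it: "integrable (samples P n) (\<lambda>u. truncated P k g (u i))" if "i < n" for i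
      using samples_component_integral(1)[OF P that tm[of k]] ti[of k] by simp
    note T = weighted_sum_L1[OF P truncated_square_integrable[OF P g, of k] truncated_mean[OF P g, of k], where c = "\<lambda>_. 1" and \<beta> = 1 and n = n, simplified]
    have "(\<integral>u. \<bar>(\<Sum>i<n. g (u i)) / n\<bar> \<partial>samples P n) \<le> (\<integral>u. ((\<Sum>i<n. \<bar>?E k (u i)\<bar>) + \<bar>\<Sum>i<n. truncated P k g (u i)\<bar>) / n \<partial>samples P n)"
    proof (rule integral_mono)
      show "integrable (samples P n) (\<lambda>u. \<bar>(\<Sum>i<n. g (u i)) / n\<bar>)"
        by (intro integrable_abs integrable_divide_zero Bochner_Integration.integrable_sum) (use ig in auto)
      show "integrable (samples P n) (\<lambda>u. ((\<Sum>i<n. \<bar>?E k (u i)\<bar>) + \<bar>\<Sum>i<n. truncated P k g (u i)\<bar>) / n)"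
        by (intro integrable_divide_zero Bochner_Integration.integrable_add integrable_abs[OF T(1)]
            Bochner_Integration.integrable_sum c(1)) simp
      fix u
      have "(\<Sum>i<n. g (u i)) = (\<Sum>i<n. ?E k (u i)) + (\<Sum>i<n. truncated P k g (u i))"
        by (simp add: sum_subtractf)
      then have "\<bar>\<Sum>i<n. g (u i)\<bar> \<le> (\<Sum>i<n. \<bar>?E k (u i)\<bar>) + \<bar>\<Sum>i<n. truncated P k g (u i)\<bar>"
        using sum_abs[of "\<lambda>i. ?E k (u i)" "{..<n}"] by linarith
      from divide_right_mono[OF this, of "real n"] show "\<bar>(\<Sum>i<n. g (u i)) / n\<bar> \<le> ((\<Sum>i<n. \<bar>?E k (u i)\<bar>) + \<bar>\<Sum>i<n. truncated P k g (u i)\<bar>) / n"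
        by simp
    qed
    also have "\<dots> = ((\<Sum>i<n. \<integral>u. \<bar>?E k (u i)\<bar> \<partial>samples P n) + (\<integral>u. \<bar>\<Sum>i<n. truncated P k g (u i)\<bar> \<partial>samples P n)) / n"
    proof -
      have iS: "integrable (samples P n) (\<lambda>u. \<Sum>i<n. \<bar>?E k (u i)\<bar>)"
        by (rule Bochner_Integration.integrable_sum) (simp add: c(1))
      have "(\<integral>u. (\<Sum>i<n. \<bar>?E k (u i)\<bar>) \<partial>samples P n) = (\<Sum>i<n. \<integral>u. \<bar>?E k (u i)\<bar> \<partial>samples P n)"
        by (rule Bochner_Integration.integral_sum) (simp add: c(1))
      then show ?thesis
        by (simp only: integral_divide_zero Bochner_Integration.integral_add[OF iS integrable_abs[OF T(1)]])
    qed
    also have "\<dots> \<le> (n * (\<integral>x. \<bar>?E k x\<bar> \<partial>P) + N * sqrt n) / n"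
      using c(2) T(2) by (intro divide_right_mono add_mono) (auto simp: N_def)
    also have "\<dots> = (\<integral>x. \<bar>?E k x\<bar> \<partial>P) + N * (sqrt n / n)"
      using n by (simp add: add_divide_distrib)
    also have "sqrt n / n = 1 / sqrt n" using n by (simp add: real_div_sqrt field_simps)
    finally show ?thesis by simp
  qed
  have "(\<lambda>n. N / sqrt (real n)) \<longlonglongrightarrow> 0" by real_asymp
  from order_tendstoD(2)[OF this, of "r / 2"] r obtain n0 where n0: "\<And>n. n \<ge> n0 \<Longrightarrow> N / sqrt (real n) < r / 2"
    by (auto simp: eventually_sequentially)
  have "norm ((\<integral>u. \<bar>(\<Sum>i<n. g (u i)) / n\<bar> \<partial>samples P n) - 0) < r" if "n \<ge> Suc n0" for n
  proof -
    have "0 \<le> (\<integral>u. \<bar>(\<Sum>i<n. g (u i)) / n\<bar> \<partial>samples P n)" by (rule Bochner_Integration.integral_nonneg) simp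
    moreover have "(\<integral>u. \<bar>(\<Sum>i<n. g (u i)) / n\<bar> \<partial>samples P n) < r / 2 + r / 2"
      by (rule le_less_trans[OF main add_strict_mono[OF k n0]]) (use that in auto)
    ultimately show ?thesis by (simp only: diff_zero real_norm_def abs_of_nonneg)
  qed
  then show "\<exists>no. \<forall>n\<ge>no. norm ((\<integral>u. \<bar>(\<Sum>i<n. g (u i)) / n\<bar> \<partial>samples P n) - 0) < r" by blast
qed

text \<open>With \<open>D\<^sup>2 = 1 + G\<close>, \<open>G = a + c + a c\<close>, the remainders are explicit:
\<open>1 / D - 1 = - G / (D (1 + D))\<close> and \<open>1 / D - 1 + G / 2 = G\<^sup>2 (D + 2) / (2 D (1 + D)\<^sup>2)\<close>. The
hypotheses make \<open>D (1 + D) \<ge> 1\<close>, and \<open>\<bar>G\<bar> \<le> 2 (\<bar>a\<bar> + \<bar>c\<bar>)\<close>; one of the nine units pays for the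
difference between \<open>G / 2\<close> and \<open>(a + c) / 2\<close>.\<close>

lemma inverse_sqrt_expansion:
  fixes a c :: real
  assumes a: "\<bar>a\<bar> \<le> 1/4" and c: "\<bar>c\<bar> \<le> 1/4"
  defines "D \<equiv> sqrt ((1 + a) * (1 + c))"
  shows "\<bar>1 / D - 1\<bar> \<le> 2 * (\<bar>a\<bar> + \<bar>c\<bar>)" and "\<bar>1 / D - 1 + (a + c) / 2\<bar> \<le> 9 * (a\<^sup>2 + c\<^sup>2)"
proof -
  define G where "G = a + c + a * c"
  have ac: "3/4 \<le> 1 + a" "3/4 \<le> 1 + c" using a c by auto
  have "3/4 * (3/4) \<le> (1 + a) * (1 + c)" using ac by (intro mult_mono) auto
  then have G: "1/2 \<le> 1 + G" unfolding G_def by (simp add: algebra_simps)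
  have "0 \<le> (1 + a) * (1 + c)" using ac by simp
  then have "D * D = (1 + a) * (1 + c)" unfolding D_def by (simp only: real_sqrt_mult_self abs_of_nonneg)
  then have D2: "D * D = 1 + G" by (simp add: G_def algebra_simps)
  have D0: "7/10 \<le> D" unfolding D_def using \<open>3/4 * (3/4) \<le> (1 + a) * (1 + c)\<close>
    by (intro real_le_rsqrt) (simp add: power2_eq_square)
  have DD: "1 \<le> D * (1 + D)" using D0 D2 G by (simp add: distrib_left)
  have Dpos: "0 < D" using D0 by simp
  have ee: "1 / D - 1 = - G / (D * (1 + D))"
  proof -
    have "G = (D - 1) * (1 + D)" using D2 by (simp add: algebra_simps)
    then have "- G = (1 - D) * (1 + D)" by (simp add: algebra_simps)
    then have "- G / (D * (1 + D)) = (1 - D) * (1 + D) / (D * (1 + D))" by (simp only:)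
    also have "\<dots> = (1 - D) / D" using Dpos by simp
    finally show ?thesis using Dpos by (simp add: diff_divide_distrib)
  qed
  have acb: "\<bar>a * c\<bar> \<le> \<bar>a\<bar> * (1/4)" unfolding abs_mult using c by (intro mult_left_mono) auto
  have Gb: "\<bar>G\<bar> \<le> 2 * (\<bar>a\<bar> + \<bar>c\<bar>)" 
  proof -
    define x y where "x = \<bar>a\<bar>" and "y = \<bar>c\<bar>"
    have "\<bar>G\<bar> \<le> x + y + \<bar>a * c\<bar>" unfolding G_def x_def y_def
      by (rule order_trans[OF abs_triangle_ineq add_right_mono[OF abs_triangle_ineq]])
    also have "\<dots> \<le> x + y + x * (1/4)" using acb unfolding x_def by (rule add_left_mono)
    also have "\<dots> \<le> 2 * (x + y)" using abs_ge_zero[of a] abs_ge_zero[of c] unfolding x_def[symmetric] y_def[symmetric] by simp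
    finally show ?thesis unfolding x_def y_def .
  qed
  have "\<bar>1 / D - 1\<bar> = \<bar>G\<bar> / (D * (1 + D))" unfolding ee using Dpos by (simp add: abs_mult)
  also have "\<dots> \<le> \<bar>G\<bar> / 1" using DD by (intro divide_left_mono) auto
  finally show "\<bar>1 / D - 1\<bar> \<le> 2 * (\<bar>a\<bar> + \<bar>c\<bar>)" using Gb by simp
  have e2: "1 / D - 1 + G / 2 = G\<^sup>2 * ((D + 2) / (2 * (1 + D))) / (D * (1 + D))"
  proof -
    have "G = (D - 1) * (1 + D)" using D2 by (simp add: algebra_simps)
    moreover have "1 + D \<noteq> 0" "D \<noteq> 0" using Dpos by auto
    ultimately show ?thesis by (simp add: divide_simps power2_eq_square) (simp add: algebra_simps)
  qed
  have r: "0 \<le> (D + 2) / (2 * (1 + D))" "(D + 2) / (2 * (1 + D)) \<le> 1" using Dpos by (auto simp: divide_simps)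
  have "\<bar>1 / D - 1 + G / 2\<bar> = G\<^sup>2 * ((D + 2) / (2 * (1 + D))) / (D * (1 + D))"
    unfolding e2 using DD Dpos r(1) by (intro abs_of_nonneg divide_nonneg_nonneg mult_nonneg_nonneg) auto
  also have "\<dots> \<le> G\<^sup>2 * 1 / 1"
    using DD r Dpos by (intro frac_le mult_left_mono) auto
  finally have "\<bar>1 / D - 1 + G / 2\<bar> \<le> G\<^sup>2 * 1 / 1" .
  then have "\<bar>1 / D - 1 + G / 2\<bar> \<le> G\<^sup>2" by simp
  also have "\<dots> \<le> (2 * (\<bar>a\<bar> + \<bar>c\<bar>))\<^sup>2" using power_mono[OF Gb abs_ge_zero, of 2] by simp
  also have "\<dots> \<le> 8 * (a\<^sup>2 + c\<^sup>2)"
    using zero_le_power2[of "\<bar>a\<bar> - \<bar>c\<bar>"] by (simp add: power2_sum power2_diff)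
  finally have 1: "\<bar>1 / D - 1 + G / 2\<bar> \<le> 8 * (a\<^sup>2 + c\<^sup>2)" .
  have "2 * (\<bar>a\<bar> * \<bar>c\<bar>) \<le> a\<^sup>2 + c\<^sup>2"
    using zero_le_power2[of "\<bar>a\<bar> - \<bar>c\<bar>"] by (simp add: power2_diff)
  then have "\<bar>a\<bar> * \<bar>c\<bar> / 2 \<le> (a\<^sup>2 + c\<^sup>2) / 4" by simp
  also have "\<dots> \<le> a\<^sup>2 + c\<^sup>2" using sum_power2_ge_zero[of a c] by argo
  finally have 2: "\<bar>a * c / 2\<bar> \<le> a\<^sup>2 + c\<^sup>2" by (simp only: abs_divide abs_mult abs_numeral)
  have "1 / D - 1 + (a + c) / 2 = (1 / D - 1 + G / 2) - a * c / 2" unfolding G_def by (simp add: add_divide_distrib)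
  then have "\<bar>1 / D - 1 + (a + c) / 2\<bar> \<le> \<bar>1 / D - 1 + G / 2\<bar> + \<bar>a * c / 2\<bar>"
    by (simp only: abs_triangle_ineq4)
  also have "\<dots> \<le> 8 * (a\<^sup>2 + c\<^sup>2) + (a\<^sup>2 + c\<^sup>2)" by (rule add_mono[OF 1 2])
  finally show "\<bar>1 / D - 1 + (a + c) / 2\<bar> \<le> 9 * (a\<^sup>2 + c\<^sup>2)" by simp
qed

definition sample_square :: "nat \<Rightarrow> ('e \<Rightarrow> real) \<Rightarrow> (nat \<Rightarrow> 'e) \<Rightarrow> real" where
  "sample_square n f u = (\<Sum>i<n. (f (u i))\<^sup>2) / n"

definition normalized_form :: "nat \<Rightarrow> (nat \<Rightarrow> nat \<Rightarrow> real) \<Rightarrow> ('e \<Rightarrow> real) \<Rightarrow> ('e \<Rightarrow> real) \<Rightarrow> real \<Rightarrow> (nat \<Rightarrow> 'e) \<Rightarrow> real" where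
  "normalized_form n b f h \<rho> u = ((\<Sum>i<n. \<Sum>j<n. f (u i) / sqrt (sample_square n f u) * b i j * (h (u j) / sqrt (sample_square n h u)))
      - \<rho> * tr n b) / sqrt n"

definition linearized_form :: "nat \<Rightarrow> (nat \<Rightarrow> nat \<Rightarrow> real) \<Rightarrow> ('e \<Rightarrow> real) \<Rightarrow> ('e \<Rightarrow> real) \<Rightarrow> real \<Rightarrow> (nat \<Rightarrow> 'e) \<Rightarrow> real" where
  "linearized_form n b f h \<rho> = quad_stat n b {()} (\<lambda>_. f) (\<lambda>_. h) (\<lambda>x. f x * h x - \<rho>) (\<lambda>x. \<rho> * ((f x)\<^sup>2 + (h x)\<^sup>2) / 2 - \<rho>)"

text \<open>Its diagonal is centred entry by entry, so that it is bounded in \<open>L\<^sup>1\<close> uniformly in \<open>n\<close>: it is what the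
random factor \<open>1 / D\<close> of the normalization may multiply without effect in the limit.\<close>

definition centered_form :: "nat \<Rightarrow> (nat \<Rightarrow> nat \<Rightarrow> real) \<Rightarrow> ('e \<Rightarrow> real) \<Rightarrow> ('e \<Rightarrow> real) \<Rightarrow> real \<Rightarrow> (nat \<Rightarrow> 'e) \<Rightarrow> real" where
  "centered_form n b f h \<rho> u = ((\<Sum>i<n. \<Sum>j<n. off_diagonal b i j * (f (u i) * h (u j))) + (\<Sum>i<n. b i i * (f (u i) * h (u i) - \<rho>))) / sqrt n"

text \<open>Let \<open>q\<close> be the centred form, \<open>\<tau> = tr n b / sqrt n\<close>, and \<open>D\<close> the product of the two sample
standard deviations. The normalized form is \<open>q / D + \<rho> \<tau> (1 / D - 1)\<close> and the linearized one
\<open>q - \<rho> \<tau> (A + G) / 2\<close>, so their difference is \<open>q (1 / D - 1) + \<rho> \<tau> (1 / D - 1 + (A + G) / 2)\<close>. As \<open>\<tau>\<close> may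
be of order \<open>sqrt n\<close>, the second term calls for the second order expansion of \<open>1 / D\<close>. Where \<open>\<bar>A\<bar>\<close> or \<open>\<bar>G\<bar>\<close>
exceeds \<open>\<kappa>\<close>, which includes the points with a vanishing sample variance, the first summand of the
bound is at least 1 and nothing has to be expanded.\<close>

lemma normalization_error_pointwise:
  fixes f h :: "'e \<Rightarrow> real"
  assumes n: "0 < n" and b: "op_bounded n \<beta> b" and \<kappa>: "0 < \<kappa>" "\<kappa> \<le> 1/4"
  defines "A \<equiv> \<lambda>u. sample_square n f u - 1" and "G \<equiv> \<lambda>u. sample_square n h u - 1"
  shows "min 1 \<bar>normalized_form n b f h \<rho> u - linearized_form n b f h \<rho> u\<bar>
    \<le> (\<bar>A u\<bar> + \<bar>G u\<bar>) / \<kappa> + 4 * \<kappa> * \<bar>centered_form n b f h \<rho> u\<bar> + 9 * \<beta> * sqrt n * (\<bar>\<rho>\<bar> * ((A u)\<^sup>2 + (G u)\<^sup>2))" (is "_ \<le> ?B")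
proof -
  have \<beta>: "0 \<le> \<beta>" by (rule op_boundedD(1)[OF b])
  define q where "q = centered_form n b f h \<rho> u"
  have rest: "0 \<le> 4 * \<kappa> * \<bar>q\<bar>" "0 \<le> 9 * \<beta> * sqrt n * (\<bar>\<rho>\<bar> * ((A u)\<^sup>2 + (G u)\<^sup>2))" using \<kappa> \<beta> by auto
  show ?thesis
  proof (cases "\<bar>A u\<bar> \<le> \<kappa> \<and> \<bar>G u\<bar> \<le> \<kappa>")
    case False
    then have "1 \<le> (\<bar>A u\<bar> + \<bar>G u\<bar>) / \<kappa>" using \<kappa> by (auto simp: le_divide_eq)
    then show ?thesis using rest unfolding q_def by linarith
  next
    case True
    define s s' where "s = sample_square n f u" and "s' = sample_square n h u"
    define \<tau> where "\<tau> = tr n b / sqrt n"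
    define D where "D = sqrt ((1 + A u) * (1 + G u))"
    have a4: "\<bar>A u\<bar> \<le> 1/4" "\<bar>G u\<bar> \<le> 1/4" using True \<kappa> by auto
    note ex = inverse_sqrt_expansion[OF a4, folded D_def]
    have ss: "s = 1 + A u" "s' = 1 + G u" unfolding s_def s'_def A_def G_def by auto
    have D: "D = sqrt s * sqrt s'" unfolding D_def ss by (rule real_sqrt_mult)
    have sn: "sqrt (real n) * sqrt (real n) = n" by simp
    define Q where "Q = (\<Sum>i<n. \<Sum>j<n. b i j * (f (u i) * h (u j)))"
    have Q: "Q = (\<Sum>i<n. \<Sum>j<n. off_diagonal b i j * (f (u i) * h (u j))) + (\<Sum>i<n. b i i * (f (u i) * h (u i)))"
    proof -
      have "(\<Sum>j<n. b i j * (f (u i) * h (u j))) = (\<Sum>j<n. off_diagonal b i j * (f (u i) * h (u j))) + b i i * (f (u i) * h (u i))" if "i < n" for i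
        using that by (subst (1 2) sum.remove[of "{..<n}" i]) (auto simp: off_diagonal_def intro!: sum.cong)
      then show ?thesis unfolding Q_def by (simp add: sum.distrib)
    qed
    have q: "q = (Q - \<rho> * tr n b) / sqrt n"
      unfolding q_def centered_form_def Q tr_def by (simp add: right_diff_distrib sum_subtractf sum_distrib_left mult.commute)
    have "(\<Sum>i<n. \<Sum>j<n. f (u i) / sqrt s * b i j * (h (u j) / sqrt s')) = Q / D"
      unfolding Q_def D by (simp add: sum_divide_distrib mult_ac)
    then have nf: "normalized_form n b f h \<rho> u = q / D + \<rho> * \<tau> * (1 / D - 1)"
      unfolding normalized_form_def q \<tau>_def s_def s'_def
      by (simp add: diff_divide_distrib right_diff_distrib)
    have "(\<Sum>i<n. tr n b / n * (\<rho> * ((f (u i))\<^sup>2 + (h (u i))\<^sup>2) / 2 - \<rho>)) = tr n b / n * (\<rho> * (n * s + n * s') / 2 - n * \<rho>)"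
      unfolding s_def s'_def sample_square_def using n
      by (simp add: sum_distrib_left[symmetric] sum_subtractf sum_divide_distrib[symmetric] sum.distrib)
    also have "\<dots> = tr n b * (\<rho> * (A u + G u) / 2)" using n unfolding ss by (simp add: field_simps)
    finally have X: "(\<Sum>i<n. tr n b / n * (\<rho> * ((f (u i))\<^sup>2 + (h (u i))\<^sup>2) / 2 - \<rho>)) = tr n b * (\<rho> * (A u + G u) / 2)" .
    have "linearized_form n b f h \<rho> u = q - (\<Sum>i<n. tr n b / n * (\<rho> * ((f (u i))\<^sup>2 + (h (u i))\<^sup>2) / 2 - \<rho>)) / sqrt n"
      unfolding linearized_form_def quad_stat_def q_def centered_form_def
      by (simp add: diff_divide_distrib[symmetric] add_diff_eq)
    then have lf: "linearized_form n b f h \<rho> u = q - \<rho> * \<tau> * ((A u + G u) / 2)"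
      unfolding X \<tau>_def by (simp add: mult_ac)
    have "normalized_form n b f h \<rho> u - linearized_form n b f h \<rho> u = q * (1 / D - 1) + \<rho> * \<tau> * (1 / D - 1 + (A u + G u) / 2)"
      unfolding nf lf by (simp add: right_diff_distrib distrib_left)
    then have "\<bar>normalized_form n b f h \<rho> u - linearized_form n b f h \<rho> u\<bar> \<le> \<bar>q\<bar> * \<bar>1 / D - 1\<bar> + \<bar>\<rho>\<bar> * \<bar>\<tau>\<bar> * \<bar>1 / D - 1 + (A u + G u) / 2\<bar>"
      using abs_triangle_ineq[of "q * (1 / D - 1)" "\<rho> * \<tau> * (1 / D - 1 + (A u + G u) / 2)"] by (simp add: abs_mult)
    also have "\<dots> \<le> \<bar>q\<bar> * (4 * \<kappa>) + \<bar>\<rho>\<bar> * (\<beta> * sqrt n) * (9 * ((A u)\<^sup>2 + (G u)\<^sup>2))"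
    proof (intro add_mono mult_left_mono mult_mono)
      show "\<bar>1 / D - 1\<bar> \<le> 4 * \<kappa>" by (rule order_trans[OF ex(1)]) (use True in simp)
      have "\<bar>\<tau>\<bar> = \<bar>tr n b / n\<bar> * sqrt n" unfolding \<tau>_def using n sn by (simp add: abs_mult field_simps)
      also have "\<dots> \<le> \<beta> * sqrt n" using mean_diagonal_le[OF b] by (intro mult_right_mono) auto
      finally show "\<bar>\<tau>\<bar> \<le> \<beta> * sqrt n" .
    qed (use ex(2) \<beta> in auto)
    also have "\<dots> = 4 * \<kappa> * \<bar>q\<bar> + 9 * \<beta> * sqrt n * (\<bar>\<rho>\<bar> * ((A u)\<^sup>2 + (G u)\<^sup>2))" by (simp add: mult_ac)
    finally have "\<bar>normalized_form n b f h \<rho> u - linearized_form n b f h \<rho> u\<bar> \<le> 4 * \<kappa> * \<bar>q\<bar> + 9 * \<beta> * sqrt n * (\<bar>\<rho>\<bar> * ((A u)\<^sup>2 + (G u)\<^sup>2))" .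
    moreover have "0 \<le> (\<bar>A u\<bar> + \<bar>G u\<bar>) / \<kappa>" using \<kappa> by simp
    ultimately show ?thesis unfolding q_def by linarith
  qed
qed

lemma sample_square_centered:
  "0 < n \<Longrightarrow> sample_square n f u - 1 = (\<Sum>i<n. (f (u i))\<^sup>2 - 1) / n"
  unfolding sample_square_def by (simp add: sum_subtractf diff_divide_distrib)

lemma sample_square_measurable:
  assumes "f \<in> borel_measurable P"
  shows "sample_square n f \<in> borel_measurable (samples P n)"
  unfolding sample_square_def[abs_def] using assms
  by (intro borel_measurable_divide borel_measurable_sum borel_measurable_power borel_measurable_const
      measurable_compose[OF measurable_component_singleton, of _ "{..<n}" "\<lambda>_. P"]) auto

lemma sqrt_sample_square_measurable:
  assumes "f \<in> borel_measurable P"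
  shows "(\<lambda>u. sqrt (sample_square n f u)) \<in> borel_measurable (samples P n)"
  using measurable_compose[OF sample_square_measurable[OF assms] borel_measurable_sqrt] .

lemma normalized_form_measurable:
  assumes "f \<in> borel_measurable P" "h \<in> borel_measurable P"
  shows "normalized_form n b f h \<rho> \<in> borel_measurable (samples P n)"
  unfolding normalized_form_def[abs_def] using assms
  by (intro borel_measurable_divide borel_measurable_diff borel_measurable_sum borel_measurable_times borel_measurable_const
      sqrt_sample_square_measurable
      measurable_compose[OF measurable_component_singleton, of _ "{..<n}" "\<lambda>_. P"]) auto

lemma linearized_form_measurable:
  assumes "f \<in> borel_measurable P" "h \<in> borel_measurable P"
  shows "linearized_form n b f h \<rho> \<in> borel_measurable (samples P n)"
  unfolding linearized_form_def using assms by (intro quad_stat_measurable) auto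

text \<open>The three error terms: \<open>A\<close> and \<open>G\<close> tend to 0 in \<open>L\<^sup>1\<close> by the law of large numbers; the centred
form is bounded in \<open>L\<^sup>1\<close>, and its factor \<open>\<kappa>\<close> is chosen small beforehand; and
\<open>sqrt n * (A\<^sup>2 + G\<^sup>2)\<close> has expectation of order \<open>1 / sqrt n\<close> by fourth moments, which enter for
correlated components (\<open>\<rho> \<noteq> 0\<close>).\<close>

lemma normalization_negligible:
  fixes f h :: "'e \<Rightarrow> real"
  assumes P: "prob_space P" and \<beta>: "0 \<le> \<beta>" and \<delta>: "0 < (\<delta>::real)"
    and f: "square_integrable P f" "integral\<^sup>L P f = 0" "(\<integral>x. (f x)\<^sup>2 \<partial>P) = 1"
    and h: "square_integrable P h" "integral\<^sup>L P h = 0" "(\<integral>x. (h x)\<^sup>2 \<partial>P) = 1"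
    and fh: "square_integrable P (\<lambda>x. f x * h x)" and \<rho>: "\<rho> = (\<integral>x. f x * h x \<partial>P)"
    and f2: "\<rho> \<noteq> 0 \<Longrightarrow> square_integrable P (\<lambda>x. (f x)\<^sup>2)" and h2: "\<rho> \<noteq> 0 \<Longrightarrow> square_integrable P (\<lambda>x. (h x)\<^sup>2)"
  shows "\<forall>\<^sub>F n in sequentially. \<forall>b. op_bounded n \<beta> b \<longrightarrow>
     (\<integral>u. min 1 \<bar>normalized_form n b f h \<rho> u - linearized_form n b f h \<rho> u\<bar> \<partial>samples P n) < \<delta>"
proof -
  interpret P: prob_space P by (rule P)
  note int = square_integrable_integrable[OF P.finite_measure_axioms]
  let ?\<zeta> = "\<lambda>x. f x * h x - \<rho>"
  have \<zeta>: "square_integrable P ?\<zeta>" by (intro square_integrable_diff fh square_integrable_const P)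
  have m\<zeta>: "integral\<^sup>L P ?\<zeta> = 0" using int[OF fh] by (simp add: \<rho> P.prob_space)
  define C1 where "C1 = 2 * \<beta> * L2norm P f * L2norm P h + \<beta> * L2norm P ?\<zeta>"
  have C1: "0 \<le> C1" unfolding C1_def using \<beta> by (simp add: L2norm_nonneg)
  \<comment> \<open>makes the contribution of the centred form, 4 \<kappa> C1, at most \<delta> / 3\<close>
  define \<kappa> where "\<kappa> = min (1/4) (\<delta> / (12 * (C1 + 1)))"
  have \<kappa>: "0 < \<kappa>" "\<kappa> \<le> 1/4" "4 * \<kappa> * C1 \<le> \<delta> / 3"
  proof -
    show "0 < \<kappa>" using \<delta> C1 by (simp add: \<kappa>_def)
    show "\<kappa> \<le> 1/4" unfolding \<kappa>_def by (rule min.cobounded1)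
    have "\<kappa> \<le> \<delta> / (12 * (C1 + 1))" by (simp add: \<kappa>_def)
    then have "\<kappa> * (12 * (C1 + 1)) \<le> \<delta>" using C1 by (simp add: le_divide_eq)
    moreover have "0 \<le> \<kappa>" using \<open>0 < \<kappa>\<close> by simp
    ultimately show "4 * \<kappa> * C1 \<le> \<delta> / 3" by (simp add: algebra_simps)
  qed
  define V where "V g = (\<integral>x. ((g x)\<^sup>2 - 1)\<^sup>2 \<partial>P)" for g :: "'e \<Rightarrow> real"
  let ?a = "\<lambda>g n. \<integral>u. \<bar>(\<Sum>i<n. (g (u i))\<^sup>2 - 1) / n\<bar> \<partial>samples P n"
  have wl: "?a f \<longlonglongrightarrow> 0" "?a h \<longlonglongrightarrow> 0"
    using weak_law_L1[OF P, of "\<lambda>x. (f x)\<^sup>2 - 1"] weak_law_L1[OF P, of "\<lambda>x. (h x)\<^sup>2 - 1"]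
      square_integrable_power2[OF f(1)] square_integrable_power2[OF h(1)] f(3) h(3) by (simp_all add: P.prob_space)
  have key: "(\<integral>u. min 1 \<bar>normalized_form n b f h \<rho> u - linearized_form n b f h \<rho> u\<bar> \<partial>samples P n)
      \<le> (?a f n + ?a h n) / \<kappa> + 4 * \<kappa> * C1 + 9 * \<beta> * (\<bar>\<rho>\<bar> * (V f + V h)) / sqrt n" if n: "0 < n" and b: "op_bounded n \<beta> b" for n b
  proof -
    interpret S: prob_space "samples P n" by (rule prob_space_samples[OF P])
    let ?S = "samples P n"
    define A where "A g u = sample_square n g u - 1" for g :: "'e \<Rightarrow> real" and u
    have Aeq: "A g = (\<lambda>u. (\<Sum>i<n. (g (u i))\<^sup>2 - 1) / n)" for g
      unfolding A_def using sample_square_centered[OF n] by auto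
    have iA: "integrable ?S (A g)" if "square_integrable P g" for g
    proof -
      have "integrable P (\<lambda>x. (g x)\<^sup>2 - 1)" using square_integrable_power2[OF that] by simp
      then have "integrable ?S (\<lambda>u. (g (u i))\<^sup>2 - 1)" if "i < n" for i
        using samples_component_integral(1)[OF P that, of "\<lambda>x. (g x)\<^sup>2 - 1"] by (auto dest: borel_measurable_integrable)
      then show ?thesis unfolding Aeq by (intro integrable_divide_zero Bochner_Integration.integrable_sum) auto
    qed
    have A2: "integrable ?S (\<lambda>u. \<bar>\<rho>\<bar> * (A g u)\<^sup>2)" "(\<integral>u. \<bar>\<rho>\<bar> * (A g u)\<^sup>2 \<partial>?S) = \<bar>\<rho>\<bar> * V g / n"
      if g: "\<rho> \<noteq> 0 \<longrightarrow> square_integrable P (\<lambda>x. (g x)\<^sup>2)" "(\<integral>x. (g x)\<^sup>2 \<partial>P) = 1" for g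
    proof -
      have "integrable ?S (\<lambda>u. (A g u)\<^sup>2) \<and> (\<integral>u. (A g u)\<^sup>2 \<partial>?S) = V g / n" if r: "\<rho> \<noteq> 0"
      proof -
        have s: "square_integrable P (\<lambda>x. (g x)\<^sup>2 - 1)"
          by (intro square_integrable_diff g(1)[rule_format] r square_integrable_const P)
        have z: "(\<integral>x. (g x)\<^sup>2 - 1 \<partial>P) = 0" using int[OF g(1)[rule_format, OF r]] g(2) by (simp add: P.prob_space)
        have e: "A g u = (\<Sum>i<n. 1 / n * ((g (u i))\<^sup>2 - 1))" for u
          unfolding Aeq by (simp add: sum_divide_distrib)
        have "(\<Sum>i<n. (1 / real n)\<^sup>2) = 1 / n" using n by (simp add: power2_eq_square)
        then show ?thesis
          using weighted_sum_L2[OF P s z, of "{..<n}" n "\<lambda>_. 1 / real n"]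
          unfolding e[symmetric] V_def by (simp add: square_integrable_def)
      qed
      then show "integrable ?S (\<lambda>u. \<bar>\<rho>\<bar> * (A g u)\<^sup>2)" "(\<integral>u. \<bar>\<rho>\<bar> * (A g u)\<^sup>2 \<partial>?S) = \<bar>\<rho>\<bar> * V g / n"
        by (cases "\<rho> = 0"; simp)+
    qed
    have f2': "\<rho> \<noteq> 0 \<longrightarrow> square_integrable P (\<lambda>x. (f x)\<^sup>2)" and h2': "\<rho> \<noteq> 0 \<longrightarrow> square_integrable P (\<lambda>x. (h x)\<^sup>2)"
      using f2 h2 by blast+
    note Af = A2[OF f2' f(3)] and Ah = A2[OF h2' h(3)]
    have q: "integrable ?S (centered_form n b f h \<rho>)" "(\<integral>u. \<bar>centered_form n b f h \<rho> u\<bar> \<partial>?S) \<le> C1"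
    proof -
      let ?Q = "\<lambda>u. \<Sum>i<n. \<Sum>j<n. off_diagonal b i j * (f (u i) * h (u j))" and ?W = "\<lambda>u. \<Sum>i<n. b i i * ?\<zeta> (u i)"
      note Q = quadratic_form_L1[OF P b f(1,2) h(1,2)]
      have W: "integrable ?S ?W" "(\<integral>u. \<bar>?W u\<bar> \<partial>?S) \<le> \<beta> * L2norm P ?\<zeta> * sqrt n"
        using weighted_sum_L1[OF P \<zeta> m\<zeta>, of n "\<lambda>i. b i i" \<beta>] op_bounded_entry[OF b] \<beta> by auto
      show "integrable ?S (centered_form n b f h \<rho>)"
        unfolding centered_form_def[abs_def] using Q(1) W(1) by simp
      have "(\<integral>u. \<bar>centered_form n b f h \<rho> u\<bar> \<partial>?S) \<le> (\<integral>u. (\<bar>?Q u\<bar> + \<bar>?W u\<bar>) / sqrt n \<partial>?S)"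
        unfolding centered_form_def using Q(1) W(1)
        by (intro integral_mono) (auto intro!: divide_right_mono)
      also have "\<dots> = ((\<integral>u. \<bar>?Q u\<bar> \<partial>?S) + (\<integral>u. \<bar>?W u\<bar> \<partial>?S)) / sqrt n" using Q(1) W(1) by simp
      also have "\<dots> \<le> (2 * \<beta> * L2norm P f * L2norm P h * sqrt n + \<beta> * L2norm P ?\<zeta> * sqrt n) / sqrt n"
        by (intro divide_right_mono add_mono Q(2) W(2)) simp
      also have "\<dots> = C1" unfolding C1_def using n by (simp add: add_divide_distrib)
      finally show "(\<integral>u. \<bar>centered_form n b f h \<rho> u\<bar> \<partial>?S) \<le> C1" .
    qed
    let ?B = "\<lambda>u. (\<bar>A f u\<bar> + \<bar>A h u\<bar>) / \<kappa> + 4 * \<kappa> * \<bar>centered_form n b f h \<rho> u\<bar> + 9 * \<beta> * sqrt n * (\<bar>\<rho>\<bar> * (A f u)\<^sup>2 + \<bar>\<rho>\<bar> * (A h u)\<^sup>2)"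
    have "(\<integral>u. min 1 \<bar>normalized_form n b f h \<rho> u - linearized_form n b f h \<rho> u\<bar> \<partial>?S) \<le> (\<integral>u. ?B u \<partial>?S)"
    proof (rule integral_mono)
      have "normalized_form n b f h \<rho> \<in> borel_measurable ?S" "linearized_form n b f h \<rho> \<in> borel_measurable ?S"
        by (intro normalized_form_measurable linearized_form_measurable square_integrable_measurable[OF f(1)]
            square_integrable_measurable[OF h(1)])+
      then show "integrable ?S (\<lambda>u. min 1 \<bar>normalized_form n b f h \<rho> u - linearized_form n b f h \<rho> u\<bar>)"
        by (intro S.integrable_const_bound[where B = 1]) auto
      show "integrable ?S ?B" using iA[OF f(1)] iA[OF h(1)] Af(1) Ah(1) q(1) by simp
      show "min 1 \<bar>normalized_form n b f h \<rho> u - linearized_form n b f h \<rho> u\<bar> \<le> ?B u" for u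
        using normalization_error_pointwise[OF n b \<kappa>(1,2), of f h \<rho> u] unfolding A_def by (simp only: distrib_left)
    qed
    also have "\<dots> = ((\<integral>u. \<bar>A f u\<bar> \<partial>?S) + (\<integral>u. \<bar>A h u\<bar> \<partial>?S)) / \<kappa> + 4 * \<kappa> * (\<integral>u. \<bar>centered_form n b f h \<rho> u\<bar> \<partial>?S)
        + 9 * \<beta> * sqrt n * ((\<integral>u. \<bar>\<rho>\<bar> * (A f u)\<^sup>2 \<partial>?S) + (\<integral>u. \<bar>\<rho>\<bar> * (A h u)\<^sup>2 \<partial>?S))"
      using iA[OF f(1)] iA[OF h(1)] Af(1) Ah(1) q(1) by simp
    also have "\<dots> \<le> (?a f n + ?a h n) / \<kappa> + 4 * \<kappa> * C1 + 9 * \<beta> * sqrt n * (\<bar>\<rho>\<bar> * V f / n + \<bar>\<rho>\<bar> * V h / n)"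
      unfolding Af(2) Ah(2) unfolding Aeq using q(2) \<kappa> \<beta> by (intro add_mono mult_left_mono order_refl) auto
    also have "9 * \<beta> * sqrt n * (\<bar>\<rho>\<bar> * V f / n + \<bar>\<rho>\<bar> * V h / n) = 9 * \<beta> * (\<bar>\<rho>\<bar> * (V f + V h)) * (sqrt n / n)"
      by (simp add: distrib_left add_divide_distrib mult_ac)
    also have "sqrt n / n = 1 / sqrt n" using n by (simp add: real_div_sqrt field_simps)
    finally show ?thesis by simp
  qed
  have "(\<lambda>n. (?a f n + ?a h n) / \<kappa> + 9 * \<beta> * (\<bar>\<rho>\<bar> * (V f + V h)) / sqrt n) \<longlonglongrightarrow> (0 + 0) / \<kappa> + 0"
  proof (intro tendsto_add tendsto_divide wl tendsto_const)
    have "(\<lambda>n. K / sqrt (real n)) \<longlonglongrightarrow> 0" for K :: real by real_asymp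
    then show "(\<lambda>n. 9 * \<beta> * (\<bar>\<rho>\<bar> * (V f + V h)) / sqrt (real n)) \<longlonglongrightarrow> 0" .
  qed (use \<kappa> in auto)
  then have "(\<lambda>n. (?a f n + ?a h n) / \<kappa> + 9 * \<beta> * (\<bar>\<rho>\<bar> * (V f + V h)) / sqrt n) \<longlonglongrightarrow> 0" by simp
  moreover have "0 < \<delta> / 3" using \<delta> by simp
  ultimately have "\<forall>\<^sub>F n in sequentially. (?a f n + ?a h n) / \<kappa> + 9 * \<beta> * (\<bar>\<rho>\<bar> * (V f + V h)) / sqrt n < \<delta> / 3"
    by (rule order_tendstoD(2))
  then show ?thesis using eventually_gt_at_top[of 0]
  proof eventually_elim
    case (elim n)
    show ?case
    proof (intro allI impI)
      fix b assume "op_bounded n \<beta> b"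
      from key[OF elim(2) this] elim(1) \<kappa>(3) \<delta>
      show "(\<integral>u. min 1 \<bar>normalized_form n b f h \<rho> u - linearized_form n b f h \<rho> u\<bar> \<partial>samples P n) < \<delta>" by linarith
    qed
  qed
qed

section \<open>Characteristic functions of normalized forms\<close>

lemma min_one_sum_le:
  fixes a :: "'i \<Rightarrow> real"
  assumes "finite I" "\<And>i. i \<in> I \<Longrightarrow> 0 \<le> a i"
  shows "min 1 (\<Sum>i\<in>I. a i) \<le> (\<Sum>i\<in>I. min 1 (a i))"
  using assms
proof (induction I)
  case (insert i I)
  have "min 1 (a i + (\<Sum>i\<in>I. a i)) \<le> min 1 (a i) + min 1 (\<Sum>i\<in>I. a i)"
  proof -
    have "min 1 (p + q) \<le> min 1 p + min 1 q" if "0 \<le> p" "0 \<le> q" for p q :: real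
      using that by (auto simp: min_def)
    then show ?thesis using insert by (simp add: sum_nonneg)
  qed
  moreover have "min 1 (\<Sum>i\<in>I. a i) \<le> (\<Sum>i\<in>I. min 1 (a i))" using insert by auto
  ultimately show ?case using insert(1,2) by simp
qed simp

lemma min_one_scale_le:
  fixes t a :: real
  assumes "0 \<le> a"
  shows "min 1 (\<bar>t\<bar> * a) \<le> (1 + \<bar>t\<bar>) * min 1 a"
proof (cases "a \<le> 1")
  case True
  then have "min 1 (\<bar>t\<bar> * a) \<le> \<bar>t\<bar> * a" by simp
  also have "\<dots> \<le> (1 + \<bar>t\<bar>) * a" using assms by (intro mult_right_mono) auto
  finally show ?thesis using True by simp
qed simp

lemma norm_iexp_diff_le_min: "norm (iexp x - iexp y) \<le> 2 * min 1 \<bar>x - y\<bar>"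
proof -
  have "norm (iexp x - iexp y) \<le> norm (iexp x) + norm (iexp y)" by (rule norm_triangle_ineq4)
  then have "norm (iexp x - iexp y) \<le> 2" by simp
  moreover have "norm (iexp x - iexp y) \<le> \<bar>x - y\<bar>" by (rule iexp_diff_le)
  moreover have "0 \<le> \<bar>x - y\<bar>" by simp
  ultimately show ?thesis unfolding min_def by (cases "1 \<le> \<bar>x - y\<bar>") argo+
qed

text \<open>Characteristic functions are compared through \<open>min 1 \<bar>f - g\<bar>\<close>, hence through closeness in
probability: the normalized form, having random denominators, need not be close in \<open>L\<^sup>1\<close>.\<close>

lemma char_diff_le_min:
  assumes "prob_space M" "f \<in> borel_measurable M" "g \<in> borel_measurable M"
  shows "norm ((\<integral>x. iexp (f x) \<partial>M) - (\<integral>x. iexp (g x) \<partial>M)) \<le> 2 * (\<integral>x. min 1 \<bar>f x - g x\<bar> \<partial>M)"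
proof -
  interpret prob_space M by fact
  have i: "integrable M (\<lambda>x. iexp (f x))" "integrable M (\<lambda>x. iexp (g x))"
    by (intro bounded_measurable_integrable[OF assms(1)] bounded_measurable_iexp assms(2,3))+
  have m: "integrable M (\<lambda>x. min 1 \<bar>f x - g x\<bar>)"
    using assms(2,3) by (intro integrable_const_bound[where B = 1]) auto
  have "norm (\<integral>x. iexp (f x) - iexp (g x) \<partial>M) \<le> (\<integral>x. norm (iexp (f x) - iexp (g x)) \<partial>M)"
    by (rule integral_norm_bound)
  also have "\<dots> \<le> (\<integral>x. 2 * min 1 \<bar>f x - g x\<bar> \<partial>M)"
    using i m by (intro integral_mono norm_iexp_diff_le_min) auto
  finally show ?thesis using i by simp
qed

text \<open>A linear combination of the components is again a quadratic statistic, with the kernel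
\<open>\<Sum>l. t l * x l \<otimes> y l\<close>. So the joint limit law needs no multivariate argument.\<close>

lemma sum_linearized_form:
  assumes "finite L"
  shows "(\<Sum>l\<in>L. t l * linearized_form n b (x l) (y l) (\<rho> l) u) =
    quad_stat n b L (\<lambda>l v. t l * x l v) y (\<lambda>v. \<Sum>l\<in>L. t l * (x l v * y l v - \<rho> l))
      (\<lambda>v. \<Sum>l\<in>L. t l * (\<rho> l * ((x l v)\<^sup>2 + (y l v)\<^sup>2) / 2 - \<rho> l)) u"
proof -
  let ?Z = "\<lambda>l i. x l (u i) * y l (u i) - \<rho> l" and ?E = "\<lambda>l i. \<rho> l * ((x l (u i))\<^sup>2 + (y l (u i))\<^sup>2) / 2 - \<rho> l"
  let ?m = "tr n b / n"
  define Q where "Q l = (\<Sum>i<n. \<Sum>j<n. off_diagonal b i j * (x l (u i) * y l (u j)))" for l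
  have "t l * linearized_form n b (x l) (y l) (\<rho> l) u = (t l * Q l + ((\<Sum>i<n. b i i * (t l * ?Z l i)) - (\<Sum>i<n. ?m * (t l * ?E l i)))) / sqrt n" for l
    unfolding linearized_form_def quad_stat_def Q_def
    by (simp add: distrib_left right_diff_distrib sum_distrib_left mult.left_commute)
  then have "(\<Sum>l\<in>L. t l * linearized_form n b (x l) (y l) (\<rho> l) u)
     = ((\<Sum>l\<in>L. t l * Q l) + ((\<Sum>l\<in>L. \<Sum>i<n. b i i * (t l * ?Z l i)) - (\<Sum>l\<in>L. \<Sum>i<n. ?m * (t l * ?E l i)))) / sqrt n"
    by (simp only: sum_divide_distrib[symmetric] sum.distrib sum_subtractf)
  also have "(\<Sum>l\<in>L. \<Sum>i<n. b i i * (t l * ?Z l i)) = (\<Sum>i<n. b i i * (\<Sum>l\<in>L. t l * ?Z l i))"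
    unfolding sum_distrib_left by (rule sum.swap)
  also have "(\<Sum>l\<in>L. \<Sum>i<n. ?m * (t l * ?E l i)) = (\<Sum>i<n. ?m * (\<Sum>l\<in>L. t l * ?E l i))"
    unfolding sum_distrib_left by (rule sum.swap)
  also have "(\<Sum>l\<in>L. t l * Q l) = (\<Sum>l\<in>L. \<Sum>i<n. \<Sum>j<n. off_diagonal b i j * (t l * x l (u i) * y l (u j)))"
    unfolding Q_def by (simp add: sum_distrib_left mult_ac)
  finally show ?thesis unfolding quad_stat_def .
qed

theorem char_normalized_form:
  fixes x y :: "'l \<Rightarrow> 'e \<Rightarrow> real" and t :: "'l \<Rightarrow> real"
  assumes P: "prob_space P" and L: "finite L" and \<beta>: "0 \<le> \<beta>" and \<epsilon>: "0 < (\<epsilon>::real)"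
    and x: "\<And>l. l \<in> L \<Longrightarrow> square_integrable P (x l)" "\<And>l. l \<in> L \<Longrightarrow> integral\<^sup>L P (x l) = 0" "\<And>l. l \<in> L \<Longrightarrow> (\<integral>v. (x l v)\<^sup>2 \<partial>P) = 1"
    and y: "\<And>l. l \<in> L \<Longrightarrow> square_integrable P (y l)" "\<And>l. l \<in> L \<Longrightarrow> integral\<^sup>L P (y l) = 0" "\<And>l. l \<in> L \<Longrightarrow> (\<integral>v. (y l v)\<^sup>2 \<partial>P) = 1"
    and xy: "\<And>l. l \<in> L \<Longrightarrow> square_integrable P (\<lambda>v. x l v * y l v)" and \<rho>: "\<And>l. l \<in> L \<Longrightarrow> \<rho> l = (\<integral>v. x l v * y l v \<partial>P)"
    and x2: "\<And>l. l \<in> L \<Longrightarrow> \<rho> l \<noteq> 0 \<Longrightarrow> square_integrable P (\<lambda>v. (x l v)\<^sup>2)"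
    and y2: "\<And>l. l \<in> L \<Longrightarrow> \<rho> l \<noteq> 0 \<Longrightarrow> square_integrable P (\<lambda>v. (y l v)\<^sup>2)"
  defines "\<zeta> \<equiv> \<lambda>v. \<Sum>l\<in>L. t l * (x l v * y l v - \<rho> l)"
    and "\<eta> \<equiv> \<lambda>v. \<Sum>l\<in>L. t l * (\<rho> l * ((x l v)\<^sup>2 + (y l v)\<^sup>2) / 2 - \<rho> l)"
  shows "\<forall>\<^sub>F n in sequentially. \<forall>b. op_bounded n \<beta> b \<longrightarrow>
     norm ((\<integral>u. iexp (\<Sum>l\<in>L. t l * normalized_form n b (x l) (y l) (\<rho> l) u) \<partial>samples P n)
       - complex_of_real (exp (- quad_var n b (kernel_variance P L (\<lambda>l v. t l * x l v) y) (moment P \<zeta> \<zeta>) (moment P \<eta> \<eta> - 2 * moment P \<zeta> \<eta>) / 2))) < \<epsilon>"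
proof -
  interpret P: prob_space P by (rule P)
  note int = square_integrable_integrable[OF P.finite_measure_axioms]
  have z: "square_integrable P (\<lambda>v. x l v * y l v - \<rho> l)" "(\<integral>v. x l v * y l v - \<rho> l \<partial>P) = 0" if l: "l \<in> L" for l
  proof -
    show "square_integrable P (\<lambda>v. x l v * y l v - \<rho> l)" by (intro square_integrable_diff xy[OF l] square_integrable_const P)
    show "(\<integral>v. x l v * y l v - \<rho> l \<partial>P) = 0" using int[OF xy[OF l]] \<rho>[OF l] by (simp add: P.prob_space)
  qed
  have w: "square_integrable P (\<lambda>v. \<rho> l * ((x l v)\<^sup>2 + (y l v)\<^sup>2) / 2 - \<rho> l)" "(\<integral>v. \<rho> l * ((x l v)\<^sup>2 + (y l v)\<^sup>2) / 2 - \<rho> l \<partial>P) = 0" if l: "l \<in> L" for l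
  proof -
    have "square_integrable P (\<lambda>v. \<rho> l / 2 * ((x l v)\<^sup>2 + (y l v)\<^sup>2) - \<rho> l)"
    proof (cases "\<rho> l = 0")
      case False
      then show ?thesis
        by (intro square_integrable_diff square_integrable_cmult square_integrable_add x2[OF l] y2[OF l] square_integrable_const P)
    qed (simp add: square_integrable_zero)
    then show "square_integrable P (\<lambda>v. \<rho> l * ((x l v)\<^sup>2 + (y l v)\<^sup>2) / 2 - \<rho> l)" by simp
    show "(\<integral>v. \<rho> l * ((x l v)\<^sup>2 + (y l v)\<^sup>2) / 2 - \<rho> l \<partial>P) = 0"
      using square_integrable_power2[OF x(1)[OF l]] square_integrable_power2[OF y(1)[OF l]] x(3)[OF l] y(3)[OF l]
      by (simp add: P.prob_space)
  qed
  have \<zeta>: "square_integrable P \<zeta>" "integral\<^sup>L P \<zeta> = 0"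
    unfolding \<zeta>_def using z int[OF z(1)]
    by (auto intro!: square_integrable_sum square_integrable_cmult simp: Bochner_Integration.integral_sum simp del: Bochner_Integration.integral_diff)
  have \<eta>: "square_integrable P \<eta>" "integral\<^sup>L P \<eta> = 0"
    unfolding \<eta>_def using w int[OF w(1)]
    by (auto intro!: square_integrable_sum square_integrable_cmult simp: Bochner_Integration.integral_sum simp del: Bochner_Integration.integral_diff)
  have tx: "square_integrable P (\<lambda>v. t l * x l v)" "(\<integral>v. t l * x l v \<partial>P) = 0" if "l \<in> L" for l
    using square_integrable_cmult[OF x(1)[OF that]] x(2)[OF that] by auto
  have main: "\<forall>\<^sub>F n in sequentially. \<forall>b. op_bounded n \<beta> b \<longrightarrow>
     norm ((\<integral>u. iexp (quad_stat n b L (\<lambda>l v. t l * x l v) y \<zeta> \<eta> u) \<partial>samples P n)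
       - complex_of_real (exp (- quad_var n b (kernel_variance P L (\<lambda>l v. t l * x l v) y) (moment P \<zeta> \<zeta>) (moment P \<eta> \<eta> - 2 * moment P \<zeta> \<eta>) / 2))) < \<epsilon> / 2"
    by (rule char_quad_stat[OF P L \<beta> _ tx y(1,2) \<zeta> \<eta>]) (use \<epsilon> in simp)
  \<comment> \<open>such that normalization errors of \<epsilon> / c in each component cost at most \<epsilon> / 2 altogether\<close>
  define c where "c = 4 * (1 + (\<Sum>l\<in>L. 1 + \<bar>t l\<bar>))"
  have c: "0 < c" "(\<Sum>l\<in>L. 1 + \<bar>t l\<bar>) \<le> c / 4" unfolding c_def by (auto intro!: add_pos_nonneg sum_nonneg)
  define \<delta> where "\<delta> = \<epsilon> / c"
  have \<delta>: "0 < \<delta>" unfolding \<delta>_def using \<epsilon> c by simp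
  have neg: "\<forall>\<^sub>F n in sequentially. \<forall>l\<in>L. \<forall>b. op_bounded n \<beta> b \<longrightarrow>
     (\<integral>u. min 1 \<bar>normalized_form n b (x l) (y l) (\<rho> l) u - linearized_form n b (x l) (y l) (\<rho> l) u\<bar> \<partial>samples P n) < \<delta>"
    unfolding eventually_ball_finite_distrib[OF L]
    by (intro ballI normalization_negligible[OF P \<beta> \<delta>] x y xy \<rho> x2 y2)
  from main neg show ?thesis
  proof eventually_elim
    case (elim n)
    interpret S: prob_space "samples P n" by (rule prob_space_samples[OF P])
    let ?S = "samples P n"
    show ?case
    proof (intro allI impI)
      fix b assume b: "op_bounded n \<beta> b"
      let ?N = "\<lambda>l. normalized_form n b (x l) (y l) (\<rho> l)" and ?\<Lambda> = "\<lambda>l. linearized_form n b (x l) (y l) (\<rho> l)"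
      let ?q = "quad_stat n b L (\<lambda>l v. t l * x l v) y \<zeta> \<eta>"
      let ?e = "complex_of_real (exp (- quad_var n b (kernel_variance P L (\<lambda>l v. t l * x l v) y) (moment P \<zeta> \<zeta>) (moment P \<eta> \<eta> - 2 * moment P \<zeta> \<eta>) / 2))"
      have q: "?q u = (\<Sum>l\<in>L. t l * ?\<Lambda> l u)" for u
        unfolding \<zeta>_def \<eta>_def by (rule sum_linearized_form[OF L, symmetric])
      have mN: "?N l \<in> borel_measurable ?S" and m\<Lambda>: "?\<Lambda> l \<in> borel_measurable ?S" if "l \<in> L" for l
        by (intro normalized_form_measurable linearized_form_measurable square_integrable_measurable[OF x(1)[OF that]]
            square_integrable_measurable[OF y(1)[OF that]])+
      have im: "integrable ?S (\<lambda>u. min 1 \<bar>?N l u - ?\<Lambda> l u\<bar>)" if "l \<in> L" for l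
        using mN[OF that] m\<Lambda>[OF that] by (intro S.integrable_const_bound[where B = 1]) auto
      have mNs: "(\<lambda>u. \<Sum>l\<in>L. t l * ?N l u) \<in> borel_measurable ?S"
        by (intro borel_measurable_sum borel_measurable_times borel_measurable_const mN)
      have mqs: "?q \<in> borel_measurable ?S"
        unfolding q by (intro borel_measurable_sum borel_measurable_times borel_measurable_const m\<Lambda>)
      have pt: "min 1 \<bar>(\<Sum>l\<in>L. t l * ?N l u) - ?q u\<bar> \<le> (\<Sum>l\<in>L. (1 + \<bar>t l\<bar>) * min 1 \<bar>?N l u - ?\<Lambda> l u\<bar>)" for u
      proof -
        have "\<bar>(\<Sum>l\<in>L. t l * ?N l u) - ?q u\<bar> = \<bar>\<Sum>l\<in>L. t l * (?N l u - ?\<Lambda> l u)\<bar>"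
          unfolding q by (simp add: sum_subtractf[symmetric] right_diff_distrib)
        also have "\<dots> \<le> (\<Sum>l\<in>L. \<bar>t l\<bar> * \<bar>?N l u - ?\<Lambda> l u\<bar>)" by (rule order_trans[OF sum_abs]) (simp add: abs_mult)
        finally have "min 1 \<bar>(\<Sum>l\<in>L. t l * ?N l u) - ?q u\<bar> \<le> min 1 (\<Sum>l\<in>L. \<bar>t l\<bar> * \<bar>?N l u - ?\<Lambda> l u\<bar>)" by (auto simp: min_def)
        also have "\<dots> \<le> (\<Sum>l\<in>L. min 1 (\<bar>t l\<bar> * \<bar>?N l u - ?\<Lambda> l u\<bar>))" by (rule min_one_sum_le[OF L]) simp
        also have "\<dots> \<le> (\<Sum>l\<in>L. (1 + \<bar>t l\<bar>) * min 1 \<bar>?N l u - ?\<Lambda> l u\<bar>)" by (intro sum_mono min_one_scale_le) simp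
        finally show ?thesis .
      qed
      have "(\<integral>u. min 1 \<bar>(\<Sum>l\<in>L. t l * ?N l u) - ?q u\<bar> \<partial>?S) \<le> (\<integral>u. (\<Sum>l\<in>L. (1 + \<bar>t l\<bar>) * min 1 \<bar>?N l u - ?\<Lambda> l u\<bar>) \<partial>?S)"
      proof (rule integral_mono[OF _ _ pt])
        show "integrable ?S (\<lambda>u. min 1 \<bar>(\<Sum>l\<in>L. t l * ?N l u) - ?q u\<bar>)"
          using mNs mqs by (intro S.integrable_const_bound[where B = 1]) auto
        show "integrable ?S (\<lambda>u. \<Sum>l\<in>L. (1 + \<bar>t l\<bar>) * min 1 \<bar>?N l u - ?\<Lambda> l u\<bar>)"
          using im by (intro Bochner_Integration.integrable_sum integrable_mult_right)
      qed
      also have "\<dots> = (\<Sum>l\<in>L. (1 + \<bar>t l\<bar>) * (\<integral>u. min 1 \<bar>?N l u - ?\<Lambda> l u\<bar> \<partial>?S))"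
        using im by (subst Bochner_Integration.integral_sum) auto
      also have "\<dots> \<le> (\<Sum>l\<in>L. (1 + \<bar>t l\<bar>) * \<delta>)"
        using elim(2) b by (intro sum_mono mult_left_mono) (auto intro: less_imp_le)
      also have "\<dots> = (\<Sum>l\<in>L. 1 + \<bar>t l\<bar>) * \<delta>" by (simp add: sum_distrib_right)
      also have "\<dots> \<le> c / 4 * \<delta>" using c(2) \<delta> by (intro mult_right_mono) auto
      also have "\<dots> = \<epsilon> / 4" unfolding \<delta>_def using c(1) by simp
      finally have "2 * (\<integral>u. min 1 \<bar>(\<Sum>l\<in>L. t l * ?N l u) - ?q u\<bar> \<partial>?S) \<le> \<epsilon> / 2" by simp
      then have 1: "norm ((\<integral>u. iexp (\<Sum>l\<in>L. t l * ?N l u) \<partial>?S) - (\<integral>u. iexp (?q u) \<partial>?S)) \<le> \<epsilon> / 2"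
        by (rule order_trans[OF char_diff_le_min[OF S.prob_space_axioms mNs mqs]])
      have 2: "norm ((\<integral>u. iexp (?q u) \<partial>?S) - ?e) < \<epsilon> / 2" using elim(1) b by blast
      have "norm ((\<integral>u. iexp (\<Sum>l\<in>L. t l * ?N l u) \<partial>?S) - ?e)
          \<le> norm ((\<integral>u. iexp (\<Sum>l\<in>L. t l * ?N l u) \<partial>?S) - (\<integral>u. iexp (?q u) \<partial>?S)) + norm ((\<integral>u. iexp (?q u) \<partial>?S) - ?e)"
        using norm_triangle_ineq[of "(\<integral>u. iexp (\<Sum>l\<in>L. t l * ?N l u) \<partial>?S) - (\<integral>u. iexp (?q u) \<partial>?S)" "(\<integral>u. iexp (?q u) \<partial>?S) - ?e"] by simp
      with 1 2 show "norm ((\<integral>u. iexp (\<Sum>l\<in>L. t l * ?N l u) \<partial>?S) - ?e) < \<epsilon>" by linarith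
    qed
  qed
qed

section \<open>The continuity theorem in Euclidean space\<close>

text \<open>Finite combinations of characters: the functions whose expectations are determined by the
characteristic function, closed under products.\<close>

inductive trig_poly :: "('b::euclidean_space \<Rightarrow> complex) \<Rightarrow> bool" where
  monomial: "trig_poly (\<lambda>v. c * iexp (t \<bullet> v))"
| add: "trig_poly f \<Longrightarrow> trig_poly g \<Longrightarrow> trig_poly (\<lambda>v. f v + g v)"

lemma trig_poly_mult:
  assumes "trig_poly f" "trig_poly g"
  shows "trig_poly (\<lambda>v. f v * g v)"
  using assms(1)
proof induction
  case (monomial c t)
  show ?case using assms(2)
  proof induction
    case (monomial c' t')
    have "(\<lambda>v. c * iexp (t \<bullet> v) * (c' * iexp (t' \<bullet> v))) = (\<lambda>v. (c * c') * iexp ((t + t') \<bullet> v))"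
      by (simp add: inner_add_left distrib_left exp_add mult_ac)
    then show ?case by (simp only: trig_poly.monomial)
  next
    case (add f g)
    then show ?case by (simp only: distrib_left trig_poly.add)
  qed
next
  case (add f g)
  then show ?case by (simp only: distrib_right trig_poly.add)
qed

lemma trig_poly_const: "trig_poly (\<lambda>v. c)"
  using trig_poly.monomial[of c 0] by simp

lemma trig_poly_sum: "(\<And>i. i \<in> I \<Longrightarrow> trig_poly (f i)) \<Longrightarrow> trig_poly (\<lambda>v. \<Sum>i\<in>I. f i v)"
  by (induction I rule: infinite_finite_induct) (auto intro: trig_poly_const trig_poly.add)

lemma trig_poly_sin: "trig_poly (\<lambda>v. complex_of_real (sin (t \<bullet> v)))"
proof -
  have "complex_of_real (sin (t \<bullet> v)) = 1 / (2 * \<i>) * iexp (t \<bullet> v) + (- 1 / (2 * \<i>)) * iexp ((- t) \<bullet> v)" for v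
    by (simp add: sin_of_real[symmetric] sin_exp_eq diff_divide_distrib exp_minus algebra_simps)
  then show ?thesis by (simp only: trig_poly.intros)
qed

lemma trig_poly_polynomial:
  fixes p :: "'b::euclidean_space \<Rightarrow> real"
  assumes "real_polynomial_function p"
  shows "trig_poly (\<lambda>v. complex_of_real (p (\<Sum>i\<in>Basis. sin ((c *\<^sub>R i) \<bullet> v) *\<^sub>R i)))"
  using assms
proof induction
  case (linear f)
  interpret bounded_linear f by fact
  have "complex_of_real (f (\<Sum>i\<in>Basis. sin ((c *\<^sub>R i) \<bullet> v) *\<^sub>R i)) = (\<Sum>i\<in>Basis. complex_of_real (sin ((c *\<^sub>R i) \<bullet> v)) * complex_of_real (f i))" for v
    by (simp add: sum scaleR del: inner_scaleR_left)
  then show ?case by (simp only: trig_poly_sum trig_poly_mult trig_poly_sin trig_poly_const)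
next
  case (const c)
  then show ?case by (rule trig_poly_const)
next
  case (add f g)
  then show ?case by (simp only: of_real_add trig_poly.add)
next
  case (mult f g)
  then show ?case by (simp only: of_real_mult trig_poly_mult)
qed

lemma iexp_inner_measurable: "(\<lambda>v::'b::euclidean_space. iexp (t \<bullet> v)) \<in> borel_measurable borel"
  by (intro borel_measurable_continuous_onI continuous_intros)

lemma trig_poly_bounded_measurable:
  assumes "trig_poly (f :: 'b::euclidean_space \<Rightarrow> complex)"
  shows "f \<in> borel_measurable borel \<and> (\<exists>C. \<forall>v. norm (f v) \<le> C)"
  using assms
proof induction
  case (monomial c t)
  then show ?case using iexp_inner_measurable[of t] by (auto simp: norm_mult intro!: exI[of _ "norm c"])
next
  case (add f g)
  then obtain C C' where "\<And>v. norm (f v) \<le> C" "\<And>v. norm (g v) \<le> C'" by auto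
  then have "norm (f v + g v) \<le> C + C'" for v by (rule norm_triangle_mono)
  then show ?case using add by auto
qed

lemma trig_poly_convergence:
  fixes U :: "nat \<Rightarrow> 'a \<Rightarrow> 'b::euclidean_space"
  assumes M: "prob_space M" and U: "\<And>n. U n \<in> borel_measurable M"
    and N: "prob_space N" "sets N = sets borel"
    and conv: "\<And>t. (\<lambda>n. \<integral>s. iexp (t \<bullet> U n s) \<partial>M) \<longlonglongrightarrow> (\<integral>v. iexp (t \<bullet> v) \<partial>N)"
    and f: "trig_poly f"
  shows "(\<lambda>n. \<integral>s. f (U n s) \<partial>M) \<longlonglongrightarrow> (\<integral>v. f v \<partial>N)"
  using f
proof induction
  case (monomial c t)
  then show ?case by (simp add: tendsto_mult[OF tendsto_const conv])
next
  case (add f g)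
  have int: "integrable M (\<lambda>s. h (U n s))" "integrable N h" if h: "trig_poly h" for h n
  proof -
    obtain C where C: "\<And>v. norm (h v) \<le> C" and hm: "h \<in> borel_measurable borel"
      using trig_poly_bounded_measurable[OF h] by auto
    show "integrable M (\<lambda>s. h (U n s))"
      using C measurable_compose[OF U hm] by (intro finite_measure.integrable_const_bound[OF prob_space.axioms(1)[OF M]]) auto
    have "h \<in> borel_measurable N" using hm measurable_cong_sets[OF N(2) refl] by blast
    then show "integrable N h"
      using C by (intro finite_measure.integrable_const_bound[OF prob_space.axioms(1)[OF N(1)]]) auto
  qed
  show ?case using tendsto_add[OF add.IH] int[OF add.hyps(1)] int[OF add.hyps(2)] by simp
qed

text \<open>A continuous substitute for the indicator of \<open>\<bar>x\<bar> > R\<close>.\<close>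

definition tail_cutoff :: "real \<Rightarrow> real \<Rightarrow> real" where
  "tail_cutoff R x = min 1 (max 0 (\<bar>x\<bar> - R))"

lemma tail_cutoff_bounds: "0 \<le> tail_cutoff R x" "tail_cutoff R x \<le> 1" "\<bar>tail_cutoff R x\<bar> \<le> 1"
  by (auto simp: tail_cutoff_def)

lemma tail_cutoff_eq_1: "R + 1 \<le> \<bar>x\<bar> \<Longrightarrow> tail_cutoff R x = 1"
  by (auto simp: tail_cutoff_def)

lemma tail_cutoff_continuous: "continuous_on UNIV (tail_cutoff R)"
  unfolding tail_cutoff_def[abs_def] by (intro continuous_intros)

lemma tail_cutoff_measurable: "tail_cutoff R \<in> borel_measurable borel"
  by (rule borel_measurable_continuous_onI[OF tail_cutoff_continuous])

text \<open>On a large box, a continuous function of \<open>v\<close> is a continuous function of the numbers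
\<open>sin (c (i \<bullet> v))\<close>, for \<open>c\<close> so small that the sine is injective there. Stone--Weierstrass replaces it by a
polynomial in these sines, which is a trigonometric polynomial bounded on the whole space, and
whose expectations therefore converge. The mass outside the box is small for all large \<open>n\<close>, as the
coordinates converge in distribution by the one-dimensional theorem.\<close>

theorem levy_continuity_euclidean:
  fixes U :: "nat \<Rightarrow> 'a \<Rightarrow> 'b::euclidean_space"
  assumes M: "prob_space M" and U: "\<And>n. U n \<in> borel_measurable M"
    and N: "prob_space N" "sets N = sets borel"
    and conv: "\<And>t. (\<lambda>n. \<integral>s. iexp (t \<bullet> U n s) \<partial>M) \<longlonglongrightarrow> (\<integral>v. iexp (t \<bullet> v) \<partial>N)"
  shows "converges_in_distribution M U N"
  unfolding converges_in_distribution_def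
proof (intro conjI allI impI U N)
  fix f :: "'b \<Rightarrow> real" assume fc: "continuous_on UNIV f" and fb: "bounded (range f)"
  interpret M: prob_space M by (rule M)
  interpret N: prob_space N by (rule N)
  have mN: "h \<in> borel_measurable N" if "h \<in> borel_measurable borel" for h :: "'b \<Rightarrow> real"
    using that measurable_cong_sets[OF N(2) refl] by blast
  obtain C where C: "\<And>v. \<bar>f v\<bar> \<le> C" using fb unfolding bounded_iff by auto
  have C0: "0 \<le> C" using C[of 0] by linarith
  have fm: "f \<in> borel_measurable borel" by (rule borel_measurable_continuous_onI[OF fc])
  have tails: "(\<lambda>n. \<integral>s. tail_cutoff R (i \<bullet> U n s) \<partial>M) \<longlonglongrightarrow> (\<integral>v. tail_cutoff R (i \<bullet> v) \<partial>N)" for R i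
  proof -
    have Um: "(\<lambda>s. i \<bullet> U n s) \<in> borel_measurable M" for n using U by measurable
    have im: "(\<lambda>v. i \<bullet> v) \<in> borel_measurable N" by (rule mN) measurable
    have rd: "real_distribution (distr M borel (\<lambda>s. i \<bullet> U n s))" for n
      by (rule M.real_distribution_distr[OF Um])
    have rdN: "real_distribution (distr N borel (\<lambda>v. i \<bullet> v))" by (rule N.real_distribution_distr[OF im])
    have "weak_conv_m (\<lambda>n. distr M borel (\<lambda>s. i \<bullet> U n s)) (distr N borel (\<lambda>v. i \<bullet> v))"
    proof (rule levy_continuity[OF rd rdN])
      fix t
      have "char (distr M borel (\<lambda>s. i \<bullet> U n s)) t = (\<integral>s. iexp ((t *\<^sub>R i) \<bullet> U n s) \<partial>M)" for n
        unfolding char_def by (subst integral_distr[OF Um]) (auto intro!: borel_measurable_continuous_onI continuous_intros)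
      moreover have "char (distr N borel (\<lambda>v. i \<bullet> v)) t = (\<integral>v. iexp ((t *\<^sub>R i) \<bullet> v) \<partial>N)"
        unfolding char_def by (subst integral_distr[OF im]) (auto intro!: borel_measurable_continuous_onI continuous_intros)
      ultimately show "(\<lambda>n. char (distr M borel (\<lambda>s. i \<bullet> U n s)) t) \<longlonglongrightarrow> char (distr N borel (\<lambda>v. i \<bullet> v)) t"
        using conv[of "t *\<^sub>R i"] by simp
    qed
    from weak_conv_imp_integral_bdd_continuous_conv[OF rd rdN this, of "tail_cutoff R" 1]
    have "(\<lambda>n. integral\<^sup>L (distr M borel (\<lambda>s. i \<bullet> U n s)) (tail_cutoff R)) \<longlonglongrightarrow> integral\<^sup>L (distr N borel (\<lambda>v. i \<bullet> v)) (tail_cutoff R)"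
      using tail_cutoff_continuous[of R] tail_cutoff_bounds(3) by (auto simp: continuous_on_eq_continuous_at)
    then show ?thesis
      by (simp only: integral_distr[OF Um tail_cutoff_measurable] integral_distr[OF im tail_cutoff_measurable])
  qed
  show "(\<lambda>n. \<integral>s. f (U n s) \<partial>M) \<longlonglongrightarrow> (\<integral>v. f v \<partial>N)"
  proof (rule LIMSEQ_I)
    fix r :: real assume r: "0 < r"
    define \<epsilon> where "\<epsilon> = r / 8"
    have \<epsilon>: "0 < \<epsilon>" using r by (simp add: \<epsilon>_def)
    \<comment> \<open>the tail mass that makes the tail term, with its factor 2 C + \<epsilon>, at most \<epsilon>\<close>
    define \<eta> where "\<eta> = \<epsilon> / (2 * C + \<epsilon>)"
    have \<eta>: "0 < \<eta>" "(2 * C + \<epsilon>) * \<eta> = \<epsilon>" using \<epsilon> C0 by (auto simp: \<eta>_def)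
    define G where "G k v = (\<Sum>i\<in>Basis. tail_cutoff (real k) (i \<bullet> v))" for k and v :: 'b
    have Gm: "G k \<in> borel_measurable borel" for k
      unfolding G_def[abs_def] by (intro borel_measurable_sum measurable_compose[OF _ tail_cutoff_measurable]) measurable
    have G0: "0 \<le> G k v" for k v unfolding G_def by (intro sum_nonneg tail_cutoff_bounds)
    have Gb: "\<bar>G k v\<bar> \<le> DIM('b)" for k v
    proof -
      have "G k v \<le> (\<Sum>i\<in>(Basis :: 'b set). 1)" unfolding G_def by (intro sum_mono tail_cutoff_bounds)
      then show ?thesis using G0[of k v] by simp
    qed
    have "(\<lambda>k. \<integral>v. G k v \<partial>N) \<longlonglongrightarrow> (\<integral>v. 0 \<partial>N)"
    proof (rule integral_dominated_convergence[where w = "\<lambda>_. real DIM('b)"])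
      show "AE v in N. (\<lambda>k. G k v) \<longlonglongrightarrow> 0"
      proof (rule AE_I2, rule tendsto_eventually)
        fix v :: 'b
        show "\<forall>\<^sub>F k in sequentially. G k v = 0"
          using eventually_ge_at_top[of "nat \<lceil>norm v\<rceil>"]
        proof eventually_elim
          case (elim k)
          then have "norm v \<le> real k" by (simp add: nat_le_iff ceiling_le_iff)
          then have "\<bar>i \<bullet> v\<bar> \<le> real k" if "i \<in> Basis" for i
            using Basis_le_norm[OF that, of v] by (simp add: inner_commute)
          then show ?case unfolding G_def tail_cutoff_def by (intro sum.neutral) auto
        qed
      qed
      show "G k' \<in> borel_measurable N" for k' by (rule mN[OF Gm])
      show "AE v in N. norm (G k' v) \<le> real DIM('b)" for k' using Gb by (intro AE_I2) simp
    qed simp_all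
    then have "(\<lambda>k. \<integral>v. G k v \<partial>N) \<longlonglongrightarrow> 0" by simp
    from order_tendstoD(2)[OF this \<eta>(1)] obtain k where k: "(\<integral>v. G k v \<partial>N) < \<eta>"
      by (auto simp: eventually_sequentially)
    have im: "integrable M (\<lambda>s. tail_cutoff (real k) (i \<bullet> U n s))" for i n
      using measurable_compose[OF _ tail_cutoff_measurable, of "\<lambda>s. i \<bullet> U n s" M] U[of n] tail_cutoff_bounds(3)
      by (intro M.integrable_const_bound[where B = 1]) auto
    have iN: "integrable N (\<lambda>v. tail_cutoff (real k) (i \<bullet> v))" for i
      using mN[OF measurable_compose[OF _ tail_cutoff_measurable, of "\<lambda>s. i \<bullet> s" borel "real k"]] tail_cutoff_bounds(3)
      by (intro N.integrable_const_bound[where B = 1]) auto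
    have "(\<lambda>n. \<integral>s. G k (U n s) \<partial>M) \<longlonglongrightarrow> (\<integral>v. G k v \<partial>N)"
    proof -
      have "(\<lambda>n. \<Sum>i\<in>Basis. \<integral>s. tail_cutoff (real k) (i \<bullet> U n s) \<partial>M) \<longlonglongrightarrow> (\<Sum>i\<in>Basis. \<integral>v. tail_cutoff (real k) (i \<bullet> v) \<partial>N)"
        by (intro tendsto_sum tails)
      then show ?thesis
        unfolding G_def by (simp only: Bochner_Integration.integral_sum[OF im] Bochner_Integration.integral_sum[OF iN])
    qed
    from order_tendstoD(2)[OF this k] have ev1: "\<forall>\<^sub>F n in sequentially. (\<integral>s. G k (U n s) \<partial>M) < \<eta>" .
    \<comment> \<open>maps the box of radius k + 1 onto that of radius pi / 2, where arcsin inverts sin\<close>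
    define c where "c = (pi / 2) / (real k + 1)"
    have c: "0 < c" "c * (real k + 1) = pi / 2"
    proof -
      have "real k + 1 \<noteq> 0" by linarith
      then show "c * (real k + 1) = pi / 2" unfolding c_def by (intro iffD1[OF nonzero_eq_divide_eq refl])
      show "0 < c" unfolding c_def by simp
    qed
    \<comment> \<open>f in the coordinates u = sin (c (i \<bullet> v)), extended to the whole unit cube\<close>
    define F where "F u = f (\<Sum>i\<in>Basis. (arcsin (u \<bullet> i) / c) *\<^sub>R i)" for u :: 'b
    let ?K = "cbox (- One) One :: 'b set"
    have "continuous_on ?K F"
      unfolding F_def
      by (rule continuous_on_compose2[OF fc]) (auto intro!: continuous_intros continuous_on_arcsin simp: mem_box c(1)[THEN less_imp_neq, symmetric] inner_minus_left)
    then obtain p where p: "real_polynomial_function p" "\<And>u. u \<in> ?K \<Longrightarrow> \<bar>F u - p u\<bar> < \<epsilon>"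
      using Stone_Weierstrass_real_polynomial_function[OF compact_cbox _ \<epsilon>] by blast
    define T where "T v = p (\<Sum>i\<in>Basis. sin ((c *\<^sub>R i) \<bullet> v) *\<^sub>R i)" for v :: 'b
    have Ttrig: "trig_poly (\<lambda>v. complex_of_real (T v))" unfolding T_def by (rule trig_poly_polynomial[OF p(1)])
    have inK: "(\<Sum>i\<in>Basis. sin ((c *\<^sub>R i) \<bullet> v) *\<^sub>R i) \<in> ?K" for v
      by (auto simp: mem_box inner_minus_left)
    have Tle: "\<bar>T v\<bar> \<le> C + \<epsilon>" for v
      using p(2)[OF inK[of v]] C[of "\<Sum>i\<in>Basis. (arcsin ((\<Sum>i\<in>Basis. sin ((c *\<^sub>R i) \<bullet> v) *\<^sub>R i) \<bullet> i) / c) *\<^sub>R i"]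
      unfolding T_def F_def by linarith
    have approx: "\<bar>f v - T v\<bar> \<le> \<epsilon> + (2 * C + \<epsilon>) * G k v" for v
    proof (cases "\<forall>i\<in>Basis. \<bar>i \<bullet> v\<bar> \<le> real k + 1")
      case True
      have "arcsin (sin ((c *\<^sub>R i) \<bullet> v)) / c = i \<bullet> v" if "i \<in> Basis" for i
      proof -
        have "\<bar>c * (i \<bullet> v)\<bar> \<le> pi / 2" unfolding c(2)[symmetric] abs_mult using True that c(1) by (intro mult_mono) auto
        then have "arcsin (sin (c * (i \<bullet> v))) = c * (i \<bullet> v)" by (intro arcsin_sin) (auto simp: abs_le_iff)
        then show ?thesis using c(1) by simp
      qed
      then have "(\<Sum>i\<in>Basis. (arcsin ((\<Sum>j\<in>Basis. sin ((c *\<^sub>R j) \<bullet> v) *\<^sub>R j) \<bullet> i) / c) *\<^sub>R i) = (\<Sum>i\<in>Basis. (v \<bullet> i) *\<^sub>R i)"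
        by (intro sum.cong refl) (simp only: inner_sum_left_Basis inner_commute[of v])
      then have "F (\<Sum>i\<in>Basis. sin ((c *\<^sub>R i) \<bullet> v) *\<^sub>R i) = f v"
        unfolding F_def by (simp add: euclidean_representation)
      then have "\<bar>f v - T v\<bar> < \<epsilon>" using p(2)[OF inK[of v]] unfolding T_def by simp
      moreover have "0 \<le> (2 * C + \<epsilon>) * G k v" using C0 \<epsilon> G0 by (intro mult_nonneg_nonneg) auto
      ultimately show ?thesis by (meson add_increasing2 less_imp_le order_trans order_refl)
    next
      case False
      then obtain i :: 'b where i: "i \<in> Basis" "real k + 1 \<le> \<bar>i \<bullet> v\<bar>" by auto
      have "1 = tail_cutoff (real k) (i \<bullet> v)" using tail_cutoff_eq_1[OF i(2)] by simp
      also have "\<dots> \<le> G k v" unfolding G_def using i(1) tail_cutoff_bounds(1) by (intro member_le_sum) auto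
      finally have "(2 * C + \<epsilon>) * 1 \<le> (2 * C + \<epsilon>) * G k v" using C0 \<epsilon> by (intro mult_left_mono) auto
      then have "2 * C + \<epsilon> \<le> (2 * C + \<epsilon>) * G k v" by (simp only: mult_1_right)
      moreover have "\<bar>f v - T v\<bar> \<le> 2 * C + \<epsilon>" using C[of v] Tle[of v] by linarith
      ultimately have "\<bar>f v - T v\<bar> \<le> (2 * C + \<epsilon>) * G k v" by (rule order_trans[rotated])
      then show ?thesis using \<epsilon> by (simp add: add_increasing)
    qed
    have Tm: "T \<in> borel_measurable borel"
    proof -
      have "(\<lambda>v. Re (complex_of_real (T v))) \<in> borel_measurable borel"
        using conjunct1[OF trig_poly_bounded_measurable[OF Ttrig]] unfolding borel_measurable_complex_iff by (rule conjunct1)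
      then show ?thesis by simp
    qed
    have "(\<lambda>n. \<integral>s. complex_of_real (T (U n s)) \<partial>M) \<longlonglongrightarrow> (\<integral>v. complex_of_real (T v) \<partial>N)"
      by (rule trig_poly_convergence[OF M U N conv Ttrig])
    then have "(\<lambda>n. \<integral>s. T (U n s) \<partial>M) \<longlonglongrightarrow> (\<integral>v. T v \<partial>N)" by (simp add: tendsto_of_real_iff)
    from LIMSEQ_D[OF this \<epsilon>] have ev2: "\<forall>\<^sub>F n in sequentially. \<bar>(\<integral>s. T (U n s) \<partial>M) - (\<integral>v. T v \<partial>N)\<bar> < \<epsilon>"
      by (auto simp: eventually_sequentially)
    have intM: "integrable M (\<lambda>s. h (U n s))" if "h \<in> borel_measurable borel" "\<And>v. \<bar>h v\<bar> \<le> B" for h :: "'b \<Rightarrow> real" and B n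
      using that measurable_compose[OF U that(1)] by (intro M.integrable_const_bound[where B = B]) auto
    have intN: "integrable N h" if "h \<in> borel_measurable borel" "\<And>v. \<bar>h v\<bar> \<le> B" for h :: "'b \<Rightarrow> real" and B
      using that mN[OF that(1)] by (intro N.integrable_const_bound[where B = B]) auto
    have eM: "\<bar>(\<integral>s. f (U n s) \<partial>M) - (\<integral>s. T (U n s) \<partial>M)\<bar> \<le> \<epsilon> + (2 * C + \<epsilon>) * (\<integral>s. G k (U n s) \<partial>M)" for n
    proof -
      note i = intM[OF fm C, of n] intM[OF Tm Tle, of n] intM[OF Gm Gb, of k n]
      have "\<bar>\<integral>s. f (U n s) - T (U n s) \<partial>M\<bar> \<le> (\<integral>s. \<bar>f (U n s) - T (U n s)\<bar> \<partial>M)" by (rule integral_abs_bound)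
      also have "\<dots> \<le> (\<integral>s. \<epsilon> + (2 * C + \<epsilon>) * G k (U n s) \<partial>M)"
        using i by (intro integral_mono approx) auto
      finally show ?thesis using i by (simp add: M.prob_space)
    qed
    have eN: "\<bar>(\<integral>v. f v \<partial>N) - (\<integral>v. T v \<partial>N)\<bar> \<le> \<epsilon> + (2 * C + \<epsilon>) * (\<integral>v. G k v \<partial>N)"
    proof -
      note i = intN[OF fm C] intN[OF Tm Tle] intN[OF Gm Gb, of k]
      have "\<bar>\<integral>v. f v - T v \<partial>N\<bar> \<le> (\<integral>v. \<bar>f v - T v\<bar> \<partial>N)" by (rule integral_abs_bound)
      also have "\<dots> \<le> (\<integral>v. \<epsilon> + (2 * C + \<epsilon>) * G k v \<partial>N)"
        using i by (intro integral_mono approx) auto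
      finally show ?thesis using i by (simp add: N.prob_space)
    qed
    have s: "(2 * C + \<epsilon>) * x \<le> \<epsilon>" if "x < \<eta>" for x
      by (rule order_trans[OF mult_left_mono eq_refl[OF \<eta>(2)]]) (use that C0 \<epsilon> in auto)
    from ev1 ev2 have "\<forall>\<^sub>F n in sequentially. norm ((\<integral>s. f (U n s) \<partial>M) - (\<integral>v. f v \<partial>N)) < r"
    proof eventually_elim
      case (elim n)
      have "\<bar>(\<integral>s. f (U n s) \<partial>M) - (\<integral>s. T (U n s) \<partial>M)\<bar> \<le> 2 * \<epsilon>" "\<bar>(\<integral>v. f v \<partial>N) - (\<integral>v. T v \<partial>N)\<bar> \<le> 2 * \<epsilon>"
        using order_trans[OF eM[of n] add_left_mono[OF s[OF elim(1)]]] order_trans[OF eN add_left_mono[OF s[OF k]]] by simp_all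
      then have "\<bar>(\<integral>s. f (U n s) \<partial>M) - (\<integral>v. f v \<partial>N)\<bar> \<le> 5 * \<epsilon>" using elim(2) by linarith
      then show ?case using \<epsilon> unfolding \<epsilon>_def by simp
    qed
    then show "\<exists>no. \<forall>n\<ge>no. norm ((\<integral>s. f (U n s) \<partial>M) - (\<integral>v. f v \<partial>N)) < r"
      by (simp add: eventually_sequentially)
  qed
qed

section \<open>Existence of multivariate normal laws\<close>

lemma normal_law_char:
  assumes "0 \<le> v"
  shows "real_distribution (normal_law 0 v)" "char (normal_law 0 v) s = complex_of_real (exp (- (s\<^sup>2 * v) / 2))"
proof -
  have "real_distribution (normal_law 0 v) \<and> char (normal_law 0 v) s = complex_of_real (exp (- (s\<^sup>2 * v) / 2))"
  proof (cases "v = 0")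
    case True
    have "real_distribution (return borel (0::real))"
      by (simp add: real_distribution_def real_distribution_axioms_def prob_space_return)
    moreover have "char (return borel (0::real)) s = 1"
      unfolding char_def by (subst integral_return) (auto intro!: borel_measurable_continuous_onI continuous_intros)
    ultimately show ?thesis using True by (simp add: normal_law_def)
  next
    case False
    then have v: "0 < v" using assms by simp
    interpret prob_space std_normal_distribution
      using prob_space_normal_density[of 1 0] by simp
    have rd: "real_distribution (density lborel (normal_density 0 (sqrt v)))"
      using prob_space_normal_density[of "sqrt v" 0] v by (simp add: real_distribution_def real_distribution_axioms_def)
    have "distributed std_normal_distribution lborel (\<lambda>x. x) (normal_density 0 1)"
      unfolding distributed_def by (auto simp: distr_id2)
    from normal_density_affine[OF this, of "sqrt v" 0] v
    have "distributed std_normal_distribution lborel (\<lambda>x. sqrt v * x) (normal_density 0 (sqrt v))" by simp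
    then have d: "distr std_normal_distribution lborel (\<lambda>x. sqrt v * x) = density lborel (normal_density 0 (sqrt v))"
      by (rule distributed_distr_eq_density)
    have "char (density lborel (normal_density 0 (sqrt v))) s = (\<integral>x. iexp (s * (sqrt v * x)) \<partial>std_normal_distribution)"
      unfolding char_def d[symmetric]
      by (subst integral_distr) (auto intro!: borel_measurable_continuous_onI continuous_intros)
    also have "\<dots> = char std_normal_distribution (s * sqrt v)" by (simp add: char_def mult.assoc)
    also have "\<dots> = complex_of_real (exp (- (s\<^sup>2 * v) / 2))"
      using v by (simp add: char_std_normal_distribution power_mult_distrib)
    finally show ?thesis using rd False by (simp add: normal_law_def)
  qed
  then show "real_distribution (normal_law 0 v)" "char (normal_law 0 v) s = complex_of_real (exp (- (s\<^sup>2 * v) / 2))" by auto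
qed

lemma multivariate_normal_from_char:
  fixes D :: "real ^ 'm ^ 'm"
  assumes D: "transpose D = D" "\<And>t. 0 \<le> t \<bullet> (D *v t)"
    and N: "prob_space N" "sets N = sets borel"
    and ch: "\<And>t. (\<integral>v. iexp (t \<bullet> v) \<partial>N) = complex_of_real (exp (- (t \<bullet> (D *v t)) / 2))"
  shows "multivariate_normal 0 D N"
  unfolding multivariate_normal_def
proof (intro conjI allI D N)
  fix t :: "real ^ 'm"
  have im: "(\<lambda>v. t \<bullet> v) \<in> borel_measurable N"
    unfolding measurable_cong_sets[OF N(2) refl] by measurable
  have rd: "real_distribution (distr N borel (\<lambda>v. t \<bullet> v))"
    by (rule prob_space.real_distribution_distr[OF N(1) im])
  have "char (distr N borel (\<lambda>v. t \<bullet> v)) s = char (normal_law 0 (t \<bullet> (D *v t))) s" for s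
  proof -
    have "char (distr N borel (\<lambda>v. t \<bullet> v)) s = (\<integral>v. iexp ((s *\<^sub>R t) \<bullet> v) \<partial>N)"
      unfolding char_def by (subst integral_distr[OF im]) (auto intro!: borel_measurable_continuous_onI continuous_intros)
    also have "\<dots> = complex_of_real (exp (- (s\<^sup>2 * (t \<bullet> (D *v t))) / 2))"
      unfolding ch by (simp add: scaleR_matrix_vector_assoc[symmetric] matrix_vector_mult_scaleR power2_eq_square mult.assoc)
    finally show ?thesis using normal_law_char(2)[OF D(2)] by simp
  qed
  then have "char (distr N borel (\<lambda>v. t \<bullet> v)) = char (normal_law 0 (t \<bullet> (D *v t)))" by (rule ext)
  from Levy_uniqueness[OF rd normal_law_char(1)[OF D(2)] this]
  show "distr N borel (\<lambda>v. t \<bullet> v) = normal_law (t \<bullet> 0) (t \<bullet> (D *v t))" by simp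
qed

definition quad_form :: "real ^ 'm ^ 'm \<Rightarrow> real ^ 'm \<Rightarrow> real" where
  "quad_form D t = t \<bullet> (D *v t)"

lemma quad_form_eq: "quad_form D t = (\<Sum>i\<in>UNIV. \<Sum>j\<in>UNIV. t $ i * D $ i $ j * t $ j)"
  unfolding quad_form_def inner_vec_def matrix_vector_mult_def by (simp add: sum_distrib_left mult.assoc)

lemma symmetric_entries:
  fixes D :: "real ^ 'm ^ 'm"
  assumes "transpose D = D" shows "D $ i $ j = D $ j $ i"
proof -
  have "transpose D $ i $ j = D $ j $ i" by (simp add: transpose_def)
  then show ?thesis using assms by simp
qed

lemma quad_form_shift:
  fixes D :: "real ^ 'm ^ 'm"
  assumes "transpose D = D"
  shows "quad_form D (t + c *\<^sub>R axis k 1) = quad_form D t + 2 * c * (D *v t) $ k + c\<^sup>2 * D $ k $ k"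
proof -
  let ?e = "axis k 1 :: real ^ 'm"
  have sym: "D $ i $ j = D $ j $ i" for i j by (rule symmetric_entries[OF assms])
  have De: "(D *v ?e) $ i = D $ i $ k" for i by (simp add: matrix_vector_mult_basis column_def)
  have "t \<bullet> (D *v ?e) = (D *v t) $ k"
    unfolding inner_vec_def matrix_vector_mult_def[of D t] using De sym by (simp add: mult.commute)
  moreover have "?e \<bullet> (D *v t) = (D *v t) $ k" by (simp add: inner_axis')
  moreover have "?e \<bullet> (D *v ?e) = D $ k $ k" using De by (simp add: inner_axis')
  ultimately show ?thesis
    unfolding quad_form_def
    by (simp add: matrix_vector_right_distrib matrix_vector_mult_scaleR inner_add_left inner_add_right power2_eq_square algebra_simps)
qed

text \<open>Along the line through \<open>axis j 1\<close> in direction \<open>axis k 1\<close> the quadratic form is affine when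
\<open>D $ k $ k = 0\<close>, so its slope \<open>2 * D $ k $ j\<close> must vanish.\<close>

lemma psd_zero_diagonal:
  fixes D :: "real ^ 'm ^ 'm"
  assumes sym: "transpose D = D" and psd: "\<And>t. 0 \<le> quad_form D t" and d: "D $ k $ k = 0"
  shows "D $ k $ j = 0"
proof (rule ccontr)
  assume a: "D $ k $ j \<noteq> 0"
  let ?q = "quad_form D (axis j 1)"
  have De: "(D *v axis j 1) $ k = D $ k $ j" by (simp add: matrix_vector_mult_basis column_def)
  \<comment> \<open>the point of the line at which the affine function takes the value -1\<close>
  have "quad_form D (axis j 1 + (- (?q + 1) / (2 * D $ k $ j)) *\<^sub>R axis k 1) = -1"
    unfolding quad_form_shift[OF sym] De d using a by (simp add: field_simps)
  then show False using psd[of "axis j 1 + (- (?q + 1) / (2 * D $ k $ j)) *\<^sub>R axis k 1"] by simp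
qed

text \<open>Add an independent standard normal multiple of the vector \<open>a\<close>.\<close>

lemma gaussian_add_rank_one:
  fixes a :: "real ^ 'm"
  assumes N: "prob_space N" "sets N = sets borel"
    and ch: "\<And>t. (\<integral>v. iexp (t \<bullet> v) \<partial>N) = complex_of_real (exp (- q t / 2))"
  shows "\<exists>N'. prob_space N' \<and> sets N' = sets borel \<and>
     (\<forall>t. (\<integral>v. iexp (t \<bullet> v) \<partial>N') = complex_of_real (exp (- (q t + (t \<bullet> a)\<^sup>2) / 2)))"
proof -
  interpret N: prob_space N by (rule N)
  interpret G: prob_space std_normal_distribution
    using prob_space_normal_density[of 1 0] by simp
  interpret pair_prob_space N std_normal_distribution ..
  let ?X = "N \<Otimes>\<^sub>M std_normal_distribution"
  let ?h = "\<lambda>(v, x). v + x *\<^sub>R a"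
  have sX: "sets ?X = sets (borel \<Otimes>\<^sub>M borel)"
    by (intro sets_pair_measure_cong) (simp_all add: N(2))
  have hm: "?h \<in> borel_measurable ?X"
    unfolding measurable_cong_sets[OF sX refl] by measurable
  have "(\<integral>v. iexp (t \<bullet> v) \<partial>distr ?X borel ?h) = complex_of_real (exp (- (q t + (t \<bullet> a)\<^sup>2) / 2))" for t
  proof -
    have em: "(\<lambda>v. iexp (t \<bullet> v)) \<in> borel_measurable borel"
      by (intro borel_measurable_continuous_onI continuous_intros)
    have i: "integrable ?X (\<lambda>(v, x). iexp (t \<bullet> (v + x *\<^sub>R a)))"
    proof (rule integrable_const_bound[where B = 1])
      show "(\<lambda>(v, x). iexp (t \<bullet> (v + x *\<^sub>R a))) \<in> borel_measurable ?X"
        using measurable_compose[OF hm em] by (simp add: case_prod_unfold)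
    qed auto
    have "(\<integral>v. iexp (t \<bullet> v) \<partial>distr ?X borel ?h) = (\<integral>z. (case z of (v, x) \<Rightarrow> iexp (t \<bullet> (v + x *\<^sub>R a))) \<partial>?X)"
      unfolding integral_distr[OF hm em] by (simp add: case_prod_unfold)
    also have "\<dots> = (\<integral>v. (\<integral>x. iexp (t \<bullet> (v + x *\<^sub>R a)) \<partial>std_normal_distribution) \<partial>N)"
      by (rule integral_fst[OF i, symmetric])
    also have "\<dots> = (\<integral>v. iexp (t \<bullet> v) * char std_normal_distribution (t \<bullet> a) \<partial>N)"
    proof (rule Bochner_Integration.integral_cong[OF refl])
      fix v
      have "iexp (t \<bullet> (v + x *\<^sub>R a)) = iexp (t \<bullet> v) * iexp ((t \<bullet> a) * x)" for x
        by (simp add: inner_add_right distrib_left exp_add mult_ac)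
      then show "(\<integral>x. iexp (t \<bullet> (v + x *\<^sub>R a)) \<partial>std_normal_distribution) = iexp (t \<bullet> v) * char std_normal_distribution (t \<bullet> a)"
        unfolding char_def by simp
    qed
    also have "\<dots> = complex_of_real (exp (- q t / 2)) * complex_of_real (exp (- ((t \<bullet> a)\<^sup>2) / 2))"
      unfolding char_std_normal_distribution by (simp add: ch)
    also have "\<dots> = complex_of_real (exp (- (q t + (t \<bullet> a)\<^sup>2) / 2))"
      by (simp only: of_real_mult[symmetric] exp_add[symmetric] add_divide_distrib[symmetric] minus_add_distrib[symmetric])
    finally show ?thesis .
  qed
  moreover have "prob_space (distr ?X borel ?h)" by (rule prob_space_distr[OF hm])
  ultimately show ?thesis by (intro exI[of _ "distr ?X borel ?h"]) simp
qed

text \<open>Lagrange reduction. If \<open>d = D $ k $ k\<close> is positive, then \<open>D\<close> is the sum of \<open>a a\<^sup>T\<close>, where \<open>a\<close>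
is row \<open>k\<close> divided by \<open>sqrt d\<close>, and a matrix \<open>D'\<close> whose row \<open>k\<close> vanishes. The form of \<open>D'\<close> at \<open>t\<close>
is the minimum of the form of \<open>D\<close> over the line through \<open>t\<close> in direction \<open>axis k 1\<close>, so \<open>D'\<close> is
positive semidefinite as well. The set \<open>S\<close> contains the indices of the nonzero rows.\<close>

lemma gaussian_exists_on:
  fixes D :: "real ^ 'm ^ 'm"
  assumes "finite S" and "transpose D = D" and "\<And>t. 0 \<le> quad_form D t" and "\<And>i j. i \<notin> S \<Longrightarrow> D $ i $ j = 0"
  shows "\<exists>N. prob_space N \<and> sets N = sets borel \<and>
     (\<forall>t. (\<integral>v. iexp (t \<bullet> v) \<partial>N) = complex_of_real (exp (- quad_form D t / 2)))"
  using assms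
proof (induction S arbitrary: D)
  case empty
  then have "quad_form D t = 0" for t by (simp add: quad_form_eq)
  moreover have "(\<integral>v. iexp (t \<bullet> v) \<partial>return borel (0 :: real ^ 'm)) = 1" for t
    by (subst integral_return) (auto intro!: borel_measurable_continuous_onI continuous_intros)
  ultimately show ?case
    by (intro exI[of _ "return borel 0"]) (auto simp: prob_space_return)
next
  case (insert k S)
  note sym = insert.prems(1) and psd = insert.prems(2)
  have symij: "D $ i $ j = D $ j $ i" for i j by (rule symmetric_entries[OF sym])
  let ?d = "D $ k $ k"
  have "quad_form D (axis k 1) = ?d"
    using quad_form_shift[OF sym, of 0 1 k] by (simp add: quad_form_def)
  then have d0: "0 \<le> ?d" using psd[of "axis k 1"] by simp
  show ?case
  proof (cases "?d = 0")
    case True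
    have "D $ i $ j = 0" if "i \<notin> S" for i j
      using psd_zero_diagonal[OF sym psd True] insert.prems(3)[of i j] that by (cases "i = k") auto
    then show ?thesis by (intro insert.IH sym psd)
  next
    case False
    then have d: "0 < ?d" using d0 by simp
    define a :: "real ^ 'm" where "a = (\<chi> j. D $ k $ j / sqrt ?d)"
    define D' :: "real ^ 'm ^ 'm" where "D' = (\<chi> i j. D $ i $ j - D $ k $ i * D $ k $ j / ?d)"
    have ta: "(t \<bullet> a)\<^sup>2 = ((D *v t) $ k)\<^sup>2 / ?d" for t
    proof -
      have "t \<bullet> a = (\<Sum>j\<in>UNIV. D $ k $ j * t $ j) / sqrt ?d"
        unfolding inner_vec_def a_def by (simp add: sum_divide_distrib mult.commute)
      then show ?thesis using d by (simp add: matrix_vector_mult_def power_divide)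
    qed
    have q': "quad_form D' t = quad_form D t - (t \<bullet> a)\<^sup>2" for t
    proof -
      have "(\<Sum>i\<in>UNIV. \<Sum>j\<in>UNIV. t $ i * (D $ k $ i * D $ k $ j / ?d) * t $ j) = (\<Sum>i\<in>UNIV. D $ k $ i * t $ i) * (\<Sum>j\<in>UNIV. D $ k $ j * t $ j) / ?d"
        unfolding sum_product sum_divide_distrib by (intro sum.cong refl) (simp add: mult_ac)
      also have "\<dots> = (t \<bullet> a)\<^sup>2" unfolding ta by (simp add: matrix_vector_mult_def power2_eq_square)
      finally show ?thesis unfolding quad_form_eq D'_def
        by (simp add: right_diff_distrib left_diff_distrib sum_subtractf)
    qed
    have "transpose D' = D'"
      unfolding D'_def transpose_def vec_eq_iff using symij by (simp add: mult.commute)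
    moreover have "0 \<le> quad_form D' t" for t
    proof -
      have "quad_form D (t + (- (D *v t) $ k / ?d) *\<^sub>R axis k 1) = quad_form D' t"
        unfolding quad_form_shift[OF sym] q' ta using d by (simp add: power2_eq_square field_simps)
      then show ?thesis using psd[of "t + (- (D *v t) $ k / ?d) *\<^sub>R axis k 1"] by simp
    qed
    moreover have "D' $ i $ j = 0" if "i \<notin> S" for i j
    proof (cases "i = k")
      case True
      then show ?thesis using d unfolding D'_def by simp
    next
      case False
      then have "D $ i $ j = 0" "D $ i $ k = 0" using insert.prems(3)[of i] that by auto
      then show ?thesis using symij[of k i] unfolding D'_def by simp
    qed
    ultimately obtain N where N: "prob_space N" "sets N = sets borel"
      "\<And>t. (\<integral>v. iexp (t \<bullet> v) \<partial>N) = complex_of_real (exp (- quad_form D' t / 2))"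
      using insert.IH[of D'] by blast
    from gaussian_add_rank_one[OF N, of a] show ?thesis unfolding q' by simp
  qed
qed

section \<open>Conditioning on the random matrix\<close>

text \<open>The supremum defining the norm is over a set that is bounded above: by the sum of the absolute
values of the entries.\<close>

lemma spectral_norm_apply_le:
  assumes v: "L2_set v {..<n} \<le> 1"
  shows "L2_set (\<lambda>i. \<Sum>j<n. A i j * v j) {..<n} \<le> spectral_norm n A"
proof -
  have "L2_set (\<lambda>i. \<Sum>j<n. A i j * w j) {..<n} \<le> (\<Sum>i<n. \<Sum>j<n. \<bar>A i j\<bar>)" if w: "L2_set w {..<n} \<le> 1" for w
  proof -
    have w1: "\<bar>w j\<bar> \<le> 1" if "j < n" for j
    proof -
      have "\<bar>w j\<bar> \<le> L2_set (\<lambda>j. \<bar>w j\<bar>) {..<n}" using that by (intro member_le_L2_set) auto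
      also have "\<dots> = L2_set w {..<n}" by (simp add: L2_set_def)
      finally show ?thesis using w by simp
    qed
    have "L2_set (\<lambda>i. \<Sum>j<n. A i j * w j) {..<n} \<le> (\<Sum>i<n. \<bar>\<Sum>j<n. A i j * w j\<bar>)" by (rule L2_set_le_sum_abs)
    also have "\<dots> \<le> (\<Sum>i<n. \<Sum>j<n. \<bar>A i j\<bar>)"
      by (intro sum_mono order_trans[OF sum_abs]) (simp add: abs_mult mult_left_le w1)
    finally show ?thesis .
  qed
  then show ?thesis unfolding spectral_norm_def
    using v by (intro cSUP_upper) (auto intro!: bdd_aboveI2[where M = "\<Sum>i<n. \<Sum>j<n. \<bar>A i j\<bar>"])
qed

lemma op_bounded_spectral_norm:
  assumes sym: "\<And>i j. i < n \<Longrightarrow> j < n \<Longrightarrow> A i j = A j i" and \<beta>: "spectral_norm n A \<le> \<beta>"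
  shows "op_bounded n \<beta> A"
proof -
  let ?A = "\<lambda>v i. \<Sum>j<n. A i j * v j"
  have "0 \<le> L2_set (?A (\<lambda>_. 0)) {..<n}" by simp
  also have "\<dots> \<le> \<beta>" using spectral_norm_apply_le[of "\<lambda>_. 0" n A] \<beta> by (simp add: L2_set_def)
  finally have \<beta>0: "0 \<le> \<beta>" .
  have sq: "(L2_set f {..<n})\<^sup>2 = (\<Sum>i<n. (f i)\<^sup>2)" for f :: "nat \<Rightarrow> real"
    unfolding L2_set_def by (simp add: sum_nonneg)
  have "(\<Sum>i<n. (?A v i)\<^sup>2) \<le> \<beta>\<^sup>2 * (\<Sum>j<n. (v j)\<^sup>2)" for v
  proof (cases "L2_set v {..<n} = 0")
    case True
    then have "v j = 0" if "j < n" for j using that by (simp add: L2_set_eq_0_iff)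
    then have "?A v i = 0" for i by (intro sum.neutral) simp
    then show ?thesis by (simp add: sum_nonneg)
  next
    case False
    let ?s = "L2_set v {..<n}"
    have s: "0 < ?s" using False L2_set_nonneg[of v "{..<n}"] by linarith
    have "L2_set (\<lambda>j. (1 / ?s) * v j) {..<n} = 1 / ?s * ?s" using s by (intro L2_set_right_distrib[symmetric]) simp
    then have "L2_set (?A (\<lambda>j. (1 / ?s) * v j)) {..<n} \<le> \<beta>"
      using spectral_norm_apply_le[of "\<lambda>j. (1 / ?s) * v j" n A] \<beta> s by simp
    also have "?A (\<lambda>j. (1 / ?s) * v j) = (\<lambda>i. (1 / ?s) * ?A v i)" by (simp add: sum_distrib_left mult_ac)
    also have "L2_set (\<lambda>i. (1 / ?s) * ?A v i) {..<n} = 1 / ?s * L2_set (?A v) {..<n}"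
      using s by (intro L2_set_right_distrib[symmetric]) simp
    finally have "L2_set (?A v) {..<n} \<le> \<beta> * ?s" using s by (simp add: divide_le_eq)
    from power_mono[OF this, of 2] show ?thesis unfolding power_mult_distrib sq by simp
  qed
  then show ?thesis unfolding op_bounded_def using \<beta>0 sym by blast
qed

text \<open>Measurable rectangles determine a finite measure on the product.\<close>

lemma indep_rv_distr_pair:
  assumes M: "prob_space M" and ind: "indep_rv M S U T V"
  shows "distr M (S \<Otimes>\<^sub>M T) (\<lambda>\<omega>. (U \<omega>, V \<omega>)) = distr M S U \<Otimes>\<^sub>M distr M T V"
proof -
  interpret prob_space M by (rule M)
  have U: "U \<in> measurable M S" and V: "V \<in> measurable M T"
    and i: "indep_set (sets (vimage_algebra (space M) U S)) (sets (vimage_algebra (space M) V T))"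
    using ind by (auto simp: indep_rv_def)
  have UV: "(\<lambda>\<omega>. (U \<omega>, V \<omega>)) \<in> measurable M (S \<Otimes>\<^sub>M T)" using U V by measurable
  interpret U: prob_space "distr M S U" by (rule prob_space_distr[OF U])
  interpret V: prob_space "distr M T V" by (rule prob_space_distr[OF V])
  show ?thesis
  proof (rule pair_measure_eqI[symmetric])
    show "sigma_finite_measure (distr M S U)" "sigma_finite_measure (distr M T V)"
      by (rule U.sigma_finite_measure_axioms V.sigma_finite_measure_axioms)+
    show "sets (distr M S U \<Otimes>\<^sub>M distr M T V) = sets (distr M (S \<Otimes>\<^sub>M T) (\<lambda>\<omega>. (U \<omega>, V \<omega>)))"
      unfolding sets_distr by (rule sets_pair_measure_cong) simp_all
    fix A B assume "A \<in> sets (distr M S U)" "B \<in> sets (distr M T V)"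
    then have AB: "A \<in> sets S" "B \<in> sets T" by auto
    have ABm: "A \<times> B \<in> sets (S \<Otimes>\<^sub>M T)" using AB by auto
    have e: "(\<lambda>\<omega>. (U \<omega>, V \<omega>)) -` (A \<times> B) \<inter> space M = (U -` A \<inter> space M) \<inter> (V -` B \<inter> space M)" by auto
    have "prob ((U -` A \<inter> space M) \<inter> (V -` B \<inter> space M)) = prob (U -` A \<inter> space M) * prob (V -` B \<inter> space M)"
      using AB by (intro indep_setD[OF i] in_vimage_algebra)
    then show "emeasure (distr M S U) A * emeasure (distr M T V) B = emeasure (distr M (S \<Otimes>\<^sub>M T) (\<lambda>\<omega>. (U \<omega>, V \<omega>))) (A \<times> B)"
      unfolding emeasure_distr[OF U AB(1)] emeasure_distr[OF V AB(2)] emeasure_distr[OF UV ABm] e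
      by (simp add: emeasure_eq_measure ennreal_mult)
  qed
qed

lemma indep_rv_integral:
  fixes H :: "'b \<Rightarrow> 'c \<Rightarrow> complex"
  assumes M: "prob_space M" and ind: "indep_rv M S U T V"
    and H: "case_prod H \<in> borel_measurable (S \<Otimes>\<^sub>M T)" "\<And>a b. norm (H a b) \<le> C"
  shows "(\<integral>\<omega>. H (U \<omega>) (V \<omega>) \<partial>M) = (\<integral>\<omega>. (\<integral>v. H (U \<omega>) v \<partial>distr M T V) \<partial>M)"
    and "(\<lambda>a. \<integral>v. H a v \<partial>distr M T V) \<in> borel_measurable S"
proof -
  interpret prob_space M by (rule M)
  have U: "U \<in> measurable M S" and V: "V \<in> measurable M T" using ind by (auto simp: indep_rv_def)
  have UV: "(\<lambda>\<omega>. (U \<omega>, V \<omega>)) \<in> measurable M (S \<Otimes>\<^sub>M T)" using U V by measurable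
  interpret U: prob_space "distr M S U" by (rule prob_space_distr[OF U])
  interpret V: prob_space "distr M T V" by (rule prob_space_distr[OF V])
  interpret UV: pair_prob_space "distr M S U" "distr M T V" ..
  have sUV: "sets (distr M S U \<Otimes>\<^sub>M distr M T V) = sets (S \<Otimes>\<^sub>M T)"
    by (rule sets_pair_measure_cong) simp_all
  have HP: "case_prod H \<in> borel_measurable (distr M S U \<Otimes>\<^sub>M distr M T V)"
    unfolding measurable_cong_sets[OF sUV refl] by (rule H(1))
  have iH: "integrable (distr M S U \<Otimes>\<^sub>M distr M T V) (case_prod H)"
    by (rule UV.integrable_const_bound[where B = C]) (use HP H(2) in auto)
  have "case_prod H \<in> borel_measurable (S \<Otimes>\<^sub>M distr M T V)"
    using H(1) measurable_cong_sets[OF sets_pair_measure_cong[OF refl sets_distr, of S M T V] refl] by blast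
  then show m: "(\<lambda>a. \<integral>v. H a v \<partial>distr M T V) \<in> borel_measurable S"
    by (rule V.borel_measurable_lebesgue_integral)
  have "(\<integral>\<omega>. H (U \<omega>) (V \<omega>) \<partial>M) = integral\<^sup>L (distr M (S \<Otimes>\<^sub>M T) (\<lambda>\<omega>. (U \<omega>, V \<omega>))) (case_prod H)"
    by (subst integral_distr[OF UV H(1)]) simp
  also have "\<dots> = integral\<^sup>L (distr M S U \<Otimes>\<^sub>M distr M T V) (case_prod H)"
    unfolding indep_rv_distr_pair[OF M ind] ..
  also have "\<dots> = (\<integral>a. (\<integral>v. H a v \<partial>distr M T V) \<partial>distr M S U)"
    using UV.integral_fst[OF iH] by simp
  also have "\<dots> = (\<integral>\<omega>. (\<integral>v. H (U \<omega>) v \<partial>distr M T V) \<partial>M)"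
    by (rule integral_distr[OF U m])
  finally show "(\<integral>\<omega>. H (U \<omega>) (V \<omega>) \<partial>M) = (\<integral>\<omega>. (\<integral>v. H (U \<omega>) v \<partial>distr M T V) \<partial>M)" .
qed

lemma iid_observations_distr:
  assumes M: "prob_space M" and xy: "x \<in> borel_measurable M" "y \<in> borel_measurable M"
    and iid: "iid_observations M x y n X Y" and n: "0 < n"
  shows "distr M (PiM {..<n} (\<lambda>_. borel)) (\<lambda>\<omega>. \<lambda>i\<in>{..<n}. (X i \<omega>, Y i \<omega>)) = samples (distr M borel (\<lambda>\<omega>. (x \<omega>, y \<omega>))) n"
proof -
  interpret prob_space M by (rule M)
  have ind: "indep_vars (\<lambda>_. borel) (\<lambda>i \<omega>. (X i \<omega>, Y i \<omega>)) {..<n}"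
    and d: "\<And>i. i < n \<Longrightarrow> distr M borel (\<lambda>\<omega>. (X i \<omega>, Y i \<omega>)) = distr M borel (\<lambda>\<omega>. (x \<omega>, y \<omega>))"
    using iid by (auto simp: iid_observations_def)
  have rv: "random_variable borel (\<lambda>\<omega>. (X i \<omega>, Y i \<omega>))" if "i \<in> {..<n}" for i
    using ind that by (auto simp: indep_vars_def)
  have "{..<n} \<noteq> {}" using n by auto
  from indep_vars_iff_distr_eq_PiM'[OF this rv] ind
  have "distr M (PiM {..<n} (\<lambda>_. borel)) (\<lambda>\<omega>. \<lambda>i\<in>{..<n}. (X i \<omega>, Y i \<omega>)) = PiM {..<n} (\<lambda>i. distr M borel (\<lambda>\<omega>. (X i \<omega>, Y i \<omega>)))"
    by simp
  also have "\<dots> = samples (distr M borel (\<lambda>\<omega>. (x \<omega>, y \<omega>))) n"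
    by (rule PiM_cong) (auto simp: d)
  finally show ?thesis .
qed

lemma normalized_form_cong:
  assumes "\<And>i j. i < n \<Longrightarrow> j < n \<Longrightarrow> b i j = b' i j" "\<And>i. i < n \<Longrightarrow> u i = u' i"
  shows "normalized_form n b f h \<rho> u = normalized_form n b' f h \<rho> u'"
proof -
  have "sample_square n g u = sample_square n g u'" for g
    unfolding sample_square_def using assms(2) by (intro arg_cong2[where f = "(/)"] sum.cong) auto
  then show ?thesis unfolding normalized_form_def tr_def using assms
    by (intro arg_cong2[where f = "(/)"] arg_cong2[where f = "(-)"] arg_cong2[where f = "(*)"] sum.cong refl) auto
qed

lemma normalized_form_jointly_measurable:
  assumes f: "f \<in> borel_measurable P" and h: "h \<in> borel_measurable P"
  shows "(\<lambda>(c, u). normalized_form n (\<lambda>i j. c (i, j)) f h \<rho> u)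
     \<in> borel_measurable (PiM ({..<n} \<times> {..<n}) (\<lambda>_. borel) \<Otimes>\<^sub>M samples P n)"
proof -
  let ?X = "PiM ({..<n} \<times> {..<n}) (\<lambda>_. borel :: real measure) \<Otimes>\<^sub>M samples P n"
  have c: "(\<lambda>z. fst z (i, j)) \<in> borel_measurable ?X" if "i < n" "j < n" for i j
    using that by (intro measurable_compose[OF measurable_fst] measurable_component_singleton) auto
  have u: "(\<lambda>z. g (snd z i)) \<in> borel_measurable ?X" if "i < n" "g \<in> borel_measurable P" for g i
    using that by (intro measurable_compose[OF measurable_snd] measurable_compose[OF measurable_component_singleton, of _ "{..<n}" "\<lambda>_. P"]) auto
  have s: "(\<lambda>z. sqrt (sample_square n g (snd z))) \<in> borel_measurable ?X" if "g \<in> borel_measurable P" for g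
    by (rule measurable_compose[OF measurable_snd sqrt_sample_square_measurable[OF that]])
  show ?thesis unfolding normalized_form_def tr_def case_prod_unfold
    by (intro borel_measurable_divide borel_measurable_diff borel_measurable_sum borel_measurable_times borel_measurable_const c u s f h) auto
qed

text \<open>Bounded convergence: split at \<open>\<bar>T n - c\<bar> = \<epsilon>\<close>.\<close>

lemma converges_in_probability_L1:
  assumes M: "prob_space M" and T: "converges_in_probability M T c"
    and bd: "\<And>n. AE s in M. \<bar>T n s\<bar> \<le> K"
  shows "(\<lambda>n. \<integral>s. \<bar>T n s - c\<bar> \<partial>M) \<longlonglongrightarrow> 0" and "\<And>n. integrable M (T n)"
proof -
  interpret prob_space M by (rule M)
  have Tm: "T n \<in> borel_measurable M" for n using T by (auto simp: converges_in_probability_def)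
  have lim: "(\<lambda>n. prob {s \<in> space M. \<bar>T n s - c\<bar> > \<epsilon>}) \<longlonglongrightarrow> 0" if "0 < \<epsilon>" for \<epsilon>
    using T that by (auto simp: converges_in_probability_def)
  show int: "integrable M (T n)" for n
    using bd[of n] Tm by (intro integrable_const_bound[where B = K]) auto
  let ?A = "\<lambda>\<epsilon> n. {s \<in> space M. \<bar>T n s - c\<bar> > \<epsilon>}"
  have Am: "?A \<epsilon> n \<in> sets M" for \<epsilon> n using Tm by measurable
  have le: "(\<integral>s. \<bar>T n s - c\<bar> \<partial>M) \<le> \<epsilon> + (\<bar>K\<bar> + \<bar>c\<bar>) * prob (?A \<epsilon> n)" if \<epsilon>: "0 < \<epsilon>" for \<epsilon> n
  proof -
    have "(\<integral>s. \<bar>T n s - c\<bar> \<partial>M) \<le> (\<integral>s. \<epsilon> + (\<bar>K\<bar> + \<bar>c\<bar>) * indicator (?A \<epsilon> n) s \<partial>M)"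
    proof (rule integral_mono_AE)
      show "integrable M (\<lambda>s. \<bar>T n s - c\<bar>)" using int by simp
      show "integrable M (\<lambda>s. \<epsilon> + (\<bar>K\<bar> + \<bar>c\<bar>) * indicator (?A \<epsilon> n) s)"
        using Am by (intro Bochner_Integration.integrable_add integrable_mult_right integrable_real_indicator) (auto simp: less_top[symmetric])
      show "AE s in M. \<bar>T n s - c\<bar> \<le> \<epsilon> + (\<bar>K\<bar> + \<bar>c\<bar>) * indicator (?A \<epsilon> n) s"
        using bd[of n] AE_space
      proof eventually_elim
        case (elim s)
        show ?case
        proof (cases "\<bar>T n s - c\<bar> > \<epsilon>")
          case True
          have "\<bar>T n s - c\<bar> \<le> \<bar>T n s\<bar> + \<bar>c\<bar>" by (rule abs_triangle_ineq4)
          then have "\<bar>T n s - c\<bar> \<le> \<bar>K\<bar> + \<bar>c\<bar>" using elim(1) by linarith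
          then show ?thesis using True elim(2) \<epsilon> by simp
        qed simp
      qed
    qed
    also have "\<dots> = \<epsilon> + (\<bar>K\<bar> + \<bar>c\<bar>) * prob (?A \<epsilon> n)"
      using Am by (simp add: prob_space less_top[symmetric])
    finally show ?thesis .
  qed
  show "(\<lambda>n. \<integral>s. \<bar>T n s - c\<bar> \<partial>M) \<longlonglongrightarrow> 0"
  proof (rule LIMSEQ_I)
    fix r :: real assume r: "0 < r"
    have "(\<lambda>n. r / 2 + (\<bar>K\<bar> + \<bar>c\<bar>) * prob (?A (r / 2) n)) \<longlonglongrightarrow> r / 2 + (\<bar>K\<bar> + \<bar>c\<bar>) * 0"
      by (intro tendsto_intros lim) (use r in simp)
    from order_tendstoD(2)[OF this, of r] r
    obtain no where no: "\<And>n. n \<ge> no \<Longrightarrow> r / 2 + (\<bar>K\<bar> + \<bar>c\<bar>) * prob (?A (r / 2) n) < r" by (auto simp: eventually_sequentially)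
    have "norm ((\<integral>s. \<bar>T n s - c\<bar> \<partial>M) - 0) < r" if "n \<ge> no" for n
    proof -
      have "0 \<le> (\<integral>s. \<bar>T n s - c\<bar> \<partial>M)" by (rule Bochner_Integration.integral_nonneg) simp
      moreover have "(\<integral>s. \<bar>T n s - c\<bar> \<partial>M) < r" using le[of "r / 2" n] no[OF that] r by linarith
      ultimately show ?thesis by (simp only: diff_zero real_norm_def abs_of_nonneg)
    qed
    then show "\<exists>no. \<forall>n\<ge>no. norm ((\<integral>s. \<bar>T n s - c\<bar> \<partial>M) - 0) < r" by blast
  qed
qed

section \<open>Random variances and quadratic forms of covariance matrices\<close>

text \<open>Expresses the variance through the three averages of the theorem: the squared Frobenius norm of a
symmetric matrix is the trace of its square.\<close>

lemma quad_var_spectral: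
  assumes b: "op_bounded n \<beta> b"
  shows "quad_var n b J s r = (tr n (mmult n b b) / n - (\<Sum>i<n. (b i i)\<^sup>2) / n) * J + (\<Sum>i<n. (b i i)\<^sup>2) / n * s + (tr n b / n)\<^sup>2 * r"
    and "\<bar>tr n (mmult n b b) / n\<bar> \<le> \<beta>\<^sup>2" "\<bar>(\<Sum>i<n. (b i i)\<^sup>2) / n\<bar> \<le> \<beta>\<^sup>2" "\<bar>(tr n b / n)\<^sup>2\<bar> \<le> \<beta>\<^sup>2"
proof -
  have t: "tr n (mmult n b b) = (\<Sum>i<n. \<Sum>j<n. (b i j)\<^sup>2)"
    unfolding tr_def mmult_def using op_boundedD(2)[OF b] by (intro sum.cong refl) (simp add: power2_eq_square)
  have "(\<Sum>j<n. (b i j)\<^sup>2) = (\<Sum>j<n. (off_diagonal b i j)\<^sup>2) + (b i i)\<^sup>2" if "i < n" for i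
    using that by (subst (1 2) sum.remove[of "{..<n}" i]) (auto simp: off_diagonal_def intro!: sum.cong)
  then have "tr n (mmult n b b) = (\<Sum>i<n. \<Sum>j<n. (off_diagonal b i j)\<^sup>2) + (\<Sum>i<n. (b i i)\<^sup>2)"
    unfolding t by (simp add: sum.distrib)
  then have "(\<Sum>i<n. \<Sum>j<n. (off_diagonal b i j)\<^sup>2) / n = tr n (mmult n b b) / n - (\<Sum>i<n. (b i i)\<^sup>2) / n"
    by (simp add: add_divide_distrib)
  then show "quad_var n b J s r = (tr n (mmult n b b) / n - (\<Sum>i<n. (b i i)\<^sup>2) / n) * J + (\<Sum>i<n. (b i i)\<^sup>2) / n * s + (tr n b / n)\<^sup>2 * r"
    unfolding quad_var_def by simp
  show "\<bar>tr n (mmult n b b) / n\<bar> \<le> \<beta>\<^sup>2"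
    using le_n_imp_div_le[OF op_bounded_frobenius[OF b]] unfolding t by (simp add: sum_nonneg)
  show "\<bar>(\<Sum>i<n. (b i i)\<^sup>2) / n\<bar> \<le> \<beta>\<^sup>2"
    using le_n_imp_div_le[OF diagonal_mean_square_le[OF b]] by (simp add: sum_nonneg)
  show "\<bar>(tr n b / n)\<^sup>2\<bar> \<le> \<beta>\<^sup>2"
    using power_mono[OF mean_diagonal_le[OF b] abs_ge_zero, of 2] by (simp only: power2_abs abs_power2)
qed

lemma quad_form_linear:
  fixes A B :: "real ^ 'm ^ 'm"
  shows "quad_form (A + B) t = quad_form A t + quad_form B t"
    and "quad_form (A - B) t = quad_form A t - quad_form B t"
    and "quad_form (c *\<^sub>R A) t = c * quad_form A t"
  unfolding quad_form_eq
  by (simp_all add: distrib_left distrib_right left_diff_distrib right_diff_distrib sum.distrib sum_subtractf sum_distrib_left mult_ac)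

lemma quad_form_cov_mat:
  fixes u v :: "'a \<Rightarrow> real ^ 'm"
  assumes u: "\<And>l. square_integrable M (\<lambda>s. u s $ l - (\<integral>s. u s $ l \<partial>M))" and v: "\<And>l. square_integrable M (\<lambda>s. v s $ l - (\<integral>s. v s $ l \<partial>M))"
  shows "quad_form (cov_mat M u v) t = (\<integral>s. (\<Sum>i\<in>UNIV. t $ i * (u s $ i - (\<integral>s. u s $ i \<partial>M))) * (\<Sum>j\<in>UNIV. t $ j * (v s $ j - (\<integral>s. v s $ j \<partial>M))) \<partial>M)"
proof -
  let ?u = "\<lambda>i s. u s $ i - (\<integral>s. u s $ i \<partial>M)" and ?v = "\<lambda>i s. v s $ i - (\<integral>s. v s $ i \<partial>M)"
  have i: "integrable M (\<lambda>s. ?u i s * ?v j s)" for i j by (rule square_integrable_mult[OF u v])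
  have "(\<Sum>i\<in>UNIV. t $ i * ?u i s) * (\<Sum>j\<in>UNIV. t $ j * ?v j s) = (\<Sum>i\<in>UNIV. \<Sum>j\<in>UNIV. t $ i * t $ j * (?u i s * ?v j s))" for s
    unfolding sum_product by (intro sum.cong refl) (simp only: mult_ac)
  then have "(\<integral>s. (\<Sum>i\<in>UNIV. t $ i * ?u i s) * (\<Sum>j\<in>UNIV. t $ j * ?v j s) \<partial>M) = (\<Sum>i\<in>UNIV. \<Sum>j\<in>UNIV. t $ i * t $ j * (\<integral>s. ?u i s * ?v j s \<partial>M))"
    using i by (simp only: Bochner_Integration.integral_sum Bochner_Integration.integrable_sum integrable_mult_right integral_mult_right_zero)
  also have "\<dots> = quad_form (cov_mat M u v) t"
    unfolding quad_form_eq cov_mat_def by (intro sum.cong refl) (simp add: mult_ac)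
  finally show ?thesis by simp
qed

lemma transpose_linear:
  fixes A B :: "real ^ 'm ^ 'm"
  shows "transpose (A + B) = transpose A + transpose B" "transpose (A - B) = transpose A - transpose B" "transpose (c *\<^sub>R A) = c *\<^sub>R transpose A"
    "transpose (A * B) = transpose A * transpose B"
  by (simp_all add: transpose_def vec_eq_iff)

lemma transpose_cov_mat: "transpose (cov_mat M u v) = cov_mat M v u"
  by (simp add: transpose_def cov_mat_def vec_eq_iff mult.commute)

lemma square_integrable_distr:
  assumes "g \<in> measurable M N" "F \<in> borel_measurable N" "square_integrable M (\<lambda>s. F (g s))"
  shows "square_integrable (distr M N g) F"
proof -
  have F2: "(\<lambda>v. (F v)\<^sup>2) \<in> borel_measurable N" using assms(2) by simp
  show ?thesis
    unfolding square_integrable_def integrable_distr_eq[OF assms(1) F2]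
    using assms(2,3) by (simp add: square_integrable_def)
qed

text \<open>The exponential is Lipschitz on the bounded range of \<open>V n\<close>, and \<open>V n\<close> is linear in the three
averages, so \<open>L\<^sup>1\<close> convergence of these is enough.\<close>

lemma random_variance_limit:
  fixes Th Om Ph :: "nat \<Rightarrow> 'a \<Rightarrow> real" and J s r :: real
  assumes M: "prob_space M"
    and Th: "converges_in_probability M Th \<theta>" "\<And>n. AE s in M. \<bar>Th n s\<bar> \<le> K"
    and Om: "converges_in_probability M Om \<omega>" "\<And>n. AE s in M. \<bar>Om n s\<bar> \<le> K"
    and Ph: "converges_in_probability M Ph \<phi>" "\<And>n. AE s in M. \<bar>Ph n s\<bar> \<le> K"
  defines "v \<equiv> (\<theta> - \<omega>) * J + \<omega> * s + \<phi> * r"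
    and "V \<equiv> \<lambda>n x. (Th n x - Om n x) * J + Om n x * s + Ph n x * r"
  shows "(\<lambda>n. \<integral>x. exp (- V n x / 2) \<partial>M) \<longlonglongrightarrow> exp (- v / 2)" and "\<And>n. integrable M (\<lambda>x. exp (- V n x / 2))"
proof -
  interpret prob_space M by (rule M)
  note L = converges_in_probability_L1[OF M Th] converges_in_probability_L1[OF M Om] converges_in_probability_L1[OF M Ph]
  define B where "B = (\<bar>K\<bar> + \<bar>K\<bar>) * \<bar>J\<bar> + \<bar>K\<bar> * \<bar>s\<bar> + \<bar>K\<bar> * \<bar>r\<bar>"
  define C where "C = exp ((B + \<bar>v\<bar>) / 2)"
  have B0: "0 \<le> B" unfolding B_def by simp
  have VB: "AE x in M. \<bar>V n x\<bar> \<le> B" for n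
    using Th(2)[of n] Om(2)[of n] Ph(2)[of n]
  proof eventually_elim
    case (elim x)
    have a: "\<bar>Th n x - Om n x\<bar> \<le> \<bar>K\<bar> + \<bar>K\<bar>" "\<bar>Om n x\<bar> \<le> \<bar>K\<bar>" "\<bar>Ph n x\<bar> \<le> \<bar>K\<bar>" using elim by linarith+
    have "\<bar>(Th n x - Om n x) * J\<bar> \<le> (\<bar>K\<bar> + \<bar>K\<bar>) * \<bar>J\<bar>" "\<bar>Om n x * s\<bar> \<le> \<bar>K\<bar> * \<bar>s\<bar>" "\<bar>Ph n x * r\<bar> \<le> \<bar>K\<bar> * \<bar>r\<bar>"
      unfolding abs_mult by (intro mult_right_mono a abs_ge_zero)+
    then show ?case unfolding V_def B_def
      by (intro order_trans[OF abs_triangle_ineq] add_mono order_trans[OF abs_triangle_ineq[of "(Th n x - Om n x) * J"]])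
  qed
  have Vm: "V n \<in> borel_measurable M" for n
    unfolding V_def using L(2,4,6) by (intro borel_measurable_add borel_measurable_diff borel_measurable_times borel_measurable_const) auto
  have iV: "integrable M (V n)" for n
    using Vm VB[of n] by (intro integrable_const_bound[where B = B]) auto
  show ie: "integrable M (\<lambda>x. exp (- V n x / 2))" for n
  proof (rule integrable_const_bound[where B = "exp (B / 2)"])
    show "AE x in M. norm (exp (- V n x / 2)) \<le> exp (B / 2)" using VB[of n] by eventually_elim auto
  qed (use Vm in measurable)
  let ?d = "\<lambda>n. (\<integral>x. \<bar>Th n x - \<theta>\<bar> \<partial>M) * \<bar>J\<bar> + (\<integral>x. \<bar>Om n x - \<omega>\<bar> \<partial>M) * (\<bar>J\<bar> + \<bar>s\<bar>) + (\<integral>x. \<bar>Ph n x - \<phi>\<bar> \<partial>M) * \<bar>r\<bar>"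
  have le: "\<bar>(\<integral>x. exp (- V n x / 2) \<partial>M) - exp (- v / 2)\<bar> \<le> C * ?d n" for n
  proof -
    have C0: "0 \<le> C" by (simp add: C_def)
    have dV: "\<bar>V n x - v\<bar> \<le> \<bar>Th n x - \<theta>\<bar> * \<bar>J\<bar> + \<bar>Om n x - \<omega>\<bar> * (\<bar>J\<bar> + \<bar>s\<bar>) + \<bar>Ph n x - \<phi>\<bar> * \<bar>r\<bar>" for x
    proof -
      have "V n x - v = (Th n x - \<theta>) * J + (Om n x - \<omega>) * (s - J) + (Ph n x - \<phi>) * r"
        unfolding V_def v_def by (simp add: algebra_simps)
      also have "\<bar>\<dots>\<bar> \<le> \<bar>(Th n x - \<theta>) * J\<bar> + \<bar>(Om n x - \<omega>) * (s - J)\<bar> + \<bar>(Ph n x - \<phi>) * r\<bar>"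
        by (rule order_trans[OF abs_triangle_ineq add_right_mono[OF abs_triangle_ineq]])
      also have "\<dots> \<le> \<bar>Th n x - \<theta>\<bar> * \<bar>J\<bar> + \<bar>Om n x - \<omega>\<bar> * (\<bar>J\<bar> + \<bar>s\<bar>) + \<bar>Ph n x - \<phi>\<bar> * \<bar>r\<bar>"
        unfolding abs_mult by (intro add_mono mult_left_mono order_refl) auto
      finally show ?thesis .
    qed
    have "(\<integral>x. exp (- V n x / 2) \<partial>M) - exp (- v / 2) = (\<integral>x. exp (- V n x / 2) - exp (- v / 2) \<partial>M)"
      using ie by (simp add: prob_space)
    also have "\<bar>\<dots>\<bar> \<le> (\<integral>x. \<bar>exp (- V n x / 2) - exp (- v / 2)\<bar> \<partial>M)" by (rule integral_abs_bound)
    also have "\<dots> \<le> (\<integral>x. C * (\<bar>Th n x - \<theta>\<bar> * \<bar>J\<bar> + \<bar>Om n x - \<omega>\<bar> * (\<bar>J\<bar> + \<bar>s\<bar>) + \<bar>Ph n x - \<phi>\<bar> * \<bar>r\<bar>) \<partial>M)"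
    proof (rule integral_mono_AE)
      show "integrable M (\<lambda>x. \<bar>exp (- V n x / 2) - exp (- v / 2)\<bar>)" using ie by simp
      show "integrable M (\<lambda>x. C * (\<bar>Th n x - \<theta>\<bar> * \<bar>J\<bar> + \<bar>Om n x - \<omega>\<bar> * (\<bar>J\<bar> + \<bar>s\<bar>) + \<bar>Ph n x - \<phi>\<bar> * \<bar>r\<bar>))"
        using L(2,4,6) by simp
      show "AE x in M. \<bar>exp (- V n x / 2) - exp (- v / 2)\<bar> \<le> C * (\<bar>Th n x - \<theta>\<bar> * \<bar>J\<bar> + \<bar>Om n x - \<omega>\<bar> * (\<bar>J\<bar> + \<bar>s\<bar>) + \<bar>Ph n x - \<phi>\<bar> * \<bar>r\<bar>)"
        using VB[of n]
      proof eventually_elim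
        case (elim x)
        have "- V n x \<le> B" "- v \<le> \<bar>v\<bar>" "0 \<le> \<bar>v\<bar>" using elim by auto
        then have "- V n x / 2 \<le> (B + \<bar>v\<bar>) / 2" "- v / 2 \<le> (B + \<bar>v\<bar>) / 2" using B0 by (simp_all del: abs_ge_minus_self)
        from exp_lipschitz[OF this]
        have "\<bar>exp (- V n x / 2) - exp (- v / 2)\<bar> \<le> C * \<bar>- V n x / 2 - - v / 2\<bar>" unfolding C_def .
        also have "\<bar>- V n x / 2 - - v / 2\<bar> = \<bar>V n x - v\<bar> / 2"
        proof -
          have "- V n x / 2 - - v / 2 = - ((V n x - v) / 2)" by (simp add: diff_divide_distrib)
          then show ?thesis by (simp only: abs_minus_cancel abs_divide abs_numeral)
        qed
        also have "C * (\<bar>V n x - v\<bar> / 2) \<le> C * \<bar>V n x - v\<bar>" using C0 by (intro mult_left_mono) auto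
        also have "\<dots> \<le> C * (\<bar>Th n x - \<theta>\<bar> * \<bar>J\<bar> + \<bar>Om n x - \<omega>\<bar> * (\<bar>J\<bar> + \<bar>s\<bar>) + \<bar>Ph n x - \<phi>\<bar> * \<bar>r\<bar>)"
          by (intro mult_left_mono dV C0)
        finally show ?case .
      qed
    qed
    also have "\<dots> = C * ?d n" using L(2,4,6) by simp
    finally show ?thesis .
  qed
  have "(\<lambda>n. C * ?d n) \<longlonglongrightarrow> C * (0 * \<bar>J\<bar> + 0 * (\<bar>J\<bar> + \<bar>s\<bar>) + 0 * \<bar>r\<bar>)"
    by (intro tendsto_intros L(1,3,5))
  then have z: "(\<lambda>n. C * ?d n) \<longlonglongrightarrow> 0" by simp
  have "(\<lambda>n. (\<integral>x. exp (- V n x / 2) \<partial>M) - exp (- v / 2)) \<longlonglongrightarrow> 0"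
    by (rule Lim_null_comparison[OF _ z]) (use le in auto)
  then show "(\<lambda>n. \<integral>x. exp (- V n x / 2) \<partial>M) \<longlonglongrightarrow> exp (- v / 2)" by (simp add: LIM_zero_iff)
qed

section \<open>The limit law of the normalized bilinear forms\<close>

locale bilinear_setting =
  fixes M :: "'a measure" and x y :: "'a \<Rightarrow> real ^ 'm"
    and X Y :: "nat \<Rightarrow> nat \<Rightarrow> 'a \<Rightarrow> real ^ 'm"
    and B :: "nat \<Rightarrow> 'a \<Rightarrow> nat \<Rightarrow> nat \<Rightarrow> real"
    and \<beta> \<omega> \<theta> \<phi> :: real
  assumes M: "prob_space M"
    and x: "x \<in> borel_measurable M" and y: "y \<in> borel_measurable M"
    and x_sq: "\<And>l. integrable M (\<lambda>s. (x s $ l)\<^sup>2)" and y_sq: "\<And>l. integrable M (\<lambda>s. (y s $ l)\<^sup>2)"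
    and x_mean: "\<And>l. (\<integral>s. x s $ l \<partial>M) = 0" and y_mean: "\<And>l. (\<integral>s. y s $ l \<partial>M) = 0"
    and x_var: "\<And>l. cov_mat M x x $ l $ l = 1" and y_var: "\<And>l. cov_mat M y y $ l $ l = 1"
    and z_sq: "\<And>l. integrable M (\<lambda>s. (zvec x y s $ l)\<^sup>2)"
    and w_sq: "\<And>l. integrable M (\<lambda>s. (wvec M x y s $ l)\<^sup>2)"
    and iid: "\<And>n. iid_observations M x y n (X n) (Y n)"
    and indep: "\<And>n. indep_of_data M n (B n) (X n) (Y n)"
    and B_sym: "\<And>n. AE s in M. \<forall>i<n. \<forall>j<n. B n s i j = B n s j i"
    and B_norm: "\<And>n. AE s in M. spectral_norm n (B n s) \<le> \<beta>"
    and lim_\<omega>: "converges_in_probability M (\<lambda>n s. (\<Sum>i<n. (B n s i i)\<^sup>2) / real n) \<omega>"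
    and lim_\<theta>: "converges_in_probability M (\<lambda>n s. tr n (mmult n (B n s) (B n s)) / real n) \<theta>"
    and lim_\<phi>: "converges_in_probability M (\<lambda>n s. (tr n (B n s) / real n)\<^sup>2) \<phi>"
begin

sublocale M: prob_space M by (rule M)

abbreviation "f \<equiv> \<lambda>l (v :: (real ^ 'm) \<times> (real ^ 'm)). fst v $ l"
abbreviation "h \<equiv> \<lambda>l (v :: (real ^ 'm) \<times> (real ^ 'm)). snd v $ l"
abbreviation "\<rho> \<equiv> rho M x y"

definition P where "P = distr M borel (\<lambda>s. (x s, y s))"

lemma pair_measurable: "(\<lambda>s. (x s, y s)) \<in> borel_measurable M"
  using x y by (rule borel_measurable_Pair)

lemma prob_P: "prob_space P"
  unfolding P_def by (rule M.prob_space_distr[OF pair_measurable])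

lemma coordinate_measurable: "f l \<in> borel_measurable borel" "h l \<in> borel_measurable borel"
  by (intro borel_measurable_continuous_onI continuous_intros)+

lemma integral_P:
  fixes F :: "(real ^ 'm) \<times> (real ^ 'm) \<Rightarrow> real"
  shows "F \<in> borel_measurable borel \<Longrightarrow> integral\<^sup>L P F = (\<integral>s. F (x s, y s) \<partial>M)"
  unfolding P_def by (rule integral_distr[OF pair_measurable])

lemma x_L2: "square_integrable M (\<lambda>s. x s $ l)" and y_L2: "square_integrable M (\<lambda>s. y s $ l)"
  using x_sq y_sq measurable_compose[OF pair_measurable coordinate_measurable(1)]
    measurable_compose[OF pair_measurable coordinate_measurable(2)]
  by (auto simp: square_integrable_def)

lemma x_norm: "(\<integral>s. (x s $ l)\<^sup>2 \<partial>M) = 1" and y_norm: "(\<integral>s. (y s $ l)\<^sup>2 \<partial>M) = 1"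
  using x_var[of l] y_var[of l] by (simp_all add: cov_mat_def x_mean y_mean power2_eq_square)

lemma rho_eq: "\<rho> l = (\<integral>s. x s $ l * y s $ l \<partial>M)"
  by (simp add: rho_def cov_mat_def x_mean y_mean)

lemma z_L2: "square_integrable M (\<lambda>s. zvec x y s $ l)"
  using z_sq[of l] x_L2[of l] y_L2[of l] by (auto simp: square_integrable_def zvec_def)

lemma w_L2: "square_integrable M (\<lambda>s. wvec M x y s $ l)"
  using w_sq[of l] x_L2[of l] y_L2[of l] by (auto simp: square_integrable_def wvec_def)

lemma z_mean: "(\<integral>s. zvec x y s $ l \<partial>M) = \<rho> l"
  by (simp add: zvec_def rho_eq)

lemma w_mean: "(\<integral>s. wvec M x y s $ l \<partial>M) = \<rho> l"
  using x_sq[of l] y_sq[of l] by (simp add: wvec_def x_norm y_norm)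

text \<open>If \<open>\<rho> l \<noteq> 0\<close> then \<open>x\<^sub>l\<^sup>2 + y\<^sub>l\<^sup>2\<close> is a multiple of \<open>w\<^sub>l\<close>, whose square is integrable.\<close>

lemma fourth_moment:
  assumes r: "\<rho> l \<noteq> 0"
  shows "square_integrable M (\<lambda>s. (x s $ l)\<^sup>2)" "square_integrable M (\<lambda>s. (y s $ l)\<^sup>2)"
proof -
  have xm: "(\<lambda>s. x s $ l) \<in> borel_measurable M" and ym: "(\<lambda>s. y s $ l) \<in> borel_measurable M"
    using x_L2 y_L2 by (auto simp: square_integrable_def)
  have i: "integrable M (\<lambda>s. (2 / \<rho> l)\<^sup>2 * (wvec M x y s $ l)\<^sup>2)" using w_sq by simp
  have e: "(2 / \<rho> l)\<^sup>2 * (wvec M x y s $ l)\<^sup>2 = ((x s $ l)\<^sup>2 + (y s $ l)\<^sup>2)\<^sup>2" for s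
    unfolding wvec_def power_mult_distrib[symmetric] using r by simp
  have le: "norm (a\<^sup>2) \<le> norm ((a + c)\<^sup>2)" "norm (c\<^sup>2) \<le> norm ((a + c)\<^sup>2)" if "0 \<le> a" "0 \<le> c" for a c :: real
    using that by (auto simp only: real_norm_def abs_power2 intro!: power_mono)
  have "integrable M (\<lambda>s. ((x s $ l)\<^sup>2)\<^sup>2)"
    by (rule Bochner_Integration.integrable_bound[OF i[unfolded e]])
       (use xm in \<open>simp, intro AE_I2 le(1) zero_le_power2\<close>)
  then show "square_integrable M (\<lambda>s. (x s $ l)\<^sup>2)" using xm by (simp add: square_integrable_def)
  have "integrable M (\<lambda>s. ((y s $ l)\<^sup>2)\<^sup>2)"
    by (rule Bochner_Integration.integrable_bound[OF i[unfolded e]])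
       (use ym in \<open>simp, intro AE_I2 le(2) zero_le_power2\<close>)
  then show "square_integrable M (\<lambda>s. (y s $ l)\<^sup>2)" using ym by (simp add: square_integrable_def)
qed

lemma square_integrable_P:
  "F \<in> borel_measurable borel \<Longrightarrow> square_integrable M (\<lambda>s. F (x s, y s)) \<Longrightarrow> square_integrable P F"
  unfolding P_def by (rule square_integrable_distr[OF pair_measurable])

text \<open>\<open>zeta t\<close> and \<open>eta t\<close> are the centred variables \<open>t \<bullet> z\<close> and \<open>t \<bullet> w\<close> as functions of one
observation. The numbers \<open>var_J t\<close>, \<open>var_K1 t\<close>, \<open>var_K2 t\<close> turn out to be the values at \<open>t\<close> of the quadratic
forms of the matrices \<open>J\<close>, \<open>K\<^sub>1\<close>, \<open>K\<^sub>2\<close>.\<close>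

definition zeta where "zeta t = (\<lambda>v. \<Sum>l\<in>UNIV. t $ l * (f l v * h l v - \<rho> l))" for t :: "real ^ 'm"
definition eta where "eta t = (\<lambda>v. \<Sum>l\<in>UNIV. t $ l * (\<rho> l * ((f l v)\<^sup>2 + (h l v)\<^sup>2) / 2 - \<rho> l))" for t :: "real ^ 'm"
definition stat where "stat t n b u = (\<Sum>l\<in>UNIV. t $ l * normalized_form n b (f l) (h l) (\<rho> l) u)" for t :: "real ^ 'm" and n b u
definition var_J where "var_J t = kernel_variance P UNIV (\<lambda>l v. t $ l * f l v) h" for t :: "real ^ 'm"
definition var_K1 where "var_K1 t = moment P (zeta t) (zeta t)" for t
definition var_K2 where "var_K2 t = moment P (eta t) (eta t) - 2 * moment P (zeta t) (eta t)" for t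

lemma char_stat:
  assumes \<epsilon>: "0 < (\<epsilon>::real)" and \<beta>: "0 \<le> \<beta>"
  shows "\<forall>\<^sub>F n in sequentially. \<forall>b. op_bounded n \<beta> b \<longrightarrow>
     norm ((\<integral>u. iexp (stat t n b u) \<partial>samples P n) - complex_of_real (exp (- quad_var n b (var_J t) (var_K1 t) (var_K2 t) / 2))) < \<epsilon>"
  unfolding stat_def var_J_def var_K1_def var_K2_def zeta_def eta_def
proof (rule char_normalized_form[OF prob_P finite_class.finite_UNIV \<beta> \<epsilon>])
  fix l :: 'm
  note fm = coordinate_measurable(1)[of l] and hm = coordinate_measurable(2)[of l]
  show "square_integrable P (f l)" by (rule square_integrable_P[OF fm]) (simp add: x_L2)
  show "square_integrable P (h l)" by (rule square_integrable_P[OF hm]) (simp add: y_L2)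
  show "integral\<^sup>L P (f l) = 0" using integral_P[OF fm] by (simp add: x_mean)
  show "integral\<^sup>L P (h l) = 0" using integral_P[OF hm] by (simp add: y_mean)
  show "(\<integral>v. (f l v)\<^sup>2 \<partial>P) = 1" using integral_P[OF borel_measurable_power[OF fm, of 2]] by (simp add: x_norm)
  show "(\<integral>v. (h l v)\<^sup>2 \<partial>P) = 1" using integral_P[OF borel_measurable_power[OF hm, of 2]] by (simp add: y_norm)
  show "square_integrable P (\<lambda>v. f l v * h l v)"
    by (rule square_integrable_P[OF borel_measurable_times[OF fm hm]]) (use z_L2[of l] in \<open>simp add: zvec_def\<close>)
  show "\<rho> l = (\<integral>v. f l v * h l v \<partial>P)" using integral_P[OF borel_measurable_times[OF fm hm]] by (simp add: rho_eq)
  show "square_integrable P (\<lambda>v. (f l v)\<^sup>2)" if "\<rho> l \<noteq> 0"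
    by (rule square_integrable_P[OF borel_measurable_power[OF fm]]) (use fourth_moment[OF that] in simp)
  show "square_integrable P (\<lambda>v. (h l v)\<^sup>2)" if "\<rho> l \<noteq> 0"
    by (rule square_integrable_P[OF borel_measurable_power[OF hm]]) (use fourth_moment[OF that] in simp)
qed

definition Z where "Z n = bilinear_stat M x y n (B n) (X n) (Y n)" for n

text \<open>Restricted to the relevant indices, these are the random elements of product spaces whose
independence is assumed.\<close>

definition data where "data n s = (\<lambda>i\<in>{..<n}. (X n i s, Y n i s))" for n s
definition B_entries where "B_entries n s = (\<lambda>(i, j)\<in>{..<n} \<times> {..<n}. B n s i j)" for n s

abbreviation "matrix_space n \<equiv> PiM ({..<n} \<times> {..<n}) (\<lambda>_. borel :: real measure)"
abbreviation "data_space n \<equiv> PiM {..<n} (\<lambda>_. borel :: ((real ^ 'm) \<times> (real ^ 'm)) measure)"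

lemma indep_mat_data: "indep_rv M (matrix_space n) (B_entries n) (data_space n) (data n)"
  using indep[of n] unfolding indep_of_data_def B_entries_def[abs_def] data_def[abs_def] .

lemma Z_component: "Z n s $ l = normalized_form n (B n s) (f l) (h l) (\<rho> l) (\<lambda>i. (X n i s, Y n i s))"
  by (simp add: Z_def bilinear_stat_def normalized_form_def normalized_def sigma2_hat_def sample_square_def)

lemma Z_component_restricted: "Z n s $ l = normalized_form n (\<lambda>i j. B_entries n s (i, j)) (f l) (h l) (\<rho> l) (data n s)"
  unfolding Z_component by (rule normalized_form_cong) (simp_all add: B_entries_def data_def)

lemma form_measurable:
  "(\<lambda>(c, u). normalized_form n (\<lambda>i j. c (i, j)) (f l) (h l) (\<rho> l) u) \<in> borel_measurable (matrix_space n \<Otimes>\<^sub>M data_space n)"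
  by (rule normalized_form_jointly_measurable[OF coordinate_measurable])

lemma Z_measurable: "Z n \<in> borel_measurable M"
proof -
  have "B_entries n \<in> measurable M (matrix_space n)" "data n \<in> measurable M (data_space n)"
    using indep_mat_data[of n] by (auto simp: indep_rv_def)
  then have pr: "(\<lambda>s. (B_entries n s, data n s)) \<in> measurable M (matrix_space n \<Otimes>\<^sub>M data_space n)" by (rule measurable_Pair)
  have c: "(\<lambda>s. Z n s $ l) \<in> borel_measurable M" for l
    using measurable_compose[OF pr form_measurable[of n l]] unfolding Z_component_restricted case_prod_conv .
  show ?thesis
  proof (rule iffD2[OF borel_measurable_euclidean_space], rule ballI)
    fix i :: "real ^ 'm" assume "i \<in> Basis"
    then obtain l where "i = axis l 1" by (auto simp: Basis_vec_def)
    then show "(\<lambda>s. Z n s \<bullet> i) \<in> borel_measurable M" using c[of l] by (simp add: inner_axis)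
  qed
qed

lemma inner_Z: "t \<bullet> Z n s = stat t n (\<lambda>i j. B_entries n s (i, j)) (data n s)"
  unfolding inner_vec_def stat_def Z_component_restricted by simp

lemma stat_mat: "stat t n (\<lambda>i j. B_entries n s (i, j)) u = stat t n (B n s) u"
  unfolding stat_def by (intro sum.cong refl arg_cong2[where f = "(*)"] normalized_form_cong) (simp_all add: B_entries_def)

lemma data_distr: "0 < n \<Longrightarrow> distr M (data_space n) (data n) = samples P n"
  unfolding P_def data_def[abs_def] by (rule iid_observations_distr[OF M x y iid])

text \<open>Fubini for the independent pair \<open>(B n, data n)\<close>: the inner integral is the characteristic function for
a fixed matrix.\<close>

lemma char_conditional:
  assumes n: "0 < n"
  shows "(\<integral>s. iexp (t \<bullet> Z n s) \<partial>M) = (\<integral>s. (\<integral>u. iexp (stat t n (B n s) u) \<partial>samples P n) \<partial>M)"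
    and "(\<lambda>s. \<integral>u. iexp (stat t n (B n s) u) \<partial>samples P n) \<in> borel_measurable M"
proof -
  define H where "H c u = iexp (stat t n (\<lambda>i j. c (i, j)) u)" for c :: "nat \<times> nat \<Rightarrow> real" and u
  have "(\<lambda>z. stat t n (\<lambda>i j. fst z (i, j)) (snd z)) \<in> borel_measurable (matrix_space n \<Otimes>\<^sub>M data_space n)"
    unfolding stat_def using form_measurable by (intro borel_measurable_sum borel_measurable_times borel_measurable_const) (simp add: case_prod_unfold)
  from measurable_compose[OF this, of iexp borel]
  have Hm: "case_prod H \<in> borel_measurable (matrix_space n \<Otimes>\<^sub>M data_space n)"
    unfolding H_def case_prod_unfold by (simp add: borel_measurable_continuous_onI continuous_intros)
  have Hb: "norm (H a b) \<le> 1" for a b by (simp add: H_def)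
  note r = indep_rv_integral[OF M indep_mat_data[of n] Hm Hb, unfolded data_distr[OF n]]
  show "(\<integral>s. iexp (t \<bullet> Z n s) \<partial>M) = (\<integral>s. (\<integral>u. iexp (stat t n (B n s) u) \<partial>samples P n) \<partial>M)"
    using r(1) unfolding H_def inner_Z stat_mat .
  have "B_entries n \<in> measurable M (matrix_space n)" using indep_mat_data[of n] by (auto simp: indep_rv_def)
  from measurable_compose[OF this r(2)]
  show "(\<lambda>s. \<integral>u. iexp (stat t n (B n s) u) \<partial>samples P n) \<in> borel_measurable M"
    unfolding H_def stat_mat .
qed

lemma op_bounded_B: "AE s in M. op_bounded n \<beta> (B n s)"
  using B_sym[of n] B_norm[of n] by eventually_elim (auto intro: op_bounded_spectral_norm)

lemma \<beta>_nonneg: "0 \<le> \<beta>"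
proof -
  have "AE s in M. 0 \<le> \<beta>" using op_bounded_B[of 0] by eventually_elim (rule op_boundedD(1))
  then show ?thesis by simp
qed

definition limit_variance where "limit_variance t = (\<theta> - \<omega>) * var_J t + \<omega> * var_K1 t + \<phi> * var_K2 t" for t

text \<open>For almost every value of \<open>B n\<close> the inner characteristic function is uniformly close to
\<open>exp (- V / 2)\<close>, where \<open>V\<close> is the variance belonging to that value; the mean of the latter has the
stated limit.\<close>

theorem char_Z_tendsto:
  "(\<lambda>n. \<integral>s. iexp (t \<bullet> Z n s) \<partial>M) \<longlonglongrightarrow> complex_of_real (exp (- limit_variance t / 2))"
proof -
  define Om Th Ph where "Om n s = (\<Sum>i<n. (B n s i i)\<^sup>2) / real n" and "Th n s = tr n (mmult n (B n s) (B n s)) / real n"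
    and "Ph n s = (tr n (B n s) / real n)\<^sup>2" for n s
  have bd: "AE s in M. \<bar>Om n s\<bar> \<le> \<beta>\<^sup>2" "AE s in M. \<bar>Th n s\<bar> \<le> \<beta>\<^sup>2" "AE s in M. \<bar>Ph n s\<bar> \<le> \<beta>\<^sup>2" for n
  proof -
    show "AE s in M. \<bar>Om n s\<bar> \<le> \<beta>\<^sup>2"
      unfolding Om_def using op_bounded_B[of n] by eventually_elim (rule quad_var_spectral(3))
    show "AE s in M. \<bar>Th n s\<bar> \<le> \<beta>\<^sup>2"
      unfolding Th_def using op_bounded_B[of n] by eventually_elim (rule quad_var_spectral(2))
    show "AE s in M. \<bar>Ph n s\<bar> \<le> \<beta>\<^sup>2"
      unfolding Ph_def using op_bounded_B[of n] by eventually_elim (rule quad_var_spectral(4))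
  qed
  let ?V = "\<lambda>n s. (Th n s - Om n s) * var_J t + Om n s * var_K1 t + Ph n s * var_K2 t"
  note rv = random_variance_limit[OF M lim_\<theta>[folded Th_def] bd(2) lim_\<omega>[folded Om_def] bd(1) lim_\<phi>[folded Ph_def] bd(3), where J = "var_J t" and s = "var_K1 t" and r = "var_K2 t"]
  have lim: "(\<lambda>n. \<integral>s. complex_of_real (exp (- ?V n s / 2)) \<partial>M) \<longlonglongrightarrow> complex_of_real (exp (- limit_variance t / 2))"
    using tendsto_of_real[OF rv(1)] unfolding limit_variance_def by simp
  have "(\<lambda>n. (\<integral>s. iexp (t \<bullet> Z n s) \<partial>M) - (\<integral>s. complex_of_real (exp (- ?V n s / 2)) \<partial>M)) \<longlonglongrightarrow> 0"
  proof (rule LIMSEQ_I)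
    fix r :: real assume r: "0 < r"
    then have "0 < r / 2" by simp
    from char_stat[OF this \<beta>_nonneg, of t] eventually_gt_at_top[of 0]
    have "\<forall>\<^sub>F n in sequentially. norm ((\<integral>s. iexp (t \<bullet> Z n s) \<partial>M) - (\<integral>s. complex_of_real (exp (- ?V n s / 2)) \<partial>M) - 0) < r"
    proof eventually_elim
      case (elim n)
      let ?\<psi> = "\<lambda>s. \<integral>u. iexp (stat t n (B n s) u) \<partial>samples P n" and ?e = "\<lambda>s. complex_of_real (exp (- ?V n s / 2))"
      interpret S: prob_space "samples P n" by (rule prob_space_samples[OF prob_P])
      have "norm (?\<psi> s) \<le> 1" for s
      proof -
        have "norm (?\<psi> s) \<le> (\<integral>u. norm (iexp (stat t n (B n s) u)) \<partial>samples P n)" by (rule integral_norm_bound)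
        then show ?thesis by (simp add: S.prob_space)
      qed
      then have i1: "integrable M ?\<psi>"
        using char_conditional(2)[OF elim(2)] by (intro M.integrable_const_bound[where B = 1]) auto
      have i2: "integrable M ?e" using rv(2)[of n] by simp
      have "norm ((\<integral>s. ?\<psi> s \<partial>M) - (\<integral>s. ?e s \<partial>M)) = norm (\<integral>s. ?\<psi> s - ?e s \<partial>M)" using i1 i2 by simp
      also have "\<dots> \<le> (\<integral>s. norm (?\<psi> s - ?e s) \<partial>M)" by (rule integral_norm_bound)
      also have "\<dots> \<le> (\<integral>s. r / 2 \<partial>M)"
      proof (rule integral_mono_AE)
        show "integrable M (\<lambda>s. norm (?\<psi> s - ?e s))" using i1 i2 by simp
        show "AE s in M. norm (?\<psi> s - ?e s) \<le> r / 2"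
          using op_bounded_B[of n]
        proof eventually_elim
          case (elim s)
          have "?V n s = quad_var n (B n s) (var_J t) (var_K1 t) (var_K2 t)"
            unfolding Om_def Th_def Ph_def by (rule quad_var_spectral(1)[OF elim, symmetric])
          then show ?case using \<open>\<forall>b. op_bounded n \<beta> b \<longrightarrow> _\<close> elim by (metis less_imp_le)
        qed
      qed simp
      also have "\<dots> = r / 2" by (simp add: M.prob_space)
      finally show ?case unfolding char_conditional(1)[OF elim(2)] using r by simp
    qed
    then show "\<exists>no. \<forall>n\<ge>no. norm ((\<integral>s. iexp (t \<bullet> Z n s) \<partial>M) - (\<integral>s. complex_of_real (exp (- ?V n s / 2)) \<partial>M) - 0) < r"
      by (simp add: eventually_sequentially)
  qed
  from tendsto_add[OF this lim] show ?thesis by simp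
qed

text \<open>Positivity is not visible in the formula, since \<open>var_K2\<close> may be negative; it is inherited from
\<open>\<bar>exp (- limit_variance t / 2)\<bar> \<le> 1\<close>.\<close>

lemma limit_variance_nonneg: "0 \<le> limit_variance t"
proof -
  have "norm (\<integral>s. iexp (t \<bullet> Z n s) \<partial>M) \<le> 1" for n
  proof -
    have "norm (\<integral>s. iexp (t \<bullet> Z n s) \<partial>M) \<le> (\<integral>s. norm (iexp (t \<bullet> Z n s)) \<partial>M)" by (rule integral_norm_bound)
    then show ?thesis by (simp add: M.prob_space)
  qed
  then have "norm (complex_of_real (exp (- limit_variance t / 2))) \<le> 1"
    by (intro LIMSEQ_le_const2[OF tendsto_norm[OF char_Z_tendsto[of t]]]) auto
  then show ?thesis by simp
qed

lemma centered_L2: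
  "square_integrable M (\<lambda>s. zvec x y s $ l - (\<integral>s. zvec x y s $ l \<partial>M))"
  "square_integrable M (\<lambda>s. wvec M x y s $ l - (\<integral>s. wvec M x y s $ l \<partial>M))"
  by (intro square_integrable_diff z_L2 w_L2 square_integrable_const M)+

lemma zeta_measurable: "zeta t \<in> borel_measurable borel" "eta t \<in> borel_measurable borel"
  unfolding zeta_def eta_def
  by (intro borel_measurable_sum borel_measurable_times borel_measurable_diff borel_measurable_add borel_measurable_divide
      borel_measurable_power borel_measurable_const coordinate_measurable)+

lemma zeta_eq: "zeta t (x s, y s) = (\<Sum>i\<in>UNIV. t $ i * (zvec x y s $ i - (\<integral>s. zvec x y s $ i \<partial>M)))"
  unfolding zeta_def z_mean by (simp add: zvec_def)

lemma eta_eq: "eta t (x s, y s) = (\<Sum>i\<in>UNIV. t $ i * (wvec M x y s $ i - (\<integral>s. wvec M x y s $ i \<partial>M)))"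
  unfolding eta_def w_mean by (simp add: wvec_def)

lemma quad_form_K1: "quad_form (cov_mat M (zvec x y) (zvec x y)) t = var_K1 t"
  unfolding quad_form_cov_mat[OF centered_L2(1) centered_L2(1)] zeta_eq[symmetric] var_K1_def moment_def
  by (rule integral_P[symmetric]) (intro borel_measurable_times zeta_measurable)

lemma quad_form_K2:
  "quad_form (cov_mat M (wvec M x y) (wvec M x y) - cov_mat M (wvec M x y) (zvec x y) - cov_mat M (zvec x y) (wvec M x y)) t = var_K2 t"
proof -
  have "moment P (eta t) (eta t) = quad_form (cov_mat M (wvec M x y) (wvec M x y)) t"
    unfolding quad_form_cov_mat[OF centered_L2(2) centered_L2(2)] eta_eq[symmetric] moment_def
    by (rule integral_P) (intro borel_measurable_times zeta_measurable)
  moreover have "moment P (zeta t) (eta t) = quad_form (cov_mat M (zvec x y) (wvec M x y)) t"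
    unfolding quad_form_cov_mat[OF centered_L2(1) centered_L2(2)] zeta_eq[symmetric] eta_eq[symmetric] moment_def
    by (rule integral_P) (intro borel_measurable_times zeta_measurable)
  moreover have "moment P (zeta t) (eta t) = quad_form (cov_mat M (wvec M x y) (zvec x y)) t"
    unfolding quad_form_cov_mat[OF centered_L2(2) centered_L2(1)] zeta_eq[symmetric] eta_eq[symmetric] moment_def
    by (subst mult.commute, rule integral_P) (intro borel_measurable_times zeta_measurable)
  ultimately show ?thesis unfolding var_K2_def quad_form_linear by simp
qed

text \<open>In the sum over \<open>l\<close> and \<open>m\<close>, the products \<open>C\<^sup>x\<^sup>x C\<^sup>y\<^sup>y\<close> come from equal and \<open>C\<^sup>x\<^sup>y C\<^sup>y\<^sup>x\<close> from
exchanged factors of the symmetrized kernel.\<close>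

lemma quad_form_J:
  "quad_form (hadamard (cov_mat M x y) (cov_mat M y x) + hadamard (cov_mat M x x) (cov_mat M y y)) t = var_J t"
proof -
  have m: "moment P F G = (\<integral>s. F (x s, y s) * G (x s, y s) \<partial>M)" if "F \<in> borel_measurable borel" "G \<in> borel_measurable borel" for F G
    unfolding moment_def by (rule integral_P) (intro borel_measurable_times that)
  have c: "(\<lambda>v. c * f l v) \<in> borel_measurable borel" for c l by (intro borel_measurable_times borel_measurable_const coordinate_measurable)
  have "moment P (\<lambda>v. t $ l * f l v) (\<lambda>v. t $ m * f m v) = t $ l * t $ m * cov_mat M x x $ l $ m"
    "moment P (h l) (h m) = cov_mat M y y $ l $ m"
    "moment P (\<lambda>v. t $ l * f l v) (h m) = t $ l * cov_mat M x y $ l $ m"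
    "moment P (h l) (\<lambda>v. t $ m * f m v) = t $ m * cov_mat M y x $ l $ m" for l m
    unfolding m[OF c c] m[OF coordinate_measurable(2) coordinate_measurable(2)] m[OF c coordinate_measurable(2)] m[OF coordinate_measurable(2) c]
    by (simp_all add: cov_mat_def x_mean y_mean mult_ac)
  then show ?thesis unfolding var_J_def kernel_variance_def quad_form_eq
    by (intro sum.cong refl) (simp add: algebra_simps)
qed

end

theorem proposition9:
  fixes M :: "'a measure"
    and x y :: "'a \<Rightarrow> real ^ 'm"
    and X Y :: "nat \<Rightarrow> nat \<Rightarrow> 'a \<Rightarrow> real ^ 'm"
    and B :: "nat \<Rightarrow> 'a \<Rightarrow> nat \<Rightarrow> nat \<Rightarrow> real"
    and \<beta> \<omega> \<theta> \<phi> :: real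
    and J K1 K2 K D :: "real ^ 'm ^ 'm"
  assumes "prob_space M"
    and "x \<in> borel_measurable M" and "y \<in> borel_measurable M"
    and "\<And>l. integrable M (\<lambda>s. (x s $ l)\<^sup>2)" and "\<And>l. integrable M (\<lambda>s. (y s $ l)\<^sup>2)"
    and "\<And>l. (\<integral>s. x s $ l \<partial>M) = 0" and "\<And>l. (\<integral>s. y s $ l \<partial>M) = 0"
    and "\<And>l. cov_mat M x x $ l $ l = 1" and "\<And>l. cov_mat M y y $ l $ l = 1"
    and "\<And>l. integrable M (\<lambda>s. (zvec x y s $ l)\<^sup>2)"
    and "\<And>l. integrable M (\<lambda>s. (wvec M x y s $ l)\<^sup>2)"
    and "\<And>n. iid_observations M x y n (X n) (Y n)"
    and "\<And>n. indep_of_data M n (B n) (X n) (Y n)"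
    and "\<And>n. AE s in M. \<forall>i<n. \<forall>j<n. B n s i j = B n s j i"
    and "\<And>n. AE s in M. spectral_norm n (B n s) \<le> \<beta>"
    and "converges_in_probability M (\<lambda>n s. (\<Sum>i<n. (B n s i i)\<^sup>2) / real n) \<omega>"
    and "converges_in_probability M (\<lambda>n s. tr n (mmult n (B n s) (B n s)) / real n) \<theta>"
    and "converges_in_probability M (\<lambda>n s. (tr n (B n s) / real n)\<^sup>2) \<phi>"
  defines "J \<equiv> hadamard (cov_mat M x y) (cov_mat M y x) + hadamard (cov_mat M x x) (cov_mat M y y)"
    and "K1 \<equiv> cov_mat M (zvec x y) (zvec x y)"
    and "K2 \<equiv> cov_mat M (wvec M x y) (wvec M x y)
              - cov_mat M (wvec M x y) (zvec x y) - cov_mat M (zvec x y) (wvec M x y)"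
    and "K \<equiv> K1 - J"
    and "D \<equiv> (\<theta> - \<omega>) *\<^sub>R J + \<omega> *\<^sub>R K1 + \<phi> *\<^sub>R K2"
  shows "(\<exists>N. multivariate_normal 0 D N \<and>
              converges_in_distribution M (\<lambda>n. bilinear_stat M x y n (B n) (X n) (Y n)) N)
         \<and> D = \<theta> *\<^sub>R J + \<omega> *\<^sub>R K + \<phi> *\<^sub>R K2"
proof
  interpret bilinear_setting M x y X Y B \<beta> \<omega> \<theta> \<phi>
    by (rule bilinear_setting.intro) (rule assms(1-18))+
  have J: "quad_form J t = var_J t" and K1: "quad_form K1 t = var_K1 t" and K2: "quad_form K2 t = var_K2 t" for t
    unfolding J_def K1_def K2_def by (rule quad_form_J quad_form_K1 quad_form_K2)+
  have q: "quad_form D t = limit_variance t" for t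
    unfolding D_def limit_variance_def quad_form_linear J K1 K2 ..
  have sym: "transpose D = D"
    unfolding D_def J_def K1_def K2_def transpose_linear transpose_cov_mat by (simp add: mult.commute)
  have psd: "0 \<le> quad_form D t" for t unfolding q by (rule limit_variance_nonneg)
  obtain N where N: "prob_space N" "sets N = sets borel"
    "\<And>t. (\<integral>v. iexp (t \<bullet> v) \<partial>N) = complex_of_real (exp (- quad_form D t / 2))"
    using gaussian_exists_on[OF finite_class.finite_UNIV sym psd] by blast
  have "multivariate_normal 0 D N"
    using psd N(3) unfolding quad_form_def by (intro multivariate_normal_from_char sym N(1,2))
  moreover have "converges_in_distribution M Z N"
    by (rule levy_continuity_euclidean[OF M Z_measurable N(1,2)]) (use char_Z_tendsto in \<open>simp only: N(3) q\<close>)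
  ultimately show "\<exists>N. multivariate_normal 0 D N \<and>
      converges_in_distribution M (\<lambda>n. bilinear_stat M x y n (B n) (X n) (Y n)) N"
    unfolding Z_def[abs_def] by blast
  show "D = \<theta> *\<^sub>R J + \<omega> *\<^sub>R K + \<phi> *\<^sub>R K2"
    unfolding D_def K_def by (simp add: scaleR_left_diff_distrib scaleR_right_diff_distrib)
qed

end
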